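(* Let $\mathbb{F}$ be a field of characteristic $p>0$, let $0\neq h\in\mathbb{F}[x]$, and let $A=A_h$ be the unital $\mathbb{F}$-algebra generated by $x$ and $\hat y$ subject to $\hat y x-x\hat y=h$. Let $\mathsf{Z}(A)$ denote the center of $A$. Then the Hochschild cohomology $\mathrm{HH}^2(A)$ is a free $\mathsf{Z}(A)$-module if and only if $\gcd(h,h')=1$. In this case $\mathrm{HH}^2(A)$ has rank one over $\mathsf{Z}(A)$ and, moreover, $\mathrm{HH}^\bullet(A)=\bigoplus_{n\geq0}\mathrm{HH}^n(A)$ is a free $\mathsf{Z}(A)$-module.
   Context: $h'$ denotes the derivative of $h$ with respect to $x$, and $\gcd$ is taken monic. $\mathrm{HH}^n(A)$ is the Hochschild cohomology of $A$ with coefficients in $A$, which is naturally a module over $\mathsf{Z}(A)=\mathrm{HH}^0(A)$. *)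

theory Defs
  imports "HOL-Computational_Algebra.Computational_Algebra"
begin

text \<open>The algebra A_h = F<x, y> / (y x - x y - h), realised concretely by its
  PBW normal form (Ore extension F[x][y; D] with D = h d/dx): an element
  sum_k f_k(x) y^k is stored as the polynomial in y (type 'a poly poly) whose
  k-th coefficient is the left coefficient f_k(x).  Addition is that of
  'a poly poly; the product is defined by the rule
  y^k g = sum_j (k choose j) D^j(g) y^(k-j).\<close>

definition Dh :: "'a::field poly \<Rightarrow> 'a poly \<Rightarrow> 'a poly" where
  "Dh h g = h * pderiv g"

definition Amult :: "'a::field poly \<Rightarrow> 'a poly poly \<Rightarrow> 'a poly poly \<Rightarrow> 'a poly poly" where
  "Amult h a b = (\<Sum>k\<le>degree a. \<Sum>j\<le>k.
      smult (coeff a k * of_nat (k choose j)) (map_poly ((Dh h) ^^ j) b * monom 1 (k - j)))"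

definition Ax :: "'a::field poly poly" where "Ax = [:[:0, 1:]:]"
definition Ay :: "'a::field poly poly" where "Ay = monom 1 1"

definition Asc :: "'a::field \<Rightarrow> 'a poly poly \<Rightarrow> 'a poly poly" where
  "Asc c a = smult [:c:] a"

definition Acenter :: "'a::field poly \<Rightarrow> 'a poly poly set" where
  "Acenter h = {z. \<forall>a. Amult h z a = Amult h a z}"

text \<open>Hochschild cochains: an F-multilinear map A^n -> A, i.e. an element of
  Hom_F(A^{\<otimes>n}, A), is a function on lists of length n.  A function on all
  lists which is multilinear in every argument and nonzero only in finitely
  many lengths is an element of the total cochain space (direct sum over n).\<close>
definition multilin :: "('a::field poly poly list \<Rightarrow> 'a poly poly) \<Rightarrow> bool" where
  "multilin f \<longleftrightarrow>
     (\<forall>us vs a b. f (us @ (a + b) # vs) = f (us @ a # vs) + f (us @ b # vs)) \<and>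
     (\<forall>us vs c a. f (us @ Asc c a # vs) = Asc c (f (us @ a # vs)))"

definition cochain :: "('a::field poly poly list \<Rightarrow> 'a poly poly) \<Rightarrow> bool" where
  "cochain f \<longleftrightarrow> multilin f \<and> finite {n. \<exists>xs. length xs = n \<and> f xs \<noteq> 0}"

definition deg_cochain :: "nat \<Rightarrow> ('a::field poly poly list \<Rightarrow> 'a poly poly) \<Rightarrow> bool" where
  "deg_cochain n f \<longleftrightarrow> multilin f \<and> (\<forall>xs. length xs \<noteq> n \<longrightarrow> f xs = 0)"

definition hdiff :: "'a::field poly \<Rightarrow> ('a poly poly list \<Rightarrow> 'a poly poly) \<Rightarrow> 'a poly poly list \<Rightarrow> 'a poly poly" where
  "hdiff h f xs = (if xs = [] then 0 else
     Amult h (hd xs) (f (tl xs))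
     + (\<Sum>i<length xs - 1. (-1) ^ (i + 1) *
          f (take i xs @ Amult h (xs ! i) (xs ! (i + 1)) # drop (i + 2) xs))
     + (-1) ^ length xs * Amult h (f (butlast xs)) (last xs))"

definition cocycles :: "'a::field poly \<Rightarrow> ('a poly poly list \<Rightarrow> 'a poly poly) set" where
  "cocycles h = {f. cochain f \<and> hdiff h f = (\<lambda>_. 0)}"

definition coboundaries :: "'a::field poly \<Rightarrow> ('a poly poly list \<Rightarrow> 'a poly poly) set" where
  "coboundaries h = {hdiff h g | g. cochain g}"

definition cocycles_deg :: "'a::field poly \<Rightarrow> nat \<Rightarrow> ('a poly poly list \<Rightarrow> 'a poly poly) set" where
  "cocycles_deg h n = {f. deg_cochain n f \<and> hdiff h f = (\<lambda>_. 0)}"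

definition coboundaries_deg :: "'a::field poly \<Rightarrow> nat \<Rightarrow> ('a poly poly list \<Rightarrow> 'a poly poly) set" where
  "coboundaries_deg h n = coboundaries h \<inter> {f. deg_cochain n f}"

text \<open>S is a set of cocycles whose classes form a basis of the Z(A)-module
  Zs/Bs (Z(A) acting by left multiplication on values).  Independence
  includes that distinct elements of S have distinct classes.\<close>
definition HH_basis :: "'a::field poly \<Rightarrow> ('a poly poly list \<Rightarrow> 'a poly poly) set
    \<Rightarrow> ('a poly poly list \<Rightarrow> 'a poly poly) set \<Rightarrow> ('a poly poly list \<Rightarrow> 'a poly poly) set \<Rightarrow> bool" where
  "HH_basis h Zs Bs S \<longleftrightarrow> S \<subseteq> Zs \<and>
     (\<forall>f\<in>Zs. \<exists>z. finite {s\<in>S. z s \<noteq> 0} \<and> (\<forall>s\<in>S. z s \<in> Acenter h) \<and>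
        (\<lambda>xs. f xs - (\<Sum>s\<in>{s\<in>S. z s \<noteq> 0}. Amult h (z s) (s xs))) \<in> Bs) \<and>
     (\<forall>z. finite {s\<in>S. z s \<noteq> 0} \<and> (\<forall>s\<in>S. z s \<in> Acenter h) \<and>
        (\<lambda>xs. \<Sum>s\<in>{s\<in>S. z s \<noteq> 0}. Amult h (z s) (s xs)) \<in> Bs \<longrightarrow> (\<forall>s\<in>S. z s = 0))"

definition HH_free :: "'a::field poly \<Rightarrow> ('a poly poly list \<Rightarrow> 'a poly poly) set
    \<Rightarrow> ('a poly poly list \<Rightarrow> 'a poly poly) set \<Rightarrow> bool" where
  "HH_free h Zs Bs \<longleftrightarrow> (\<exists>S. HH_basis h Zs Bs S)"

end

theory Submission
  imports Defs "HOL-Library.Product_Plus" "HOL-Library.Function_Algebras"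
begin

text \<open>
  A cochain of degree \<open>n + 2\<close> is a 2-cochain with values in the bimodule of cochains of degree
  \<open>n\<close>, so only 2-cocycles \<open>F\<close> with values in a bimodule have to be understood.  A cochain \<open>G\<close> with
  coboundary \<open>F\<close> is a splitting of the extension defined by \<open>F\<close>; as \<open>A\<close> is presented by the single
  relation \<open>y x = x y + h\<close>, it is determined by its values \<open>u\<close>, \<open>v\<close> at \<open>x\<close>, \<open>y\<close>, and the only
  obstruction is the image of the relation.  For bimodules of cochains of positive degree the
  obstruction can always be removed, so the cohomology vanishes in degrees at least 3, and
  in degree 2 it is the cokernel of the obstruction map \<open>A \<times> A \<rightarrow> A\<close> for zero \<open>F\<close>.

  To compute the cokernel, write \<open>y = h \<partial>\<close> with \<open>\<partial> x - x \<partial> = 1\<close>.  The elements \<open>e\<^sub>k = h\<^sup>k \<partial>\<^sup>k\<close> form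
  an \<open>F[x]\<close>-basis of \<open>A\<close> with \<open>[e\<^sub>k, x] = k h e\<^bsub>k-1\<^esub>\<close>, the centre is \<open>F[x\<^sup>p, e\<^sub>p]\<close>, and modulo the
  image of \<open>[-, x]\<close> the obstruction map is \<open>f e\<^sub>k \<mapsto> (h' f - h f') e\<^sub>k\<close>.  The cokernel is thus the sum of
  copies of \<open>F[x] / (h, h')\<close> for \<open>k + 1\<close> prime to \<open>p\<close>, which are torsion, and of the cokernel of
  \<open>f \<mapsto> h f' - h' f\<close> for \<open>k + 1\<close> divisible by \<open>p\<close>.  If \<open>h\<close> and \<open>h'\<close> are coprime, the former vanish
  and \<open>g \<mapsto> (d/dx)\<^bsup>p-1\<^esup> (h\<^bsup>p-2\<^esup> g)\<close> identifies the latter with \<open>F[x\<^sup>p]\<close>.  Otherwise the class with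
  obstruction 1 is not zero and is annihilated by the central element \<open>h\<^sup>p\<close>.  Derivations are
  treated in the same way, with \<open>h\<^bsup>p-1\<^esup>\<close> instead of \<open>h\<^bsup>p-2\<^esup>\<close>.
\<close>

section \<open>The Ore extension\<close>

text \<open>Pascal's rule for words in two commuting operators: \<open>t j i\<close> stands for
  \<open>j\<close> derivations and \<open>i\<close> shifts, and a further application of their sum
  raises one of the two indices. It drives the binomial formula \<open>Yop_power\<close>.\<close>

lemma pascal_sum:
  fixes t :: "nat \<Rightarrow> nat \<Rightarrow> 'b::comm_semiring_1"
  shows "(\<Sum>j\<le>k. of_nat (k choose j) * (t j (Suc (k - j)) + t (Suc j) (k - j)))
       = (\<Sum>j\<le>Suc k. of_nat (Suc k choose j) * t j (Suc k - j))"
proof -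
  have "(\<Sum>j\<le>Suc k. of_nat (Suc k choose j) * t j (Suc k - j))
      = t 0 (Suc k) + (\<Sum>j\<le>k. of_nat (k choose Suc j) * t (Suc j) (k - j))
        + (\<Sum>j\<le>k. of_nat (k choose j) * t (Suc j) (k - j))"
    by (subst sum.atMost_Suc_shift) (simp add: sum.distrib algebra_simps)
  also have "t 0 (Suc k) + (\<Sum>j\<le>k. of_nat (k choose Suc j) * t (Suc j) (k - j))
      = (\<Sum>j\<le>Suc k. of_nat (k choose j) * t j (Suc k - j))"
    by (subst sum.atMost_Suc_shift) simp
  also have "\<dots> = (\<Sum>j\<le>k. of_nat (k choose j) * t j (Suc (k - j)))"
    by (simp add: Suc_diff_le binomial_eq_0)
  finally show ?thesis
    by (simp add: sum.distrib algebra_simps)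
qed

lemma smult_sum_right: "smult c (sum f A) = (\<Sum>i\<in>A. smult c (f i))"
  by (induction A rule: infinite_finite_induct) (auto simp: smult_add_right)

locale ore_algebra =
  fixes h :: "'a::field poly"
begin

abbreviation mul :: "'a poly poly \<Rightarrow> 'a poly poly \<Rightarrow> 'a poly poly" (infixl "\<star>" 70)
  where "a \<star> b \<equiv> Amult h a b"

abbreviation C :: "'a poly \<Rightarrow> 'a poly poly" where "C q \<equiv> [:q:]"

lemma Dh_add: "Dh h (f + g) = Dh h f + Dh h g"
  by (simp add: Dh_def pderiv_add algebra_simps)

lemma Dh_mult: "Dh h (f * g) = f * Dh h g + g * Dh h f"
  by (simp add: Dh_def pderiv_mult algebra_simps)

lemma Dh_0 [simp]: "Dh h 0 = 0" and Dh_1 [simp]: "Dh h 1 = 0"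
  by (simp_all add: Dh_def)

lemma Dh_power_0 [simp]: "(Dh h ^^ j) 0 = 0"
  by (induction j) auto

text \<open>Left multiplication by \<open>y\<close>, as \<open>mul_Y\<close> confirms: moving
  \<open>y\<close> past each coefficient by \<open>y f = f y + D f\<close> produces a shift and a
  coefficientwise derivation.\<close>

definition Yop :: "'a poly poly \<Rightarrow> 'a poly poly" where
  "Yop b = pCons 0 b + map_poly (Dh h) b"

lemma Yop_add: "Yop (a + b) = Yop a + Yop b"
  by (rule poly_eqI) (auto simp: Yop_def coeff_map_poly coeff_pCons Dh_add algebra_simps split: nat.splits)

lemma Yop_0 [simp]: "Yop 0 = 0"
  by (simp add: Yop_def)

lemma Yop_smult: "Yop (smult f b) = smult f (Yop b) + smult (Dh h f) b"
  by (rule poly_eqI) (auto simp: Yop_def coeff_map_poly coeff_pCons Dh_mult algebra_simps split: nat.splits)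

lemma Yop_sum: "Yop (sum f A) = (\<Sum>i\<in>A. Yop (f i))"
  by (induction A rule: infinite_finite_induct) (auto simp: Yop_add)

lemma Dh_of_nat [simp]: "Dh h (of_nat n) = 0"
  by (simp add: Dh_def)

lemma Yop_monom: "Yop (monom f k) = monom f (Suc k) + monom (Dh h f) k"
  by (simp add: Yop_def monom_Suc map_poly_monom)

lemma Yop_power_add: "(Yop ^^ k) (a + b) = (Yop ^^ k) a + (Yop ^^ k) b"
  by (induction k) (auto simp: Yop_add)

lemma Yop_power_0 [simp]: "(Yop ^^ k) 0 = 0"
  by (induction k) auto

lemma Yop_step: "Yop (map_poly (Dh h ^^ j) b * monom 1 i)
    = map_poly (Dh h ^^ j) b * monom 1 (Suc i) + map_poly (Dh h ^^ Suc j) b * monom 1 i"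
  by (rule poly_eqI)
     (auto simp: Yop_def coeff_map_poly coeff_pCons coeff_monom_mult mult.commute[of _ "monom 1 _"] split: nat.splits)

lemma of_nat_smult: "of_nat n * c = smult (of_nat n) c" for c :: "'a poly poly"
  by (simp add: of_nat_poly)

lemma Yop_power: "(Yop ^^ k) b
    = (\<Sum>j\<le>k. of_nat (k choose j) * (map_poly (Dh h ^^ j) b * monom 1 (k - j)))"
proof (induction k)
  case (Suc k)
  have "(Yop ^^ Suc k) b = (\<Sum>j\<le>k. of_nat (k choose j) *
      (map_poly (Dh h ^^ j) b * monom 1 (Suc (k - j)) + map_poly (Dh h ^^ Suc j) b * monom 1 (k - j)))"
    using Suc by (simp add: Yop_sum of_nat_smult Yop_smult Yop_step funpow.simps(2)[of k Yop]
      del: funpow.simps)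
  thus ?case
    by (simp only: pascal_sum [where t = "\<lambda>j i. map_poly (Dh h ^^ j) b * monom 1 i"])
qed (auto simp: map_poly_id')

text \<open>This replaces the binomial definition by iterates of one operator. The ring laws below
  are derived from this form.\<close>

lemma Amult_altdef: "a \<star> b = (\<Sum>k\<le>degree a. smult (coeff a k) ((Yop ^^ k) b))"
  unfolding Amult_def Yop_power
  by (intro sum.cong refl) (simp add: smult_sum_right of_nat_smult)

lemma Amult_eq_sum: "degree a \<le> n \<Longrightarrow> a \<star> b = (\<Sum>k\<le>n. smult (coeff a k) ((Yop ^^ k) b))"
  unfolding Amult_altdef by (rule sum.mono_neutral_left) (auto simp: coeff_eq_0)

lemma mul_add_left: "(a + b) \<star> c = a \<star> c + b \<star> c"
proof -
  define n where "n = max (degree a) (degree b)"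
  have "degree a \<le> n" "degree b \<le> n" "degree (a + b) \<le> n"
    by (auto simp: n_def degree_add_le_max)
  thus ?thesis
    by (simp add: Amult_eq_sum smult_add_left sum.distrib)
qed

lemma mul_add_right: "a \<star> (b + c) = a \<star> b + a \<star> c"
  by (simp add: Amult_altdef Yop_power_add smult_add_right sum.distrib)

lemma mul_smult_left: "smult f a \<star> b = smult f (a \<star> b)"
proof -
  have "degree (smult f a) \<le> degree a"
    by (rule degree_smult_le)
  thus ?thesis
    by (simp add: Amult_eq_sum[of "smult f a" "degree a"] Amult_altdef[of a] smult_sum_right)
qed

lemma mul_0_left [simp]: "0 \<star> b = 0" and mul_0_right [simp]: "a \<star> 0 = 0"
  by (simp_all add: Amult_altdef)

lemma mul_C: "C f \<star> b = smult f b"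
  by (simp add: Amult_altdef)

lemma mul_1_left [simp]: "1 \<star> b = b"
  by (simp add: Amult_altdef)

lemma mul_monom: "monom 1 k \<star> b = (Yop ^^ k) b"
proof -
  have "degree (monom (1::'a poly) k) = k" by (simp add: degree_monom_eq)
  hence "monom 1 k \<star> b = (\<Sum>i\<le>k. smult (if i = k then 1 else 0) ((Yop ^^ i) b))"
    by (simp add: Amult_altdef eq_commute)
  also have "\<dots> = (\<Sum>i\<le>k. if i = k then (Yop ^^ i) b else 0)"
    by (intro sum.cong) auto
  finally show ?thesis by simp
qed

lemma mul_Y: "Ay \<star> b = Yop b"
  by (simp add: Ay_def mul_monom)

lemma mul_X: "Ax \<star> b = smult [:0, 1:] b"
  by (simp add: Ax_def mul_C)

lemma mul_sum_left: "sum f A \<star> b = (\<Sum>i\<in>A. f i \<star> b)"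
  by (induction A rule: infinite_finite_induct) (auto simp: mul_add_left)

lemma mul_sum_right: "b \<star> sum f A = (\<Sum>i\<in>A. b \<star> f i)"
  by (induction A rule: infinite_finite_induct) (auto simp: mul_add_right)

lemma pp_eq_sum: "a = (\<Sum>k\<le>degree a. smult (coeff a k) (monom 1 k))" for a :: "'a poly poly"
  by (subst poly_as_sum_of_monoms [symmetric]) (simp add: smult_monom)

text \<open>Associativity when the left factor is \<open>y\<close>: on each term
  \<open>f y\<^sup>k\<close> of \<open>a\<close> both sides follow the Leibniz rule
  \<open>Yop_smult\<close>. Iterating gives \<open>mul_assoc\<close>.\<close>

lemma Yop_mul: "Yop a \<star> b = Yop (a \<star> b)"
proof -
  have m: "Yop (monom 1 k) = monom 1 (Suc k)" for k
    by (simp add: Yop_monom)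
  have "Yop a \<star> b = (\<Sum>k\<le>degree a. (smult (coeff a k) (monom 1 (Suc k)) + smult (Dh h (coeff a k)) (monom 1 k)) \<star> b)"
    by (subst pp_eq_sum[of a]) (simp only: Yop_sum Yop_smult m mul_sum_left)
  also have "\<dots> = Yop (\<Sum>k\<le>degree a. smult (coeff a k) (monom 1 k) \<star> b)"
    by (simp add: Yop_sum mul_add_left mul_smult_left mul_monom Yop_smult)
  also have "\<dots> = Yop (a \<star> b)"
    by (subst (2) pp_eq_sum[of a]) (simp only: mul_sum_left)
  finally show ?thesis .
qed

lemma Yop_power_mul: "(Yop ^^ k) a \<star> b = (Yop ^^ k) (a \<star> b)"
  by (induction k) (auto simp: Yop_mul)

lemma mul_assoc: "(a \<star> b) \<star> c = a \<star> (b \<star> c)"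
  by (simp add: Amult_altdef[of a] mul_sum_left mul_smult_left Yop_power_mul)

lemma mul_1_right [simp]: "a \<star> 1 = a"
proof -
  have "(Yop ^^ k) 1 = monom 1 k" for k
    by (induction k) (auto simp: Yop_monom monom_0)
  thus ?thesis
    by (simp add: Amult_altdef flip: pp_eq_sum)
qed

lemma mul_minus_left [simp]: "(- a) \<star> b = - (a \<star> b)"
  using mul_add_left[of a "- a" b] by (simp add: eq_neg_iff_add_eq_0 add.commute)

lemma mul_minus_right [simp]: "a \<star> (- b) = - (a \<star> b)"
  using mul_add_right[of a b "- b"] by (simp add: eq_neg_iff_add_eq_0 add.commute)

lemma mul_diff_left: "(a - b) \<star> c = a \<star> c - b \<star> c"
  using mul_add_left[of a "- b" c] by simp

lemma mul_diff_right: "a \<star> (b - c) = a \<star> b - a \<star> c"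
  using mul_add_right[of a b "- c"] by simp

lemmas mul_distribs = mul_add_left mul_add_right mul_diff_left mul_diff_right

lemma Asc_eq: "Asc c a = C [:c:] \<star> a"
  by (simp add: Asc_def mul_C)

lemma mul_scalar: "a \<star> C [:c:] = C [:c:] \<star> a"
proof -
  have "Yop (smult [:c:] b) = smult [:c:] (Yop b)" for b
    by (simp add: Yop_smult Dh_def pderiv_pCons)
  hence "(Yop ^^ k) (smult [:c:] b) = smult [:c:] ((Yop ^^ k) b)" for k b
    by (induction k) auto
  hence "a \<star> smult [:c:] b = smult [:c:] (a \<star> b)" for b
    by (simp add: Amult_altdef smult_sum_right mult.commute)
  from this[of 1] show ?thesis by (simp add: mul_C)
qed

lemma mul_Asc_right: "a \<star> Asc c b = Asc c (a \<star> b)"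
  unfolding Asc_eq by (metis mul_assoc mul_scalar)

lemma mul_Asc_left: "Asc c a \<star> b = Asc c (a \<star> b)"
  unfolding Asc_eq by (metis mul_assoc)

lemma Y_C: "Ay \<star> C f = C f \<star> Ay + C (h * pderiv f)"
  unfolding mul_Y mul_C by (simp add: Yop_def Ay_def monom_Suc monom_0 map_poly_pCons Dh_def flip: one_pCons)

lemma YX: "Ay \<star> Ax = Ax \<star> Ay + C h"
  unfolding Ax_def by (subst Y_C) (simp add: pderiv_pCons)

text \<open>The normal form builds every element from scalars by sums and left multiplications by
  \<open>x\<close> and \<open>y\<close>. A map given by recursion on the leftmost generator can
  therefore be treated by induction.\<close>

lemma ore_induct [consumes 0, case_names scalar add X Y]:
  assumes s: "\<And>c. P (C [:c:])" and add: "\<And>a b. P a \<Longrightarrow> P b \<Longrightarrow> P (a + b)"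
    and X: "\<And>a. P a \<Longrightarrow> P (Ax \<star> a)" and Y: "\<And>a. P a \<Longrightarrow> P (Ay \<star> a)"
  shows "P a"
proof -
  have mX: "P (C q \<star> a)" if "\<And>c. P (C [:c:] \<star> a)" for q a
  proof (induction q)
    case (pCons c q)
    have "C (pCons c q) \<star> a = C [:c:] \<star> a + Ax \<star> (C q \<star> a)"
      by (simp add: Ax_def mul_C flip: smult_add_left)
    with pCons that X add show ?case by metis
  qed (use that[of 0] in simp)
  have Ysc: "P (C [:c:] \<star> monom 1 k)" for c k
  proof (induction k)
    case (Suc k)
    have "C [:c:] \<star> monom 1 (Suc k) = Ay \<star> (C [:c:] \<star> monom 1 k)"
      by (metis mul_assoc mul_scalar mul_Y Yop_monom Dh_1 monom_0 add.right_neutral monom_eq_0_iff)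
    with Suc Y show ?case by simp
  qed (use s in \<open>simp add: monom_0 mul_C\<close>)
  have "P (\<Sum>k\<le>n. smult (f k) (monom 1 k))" for n f
  proof (induction n)
    case 0 show ?case using mX[OF Ysc, of "f 0" 0] by (simp add: mul_C)
  next
    case (Suc n) thus ?case using mX[OF Ysc] add by (simp add: mul_C)
  qed
  thus ?thesis by (subst pp_eq_sum)
qed

section \<open>Cochains as bimodules\<close>

text \<open>The part of \<open>hdiff\<close> that remains when the left action on the values is replaced by zero.\<close>
fun tdiff :: "('a poly poly list \<Rightarrow> 'a poly poly) \<Rightarrow> 'a poly poly list \<Rightarrow> 'a poly poly" where
  "tdiff f [] = 0"
| "tdiff f [a] = - (f [] \<star> a)"
| "tdiff f (a # b # xs) = - f ((a \<star> b) # xs) - tdiff (\<lambda>ys. f (a # ys)) (b # xs)"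

text \<open>Fixing the first argument passes one minus sign on to the rest, so the recursion
  produces the alternating signs of \<open>hdiff\<close>.\<close>

lemma tdiff_eq_sum:
  "tdiff f (a # xs) = (\<Sum>i<length xs. (-1) ^ (i + 1) *
      f (take i (a # xs) @ ((a # xs) ! i \<star> (a # xs) ! (i + 1)) # drop (i + 2) (a # xs)))
    + (-1) ^ (length xs + 1) * (f (butlast (a # xs)) \<star> last (a # xs))"
proof (induction xs arbitrary: f a)
  case (Cons b xs)
  show ?case
    by (subst list.size, simp only: One_nat_def add_Suc_right add_0_right, subst sum.lessThan_Suc_shift)
       (simp add: Cons sum_negf)
qed simp

lemma hdiff_Nil [simp]: "hdiff h f [] = 0"
  by (simp add: hdiff_def)

lemma hdiff_Cons: "hdiff h f (a # xs) = a \<star> f xs + tdiff f (a # xs)"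
  unfolding hdiff_def tdiff_eq_sum by simp

lemma tdiff_add: "tdiff (\<lambda>ys. f ys + g ys) xs = tdiff f xs + tdiff g xs"
  by (induction f xs arbitrary: g rule: tdiff.induct) (auto simp: mul_add_left)

lemma tdiff_uminus: "tdiff (\<lambda>ys. - f ys) xs = - tdiff f xs"
  by (induction f xs rule: tdiff.induct) auto

lemma tdiff_diff: "tdiff (\<lambda>ys. f ys - g ys) xs = tdiff f xs - tdiff g xs"
  using tdiff_add[of f "\<lambda>ys. - g ys" xs] by (simp add: tdiff_uminus)

lemma tdiff_zero: "tdiff (\<lambda>ys. 0) xs = 0"
  using tdiff_diff[of "\<lambda>ys. 0" "\<lambda>ys. 0" xs] by simp

lemma tdiff_mul_left: "tdiff (\<lambda>ys. a \<star> f ys) xs = a \<star> tdiff f xs"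
  by (induction f xs rule: tdiff.induct) (auto simp: mul_assoc mul_diff_right)

lemma tdiff_cong:
  assumes "\<And>ys. length ys + 1 = length xs \<Longrightarrow> f ys = g ys"
  shows "tdiff f xs = tdiff g xs"
  using assms
proof (induction f xs arbitrary: g rule: tdiff.induct)
  case (3 f a b xs)
  have "tdiff (\<lambda>ys. f (a # ys)) (b # xs) = tdiff (\<lambda>ys. g (a # ys)) (b # xs)"
    by (rule 3) (use 3(2) in auto)
  thus ?case using 3(2) by simp
qed auto

lemma hdiff_cong:
  assumes "\<And>ys. length ys + 1 = length xs \<Longrightarrow> f ys = g ys"
  shows "hdiff h f xs = hdiff h g xs"
proof (cases xs)
  case (Cons a xs')
  thus ?thesis using tdiff_cong[of xs f g] assms by (simp add: hdiff_Cons)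
qed simp

text \<open>Associativity of the product makes the double contractions cancel. In terms of
  \<open>ract\<close> this is the associativity of the right action,
  \<open>ract_mul\<close>.\<close>

lemma tdiff_tdiff:
  "tdiff (\<lambda>ys. tdiff \<phi> (a # ys)) (b # xs) = - tdiff \<phi> ((a \<star> b) # xs)"
proof (induction xs arbitrary: \<phi> a b)
  case (Cons c xs)
  have "tdiff (\<lambda>ys. tdiff \<phi> (a # ys)) (b # c # xs) =
      - tdiff \<phi> (a # (b \<star> c) # xs) - tdiff (\<lambda>ys. - \<phi> ((a \<star> b) # ys) - tdiff (\<lambda>zs. \<phi> (a # zs)) (b # ys)) (c # xs)"
    by simp
  also have "tdiff (\<lambda>ys. - \<phi> ((a \<star> b) # ys) - tdiff (\<lambda>zs. \<phi> (a # zs)) (b # ys)) (c # xs)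
      = - tdiff (\<lambda>ys. \<phi> ((a \<star> b) # ys)) (c # xs) + tdiff (\<lambda>zs. \<phi> (a # zs)) ((b \<star> c) # xs)"
    by (subst tdiff_diff, subst tdiff_uminus, subst Cons) simp
  finally show ?case
    by (simp add: mul_assoc)
qed (simp add: mul_assoc)

lemma multilinI:
  assumes "\<And>us vs a b. f (us @ (a + b) # vs) = f (us @ a # vs) + f (us @ b # vs)"
    and "\<And>us vs c a. f (us @ Asc c a # vs) = Asc c (f (us @ a # vs))"
  shows "multilin f"
  using assms by (auto simp: multilin_def)

lemma multilin_add: "multilin f \<Longrightarrow> f (us @ (a + b) # vs) = f (us @ a # vs) + f (us @ b # vs)"
  and multilin_Asc: "multilin f \<Longrightarrow> f (us @ Asc c a # vs) = Asc c (f (us @ a # vs))"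
  by (auto simp: multilin_def)

lemma multilin_add_hd: "multilin f \<Longrightarrow> f ((a + b) # vs) = f (a # vs) + f (b # vs)"
  and multilin_Asc_hd: "multilin f \<Longrightarrow> f (Asc c a # vs) = Asc c (f (a # vs))"
  using multilin_add[of f "[]"] multilin_Asc[of f "[]"] by auto

lemma multilin_Cons: "multilin f \<Longrightarrow> multilin (\<lambda>ys. f (a # ys))"
  unfolding multilin_def by (metis append_Cons)

lemma Asc_add: "Asc c (a + b) = Asc c a + Asc c b"
  and Asc_diff: "Asc c (a - b) = Asc c a - Asc c b"
  and Asc_minus: "Asc c (- a) = - Asc c a"
  and Asc_0 [simp]: "Asc c 0 = 0"
  by (simp_all add: Asc_def smult_add_right smult_diff_right)

lemma tdiff_Asc: "tdiff (\<lambda>ys. Asc c (f ys)) xs = Asc c (tdiff f xs)"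
  by (simp add: Asc_eq tdiff_mul_left)

lemma multilin_tdiff:
  assumes "multilin f"
  shows "multilin (tdiff f)"
proof (rule multilinI)
  fix us vs :: "'a poly poly list" and a b :: "'a poly poly"
  show "tdiff f (us @ (a + b) # vs) = tdiff f (us @ a # vs) + tdiff f (us @ b # vs)"
    using assms
  proof (induction us arbitrary: f)
    case Nil
    show ?case
      by (cases vs) (simp_all add: mul_distribs multilin_add_hd[OF Nil] tdiff_add)
  next
    case (Cons u us f)
    note IH = Cons(1)[OF multilin_Cons[OF Cons(2)]]
    show ?case
    proof (cases us)
      case Nil
      with IH show ?thesis by (simp add: mul_distribs multilin_add_hd[OF Cons(2)])
    next
      case us: (Cons w us')
      from IH show ?thesis using multilin_add[OF Cons(2), of "(u \<star> w) # us'"]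
        by (simp add: us)
    qed
  qed
next
  fix us vs :: "'a poly poly list" and c :: 'a and a :: "'a poly poly"
  show "tdiff f (us @ Asc c a # vs) = Asc c (tdiff f (us @ a # vs))"
    using assms
  proof (induction us arbitrary: f)
    case Nil
    show ?case
      by (cases vs) (simp_all add: mul_Asc_left mul_Asc_right multilin_Asc_hd[OF Nil] tdiff_Asc Asc_diff Asc_minus)
  next
    case (Cons u us f)
    note IH = Cons(1)[OF multilin_Cons[OF Cons(2)]]
    show ?case
    proof (cases us)
      case Nil
      with IH show ?thesis
        by (simp add: mul_Asc_left mul_Asc_right multilin_Asc_hd[OF Cons(2)] Asc_diff Asc_minus)
    next
      case us: (Cons w us')
      from IH show ?thesis using multilin_Asc[OF Cons(2), of "(u \<star> w) # us'"]
        by (simp add: us Asc_diff Asc_minus)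
    qed
  qed
qed

section \<open>The two actions of the algebra on cochains\<close>

definition lact :: "'a poly poly \<Rightarrow> ('a poly poly list \<Rightarrow> 'a poly poly) \<Rightarrow> 'a poly poly list \<Rightarrow> 'a poly poly"
  (infixr "\<rhd>" 72) where "a \<rhd> \<phi> = (\<lambda>rs. a \<star> \<phi> rs)"

text \<open>Hochschild's dimension shift: for this right action \<open>hdiff\<close> becomes the differential with
  values in the bimodule of functions of the remaining arguments.  The right action is not unital.\<close>
definition ract :: "('a poly poly list \<Rightarrow> 'a poly poly) \<Rightarrow> 'a poly poly \<Rightarrow> 'a poly poly list \<Rightarrow> 'a poly poly"
  (infixl "\<lhd>" 73) where "\<phi> \<lhd> a = (\<lambda>rs. - tdiff \<phi> (a # rs))"

lemma lact_apply: "(a \<rhd> \<phi>) rs = a \<star> \<phi> rs"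
  by (simp add: lact_def)

lemma ract_Nil: "(\<phi> \<lhd> a) [] = \<phi> [] \<star> a"
  and ract_Cons: "(\<phi> \<lhd> a) (b # rs) = \<phi> ((a \<star> b) # rs) - ((\<lambda>ys. \<phi> (a # ys)) \<lhd> b) rs"
  by (simp_all add: ract_def)

lemma lact_1 [simp]: "1 \<rhd> \<phi> = \<phi>"
  by (simp add: lact_def)

lemma lact_mul: "(a \<star> b) \<rhd> \<phi> = a \<rhd> b \<rhd> \<phi>"
  by (simp add: lact_def mul_assoc)

lemma lact_distribs:
  "(a + b) \<rhd> \<phi> = a \<rhd> \<phi> + b \<rhd> \<phi>" "a \<rhd> (\<phi> + \<psi>) = a \<rhd> \<phi> + a \<rhd> \<psi>"
  "(a - b) \<rhd> \<phi> = a \<rhd> \<phi> - b \<rhd> \<phi>" "a \<rhd> (\<phi> - \<psi>) = a \<rhd> \<phi> - a \<rhd> \<psi>"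
  "a \<rhd> (- \<phi>) = - (a \<rhd> \<phi>)" "(- a) \<rhd> \<phi> = - (a \<rhd> \<phi>)" "a \<rhd> 0 = 0" "0 \<rhd> \<phi> = 0"
  by (auto simp: lact_def mul_distribs fun_eq_iff)

lemma ract_distribs:
  "(\<phi> + \<psi>) \<lhd> a = \<phi> \<lhd> a + \<psi> \<lhd> a" "(\<phi> - \<psi>) \<lhd> a = \<phi> \<lhd> a - \<psi> \<lhd> a" "(- \<phi>) \<lhd> a = - (\<phi> \<lhd> a)"
  "0 \<lhd> a = 0"
  using tdiff_zero
  by (auto simp: ract_def fun_eq_iff tdiff_add tdiff_diff tdiff_uminus plus_fun_def fun_diff_def fun_Compl_def zero_fun_def)

lemma ract_mul: "\<phi> \<lhd> a \<lhd> b = \<phi> \<lhd> (a \<star> b)"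
  by (simp add: ract_def tdiff_uminus tdiff_tdiff)

lemma lact_ract: "(a \<rhd> \<phi>) \<lhd> b = a \<rhd> (\<phi> \<lhd> b)"
  by (simp add: ract_def lact_def tdiff_mul_left)

lemma ract_add_right: "multilin \<phi> \<Longrightarrow> \<phi> \<lhd> (a + b) = \<phi> \<lhd> a + \<phi> \<lhd> b"
  using multilin_add_hd[OF multilin_tdiff] by (simp add: ract_def fun_eq_iff)

lemma ract_Asc_right: "multilin \<phi> \<Longrightarrow> \<phi> \<lhd> Asc c a = C [:c:] \<rhd> (\<phi> \<lhd> a)"
  using multilin_Asc_hd[OF multilin_tdiff] by (simp add: ract_def fun_eq_iff Asc_eq lact_def)

lemma deg_cochain_multilin: "deg_cochain m \<phi> \<Longrightarrow> multilin \<phi>"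
  by (simp add: deg_cochain_def)

lemma deg_cochain_0: "deg_cochain m 0"
  by (simp add: deg_cochain_def multilin_def)

lemma deg_cochain_add: "deg_cochain m \<phi> \<Longrightarrow> deg_cochain m \<psi> \<Longrightarrow> deg_cochain m (\<phi> + \<psi>)"
  by (auto simp: deg_cochain_def multilin_def Asc_add)

lemma deg_cochain_minus: "deg_cochain m \<phi> \<Longrightarrow> deg_cochain m (- \<phi>)"
  by (auto simp: deg_cochain_def multilin_def Asc_minus)

lemma deg_cochain_diff: "deg_cochain m \<phi> \<Longrightarrow> deg_cochain m \<psi> \<Longrightarrow> deg_cochain m (\<phi> - \<psi>)"
  by (auto simp: deg_cochain_def multilin_def Asc_diff)

lemma deg_cochain_lact: "deg_cochain m \<phi> \<Longrightarrow> deg_cochain m (a \<rhd> \<phi>)"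
  by (auto simp: deg_cochain_def multilin_def lact_def mul_distribs mul_Asc_right)

lemma deg_cochain_ract:
  assumes "deg_cochain m \<phi>" shows "deg_cochain m (\<phi> \<lhd> a)"
proof -
  have "multilin (\<lambda>rs. tdiff \<phi> (a # rs))"
    using assms by (intro multilin_Cons multilin_tdiff) (simp add: deg_cochain_def)
  hence "multilin (\<phi> \<lhd> a)"
    by (auto simp: multilin_def ract_def Asc_minus)
  moreover have "(\<phi> \<lhd> a) rs = 0" if "length rs \<noteq> m" for rs
  proof -
    have "tdiff \<phi> (a # rs) = tdiff (\<lambda>_. 0) (a # rs)"
      by (rule tdiff_cong) (use assms that in \<open>auto simp: deg_cochain_def\<close>)
    thus ?thesis by (simp add: ract_def tdiff_zero)
  qed
  ultimately show ?thesis by (simp add: deg_cochain_def)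
qed

lemmas deg_cochain_intros = deg_cochain_0 deg_cochain_add deg_cochain_minus deg_cochain_diff
  deg_cochain_lact deg_cochain_ract

text \<open>With the remaining arguments \<open>rs\<close> absorbed into the values, this formula
  and the next one are the coboundaries of a map of one and of two arguments with values in a
  bimodule. They carry out the dimension shift.\<close>

lemma hdiff_Cons2: "hdiff h f (a # b # rs) =
    (a \<rhd> (\<lambda>ys. f (b # ys))) rs - f ((a \<star> b) # rs) + ((\<lambda>ys. f (a # ys)) \<lhd> b) rs"
  by (simp add: hdiff_Cons lact_def ract_def)

lemma hdiff_Cons3: "hdiff h f (a # b # c # rs) =
    (a \<rhd> (\<lambda>ys. f (b # c # ys))) rs - f ((a \<star> b) # c # rs) + f (a # (b \<star> c) # rs)
      - ((\<lambda>ys. f (a # b # ys)) \<lhd> c) rs"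
  by (simp add: hdiff_Cons lact_def ract_def)

end

section \<open>Modules over the Ore extension\<close>

text \<open>An \<open>F[x]\<close>-module given by scalars and the endomorphism \<open>X\<close> by
  which \<open>x\<close> acts. The operations are parameters because the module structures used
  later on the same set of pairs depend on a cocycle.\<close>

locale poly_rep =
  fixes sc :: "'a::field \<Rightarrow> 'e::ab_group_add \<Rightarrow> 'e" and X :: "'e \<Rightarrow> 'e"
  assumes sc_add_left: "sc (c + d) e = sc c e + sc d e"
    and sc_add_right: "sc c (e + e') = sc c e + sc c e'"
    and sc_mult: "sc (c * d) e = sc c (sc d e)"
    and sc_1 [simp]: "sc 1 e = e"
    and X_add: "X (e + e') = X e + X e'"
    and X_sc: "X (sc c e) = sc c (X e)"
begin

lemma X_0 [simp]: "X 0 = 0"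
  using X_add[of 0 0] by simp

lemma sc_0_left [simp]: "sc 0 e = 0"
  using sc_add_left[of 0 0 e] by simp

lemma sc_0_right [simp]: "sc c 0 = 0"
  using sc_add_right[of c 0 0] by simp

definition poly_act :: "'a poly \<Rightarrow> 'e \<Rightarrow> 'e" where
  "poly_act f e = fold_coeffs (\<lambda>c r. sc c e + X r) f 0"

lemma poly_act_0 [simp]: "poly_act 0 e = 0"
  by (simp add: poly_act_def)

lemma poly_act_pCons [simp]: "poly_act (pCons c f) e = sc c e + X (poly_act f e)"
  by (cases "c = 0 \<and> f = 0") (auto simp: poly_act_def fold_coeffs_pCons_not_0_0_eq)

lemma poly_act_add_left: "poly_act (f + g) e = poly_act f e + poly_act g e"
  by (induction f g rule: poly_induct2) (simp_all add: sc_add_left X_add algebra_simps)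

lemma poly_act_add_right: "poly_act f (e + e') = poly_act f e + poly_act f e'"
  by (induction f) (simp_all add: sc_add_right X_add algebra_simps)

lemma poly_act_smult: "poly_act (smult c f) e = sc c (poly_act f e)"
  by (induction f) (simp_all add: sc_mult X_sc sc_add_right)

lemma poly_act_mult: "poly_act (f * g) e = poly_act f (poly_act g e)"
  by (induction f) (simp_all add: poly_act_add_left poly_act_smult)

lemma poly_act_0_right [simp]: "poly_act f 0 = 0"
  by (induction f) simp_all

lemma poly_act_1 [simp]: "poly_act 1 e = e"
  unfolding one_pCons by simp

lemma poly_act_closed:
  assumes "P e" "\<And>e e'. P e \<Longrightarrow> P e' \<Longrightarrow> P (e + e')" "\<And>c e. P e \<Longrightarrow> P (sc c e)" "\<And>e. P e \<Longrightarrow> P (X e)"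
  shows "P (poly_act f e)"
proof (induction f)
  case 0 show ?case using assms(3)[OF assms(1), of 0] by simp
next
  case (pCons c f) thus ?case using assms by simp
qed

text \<open>The \<open>F[x]\<close>-linear map on \<open>A\<close>, free on the powers of
  \<open>y\<close>, with prescribed values \<open>e k\<close> at \<open>y\<^sup>k\<close>.\<close>

definition lin_ext :: "(nat \<Rightarrow> 'e) \<Rightarrow> 'a poly poly \<Rightarrow> 'e" where
  "lin_ext e a = (\<Sum>k\<le>degree a. poly_act (coeff a k) (e k))"

lemma lin_ext_eq_sum: "degree a \<le> n \<Longrightarrow> lin_ext e a = (\<Sum>k\<le>n. poly_act (coeff a k) (e k))"
  unfolding lin_ext_def by (rule sum.mono_neutral_left) (auto simp: coeff_eq_0)

lemma lin_ext_add: "lin_ext e (a + b) = lin_ext e a + lin_ext e b"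
proof -
  define n where "n = max (degree a) (degree b)"
  have "degree a \<le> n" "degree b \<le> n" "degree (a + b) \<le> n"
    by (auto simp: n_def degree_add_le_max)
  thus ?thesis by (simp add: lin_ext_eq_sum poly_act_add_left sum.distrib)
qed

lemma poly_act_sum_right: "poly_act f (sum g A) = (\<Sum>i\<in>A. poly_act f (g i))"
  by (induction A rule: infinite_finite_induct) (auto simp: poly_act_add_right)

lemma lin_ext_smult: "lin_ext e (smult f a) = poly_act f (lin_ext e a)"
proof -
  have "degree (smult f a) \<le> degree a"
    by (rule degree_smult_le)
  thus ?thesis
    by (simp add: lin_ext_eq_sum[of "smult f a" "degree a"] lin_ext_def[of e a] poly_act_sum_right poly_act_mult)
qed

lemma lin_ext_pCons: "lin_ext e (pCons f a) = poly_act f (e 0) + lin_ext (\<lambda>k. e (Suc k)) a"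
proof -
  have "degree (pCons f a) \<le> Suc (degree a)"
    by (rule degree_pCons_le)
  thus ?thesis
    by (simp add: lin_ext_eq_sum[of "pCons f a" "Suc (degree a)"] lin_ext_def[of _ a]
        sum.atMost_Suc_shift del: sum.atMost_Suc)
qed

lemma lin_ext_0 [simp]: "lin_ext e 0 = 0"
  by (simp add: lin_ext_def)

lemma lin_ext_monom: "lin_ext e (monom 1 k) = e k"
  by (induction k arbitrary: e) (simp_all add: monom_0 monom_Suc lin_ext_pCons)

lemma lin_ext_closed:
  assumes "\<And>k. P (e k)" "\<And>e e'. P e \<Longrightarrow> P e' \<Longrightarrow> P (e + e')" "\<And>c e. P e \<Longrightarrow> P (sc c e)" "\<And>e. P e \<Longrightarrow> P (X e)"
  shows "P (lin_ext e a)"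
  using assms(1)
proof (induction a arbitrary: e)
  case 0 show ?case using assms(3)[OF 0[of 0], of 0] by simp
next
  case (pCons f a)
  have "P (poly_act f (e 0))" by (rule poly_act_closed) (use assms pCons in auto)
  with pCons assms show ?case by (simp add: lin_ext_pCons)
qed

end

text \<open>A left \<open>A\<close>-module: \<open>Y_X\<close> is the defining relation
  \<open>y x = x y + h\<close>.\<close>

locale ore_rep = ore_algebra h + poly_rep sc X
  for h :: "'a::field poly" and sc :: "'a \<Rightarrow> 'e::ab_group_add \<Rightarrow> 'e" and X :: "'e \<Rightarrow> 'e" +
  fixes Y :: "'e \<Rightarrow> 'e"
  assumes Y_add: "Y (e + e') = Y e + Y e'"
    and Y_sc: "Y (sc c e) = sc c (Y e)"
    and Y_X: "Y (X e) = X (Y e) + poly_act h e"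
begin

lemma Y_0 [simp]: "Y 0 = 0"
  using Y_add[of 0 0] by simp

lemma Y_poly_act: "Y (poly_act f e) = poly_act f (Y e) + poly_act (Dh h f) e"
proof (induction f)
  case (pCons c q)
  have D: "Dh h (pCons c q) = pCons 0 (Dh h q) + h * q"
    by (simp add: Dh_def pderiv_pCons algebra_simps)
  show ?case
    by (simp add: D Y_add Y_sc Y_X pCons X_add poly_act_add_left poly_act_mult algebra_simps)
qed simp

text \<open>The homomorphism of left modules from \<open>A\<close> with
  \<open>1 \<mapsto> e\<close>, written on normal forms. The defining relation enters in
  \<open>hom_Y\<close>, through the Leibniz rule \<open>Y_poly_act\<close>.\<close>

definition hom :: "'e \<Rightarrow> 'a poly poly \<Rightarrow> 'e" where
  "hom e a = lin_ext (\<lambda>k. (Y ^^ k) e) a"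

lemma hom_1: "hom e 1 = e"
  using lin_ext_monom[of "\<lambda>k. (Y ^^ k) e" 0] by (simp add: hom_def monom_0 flip: one_pCons)

lemma hom_add: "hom e (a + b) = hom e a + hom e b"
  by (simp add: hom_def lin_ext_add)

lemma hom_C: "hom e (C f \<star> a) = poly_act f (hom e a)"
  by (simp add: hom_def mul_C lin_ext_smult)

lemma hom_X: "hom e (Ax \<star> a) = X (hom e a)"
  unfolding Ax_def hom_C by simp

lemma hom_sum: "hom e (sum f A) = (\<Sum>i\<in>A. hom e (f i))"
proof (induction A rule: infinite_finite_induct)
  case (insert x F) thus ?case by (simp add: hom_add)
qed (simp_all add: hom_def)

lemma Y_sum: "Y (sum f A) = (\<Sum>i\<in>A. Y (f i))"
  by (induction A rule: infinite_finite_induct) (auto simp: Y_add)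

lemma hom_Y: "hom e (Ay \<star> a) = Y (hom e a)"
proof -
  have m: "hom e (monom 1 k) = (Y ^^ k) e" for k
    by (simp add: hom_def lin_ext_monom)
  have s: "hom e (smult f b) = poly_act f (hom e b)" for f b
    by (simp add: hom_def lin_ext_smult)
  have "hom e (Yop (smult f (monom 1 k))) = Y (hom e (smult f (monom 1 k)))" for f k
    using m[of "Suc k"] by (simp add: Yop_smult Yop_monom hom_add s m Y_poly_act)
  thus ?thesis
    unfolding mul_Y by (subst (1 2) pp_eq_sum[of a]) (simp only: Yop_sum hom_sum Y_sum)
qed

end

section \<open>Extending cochains along the defining relation\<close>

text \<open>As rewrite rules these would eta-expand sums of cochains.\<close>
declare plus_fun_apply [simp del] zero_fun_apply [simp del] minus_apply [simp del] uminus_apply [simp del]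

context ore_algebra
begin

definition scE :: "'a \<Rightarrow> 'a poly poly \<times> ('a poly poly list \<Rightarrow> 'a poly poly) \<Rightarrow> _" where
  "scE c e = (Asc c (fst e), C [:c:] \<rhd> snd e)"

text \<open>The action of \<open>x\<close> on the extension of \<open>A\<close> by the cochains. A
  map \<open>G\<close> with coboundary \<open>F\<close> and value \<open>u\<close> at
  \<open>x\<close> satisfies \<open>G (x a) = x G a + u a - F x a\<close>, so for
  \<open>R = F x\<close> its graph is stable under this operator. \<open>R\<close> is left general
  because \<open>solve_left_mult_X\<close> uses another inhomogeneous term.\<close>

definition XEg :: "_ \<Rightarrow> _ \<Rightarrow> 'a poly poly \<times> ('a poly poly list \<Rightarrow> 'a poly poly) \<Rightarrow> _" where
  "XEg u R e = (Ax \<star> fst e, Ax \<rhd> snd e + u \<lhd> fst e - R (fst e))"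

lemma scalar_commute: "C [:c:] \<rhd> a \<rhd> n = a \<rhd> C [:c:] \<rhd> n"
  by (metis lact_mul mul_scalar)

lemma scE_sel [simp]: "fst (scE c e) = Asc c (fst e)" "snd (scE c e) = C [:c:] \<rhd> snd e"
  by (simp_all add: scE_def)

lemma XEg_sel [simp]: "fst (XEg u R e) = Ax \<star> fst e" "snd (XEg u R e) = Ax \<rhd> snd e + u \<lhd> fst e - R (fst e)"
  by (simp_all add: XEg_def)

lemma poly_rep_XEg:
  assumes u: "multilin u" and R_add: "\<And>a b. R (a + b) = R a + R b"
    and R_Asc: "\<And>c a. R (Asc c a) = C [:c:] \<rhd> R a"
  shows "poly_rep scE (XEg u R)"
proof
  fix c d :: 'a and e e' :: "'a poly poly \<times> ('a poly poly list \<Rightarrow> 'a poly poly)"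
  show "scE (c + d) e = scE c e + scE d e"
    by (simp add: scE_def Asc_eq flip: mul_add_left lact_distribs)
  show "scE c (e + e') = scE c e + scE c e'"
    by (simp add: scE_def Asc_add lact_distribs)
  have "C [:c * d:] = C [:c:] \<star> C [:d:]" by (simp add: mul_C)
  thus "scE (c * d) e = scE c (scE d e)"
    by (simp add: scE_def Asc_eq mul_assoc lact_mul)
  show "scE 1 e = e"
    by (simp add: scE_def Asc_eq flip: one_pCons)
  show "XEg u R (e + e') = XEg u R e + XEg u R e'"
    by (simp add: XEg_def mul_add_right lact_distribs ract_add_right[OF u] R_add)
  show "XEg u R (scE c e) = scE c (XEg u R e)"
    by (simp add: XEg_def scE_def mul_Asc_right lact_distribs ract_Asc_right[OF u] R_Asc
        scalar_commute)
qed

lemma C_pCons: "C (pCons c q) = Asc c 1 + Ax \<star> C q"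
  by (simp add: Asc_def Ax_def mul_C)

lemma fst_poly_act_XEg:
  assumes "poly_rep scE (XEg u R)"
  shows "fst (poly_rep.poly_act scE (XEg u R) q e) = C q \<star> fst e"
proof -
  interpret poly_rep scE "XEg u R" by fact
  show ?thesis
  proof (induction q)
    case (pCons c q)
    thus ?case
      by (simp add: C_pCons mul_add_left mul_Asc_left mul_assoc)
  qed simp
qed

end

locale ore_cocycle = ore_algebra h for h :: "'a::field poly" +
  fixes m :: nat and F :: "'a poly poly \<Rightarrow> 'a poly poly \<Rightarrow> 'a poly poly list \<Rightarrow> 'a poly poly"
    and u :: "'a poly poly list \<Rightarrow> 'a poly poly"
  assumes F_add_left: "F (a + a') b = F a b + F a' b"
    and F_add_right: "F a (b + b') = F a b + F a b'"
    and F_Asc_left: "F (Asc c a) b = C [:c:] \<rhd> F a b"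
    and F_Asc_right: "F a (Asc c b) = C [:c:] \<rhd> F a b"
    and deg_F: "deg_cochain m (F a b)"
    and deg_u: "deg_cochain m u"
    and cocycle: "a \<rhd> F b b' - F (a \<star> b) b' + F a (b \<star> b') - F a b \<lhd> b' = 0"
begin

abbreviation "XE \<equiv> XEg u (F Ax)"

lemma mult_u: "multilin u"
  using deg_u by (simp add: deg_cochain_def)

sublocale xr: poly_rep scE XE
  by (rule poly_rep_XEg) (simp_all add: mult_u F_add_right F_Asc_right)

lemmas fst_poly_act = fst_poly_act_XEg[OF xr.poly_rep_axioms]

text \<open>The value at \<open>q\<close> that \<open>u\<close> and the coboundary \<open>F\<close>
  force upon \<open>G\<close>. The start value is suggested by the coboundary condition at the pair
  of units, which reads \<open>G 1 \<lhd> 1 = F 1 1\<close>.\<close>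

definition gx :: "'a poly \<Rightarrow> 'a poly poly list \<Rightarrow> 'a poly poly" where
  "gx q = snd (xr.poly_act q (1, F 1 1))"

lemma gx_0 [simp]: "gx 0 = 0"
  by (simp add: gx_def)

lemma gx_pCons [simp]:
  "gx (pCons c q) = C [:c:] \<rhd> F 1 1 + (Ax \<rhd> gx q + u \<lhd> C q - F Ax (C q))"
  using fst_poly_act[of q "(1, F 1 1)"] by (simp add: gx_def)

lemma deg_gx: "deg_cochain m (gx q)"
  by (induction q) (auto simp only: gx_0 gx_pCons intro!: deg_cochain_intros deg_F deg_u)

lemma F_0_left [simp]: "F 0 a = 0"
  using F_add_left[of 0 0 a] by simp

lemma F_1: "F 1 a = F 1 1 \<lhd> a"
  using cocycle[of 1 1 a] by simp

text \<open>By the cocycle identity every polynomial acts by the same kind of formula as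
  \<open>x\<close>, with \<open>gx f\<close> in place of \<open>u\<close>. The case
  \<open>f = h\<close> is needed for the relation \<open>y x = x y + h\<close> on the
  extension.\<close>

lemma poly_act_eq: "xr.poly_act f e = (C f \<star> fst e, C f \<rhd> snd e + gx f \<lhd> fst e - F (C f) (fst e))"
proof -
  define a n where "a = fst e" and "n = snd e"
  have "snd (xr.poly_act f e) = C f \<rhd> n + gx f \<lhd> a - F (C f) a"
  proof (induction f)
    case 0
    show ?case by (simp only: gx_0 xr.poly_act_0 pCons_0_0 F_0_left snd_zero ract_distribs lact_distribs
      add_0 diff_0_right)
  next
    case (pCons c q)
    have 1: "Ax \<rhd> F (C q) a = F (Ax \<star> C q) a - F Ax (C q \<star> a) + F Ax (C q) \<lhd> a"
      using cocycle[of Ax "C q" a] by (simp add: algebra_simps)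
    have 2: "C (pCons c q) \<rhd> n = C [:c:] \<rhd> n + Ax \<rhd> C q \<rhd> n"
      unfolding C_pCons[of c q] by (simp add: lact_distribs lact_mul Asc_eq)
    have 3: "F (C (pCons c q)) a = C [:c:] \<rhd> (F 1 1 \<lhd> a) + F (Ax \<star> C q) a"
      unfolding C_pCons[of c q] by (simp add: F_add_left F_Asc_left F_1[of a])
    have "snd (xr.poly_act (pCons c q) e) = C [:c:] \<rhd> n + Ax \<rhd> (C q \<rhd> n + gx q \<lhd> a - F (C q) a)
            + u \<lhd> (C q \<star> a) - F Ax (C q \<star> a)"
      by (simp add: fst_poly_act pCons flip: a_def n_def)
    thus ?case unfolding 3 gx_pCons 2
      by (simp add: 1 lact_distribs ract_distribs lact_ract ract_mul algebra_simps)
  qed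
  thus ?thesis
    by (intro prod_eqI) (simp_all add: fst_poly_act a_def n_def)
qed

text \<open>The obstruction to extending \<open>x \<mapsto> u\<close>, \<open>y \<mapsto> v\<close> to a cochain with coboundary \<open>F\<close>:
  it is the image of the defining relation \<open>y x - x y - h\<close>.\<close>
definition obstr :: "('a poly poly list \<Rightarrow> 'a poly poly) \<Rightarrow> 'a poly poly list \<Rightarrow> 'a poly poly" where
  "obstr v = Ax \<rhd> v - v \<lhd> Ax + u \<lhd> Ay - Ay \<rhd> u + gx h + F Ay Ax - F Ax Ay"

definition YE where
  "YE v e = (Ay \<star> fst e, Ay \<rhd> snd e + v \<lhd> fst e - F Ay (fst e))"

lemma YE_sel [simp]: "fst (YE v e) = Ay \<star> fst e" "snd (YE v e) = Ay \<rhd> snd e + v \<lhd> fst e - F Ay (fst e)"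
  by (simp_all add: YE_def)

text \<open>On a pair \<open>(a, n)\<close> the cocycle identities at \<open>(y, x, a)\<close> and
  \<open>(x, y, a)\<close> remove from \<open>Y X - X Y - h\<close> every value of \<open>F\<close>
  that involves \<open>a\<close>, and \<open>- (obstr v \<lhd> a)\<close> remains. As the right
  action is not unital, its vanishing for all \<open>a\<close> is weaker than
  \<open>obstr v = 0\<close>.\<close>

lemma ore_rep_E:
  assumes v: "deg_cochain m v" and o: "\<And>a. obstr v \<lhd> a = 0"
  shows "ore_rep h scE XE (YE v)"
proof
  fix c d :: 'a and e e' :: "'a poly poly \<times> ('a poly poly list \<Rightarrow> 'a poly poly)"
  have mv: "multilin v" using v by (simp add: deg_cochain_def)
  show "YE v (e + e') = YE v e + YE v e'"
    by (simp add: YE_def mul_add_right lact_distribs ract_add_right[OF mv] F_add_right)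
  show "YE v (scE c e) = scE c (YE v e)"
    by (simp add: YE_def scE_def mul_Asc_right lact_distribs ract_Asc_right[OF mv] F_Asc_right
        scalar_commute)
  define a n where "a = fst e" and "n = snd e"
  have e: "e = (a, n)" by (simp add: a_def n_def)
  have 1: "Ay \<rhd> F Ax a = F (Ay \<star> Ax) a - F Ay (Ax \<star> a) + F Ay Ax \<lhd> a"
    using cocycle[of Ay Ax a] by (simp add: algebra_simps)
  have 2: "Ax \<rhd> F Ay a = F (Ax \<star> Ay) a - F Ax (Ay \<star> a) + F Ax Ay \<lhd> a"
    using cocycle[of Ax Ay a] by (simp add: algebra_simps)
  have 3: "F (Ay \<star> Ax) a = F (Ax \<star> Ay) a + F (C h) a"
    by (simp add: YX F_add_left)
  have 4: "Ay \<rhd> Ax \<rhd> n = Ax \<rhd> Ay \<rhd> n + C h \<rhd> n"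
    by (simp add: YX lact_distribs flip: lact_mul)
  have 5: "Ay \<rhd> (u \<lhd> a) = Ax \<rhd> (v \<lhd> a) - v \<lhd> (Ax \<star> a) + u \<lhd> (Ay \<star> a) + gx h \<lhd> a + F Ay Ax \<lhd> a - F Ax Ay \<lhd> a"
    using o[of a] unfolding obstr_def
    by (simp add: ract_distribs ract_mul lact_ract algebra_simps)
  have 6: "Ay \<star> (Ax \<star> a) = Ax \<star> (Ay \<star> a) + C h \<star> a"
    by (metis YX mul_assoc mul_add_left)
  show "YE v (XE e) = XE (YE v e) + xr.poly_act h e"
    unfolding poly_act_eq e by (simp add: XEg_def YE_def lact_distribs 1 2 3 4 5 6 algebra_simps)
qed

text \<open>The module homomorphism that sends 1 to \<open>(1, F 1 1)\<close> is the identity in the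
  first component, hence a splitting, and \<open>G\<close> is its second component. The coboundary
  identity holds for the left arguments \<open>x\<close> and \<open>y\<close> by construction, and
  the cocycle identity extends it to products.\<close>

theorem coboundary:
  assumes v: "deg_cochain m v" and o: "\<And>a. obstr v \<lhd> a = 0"
  obtains G where "\<And>a b. G (a + b) = G a + G b" "\<And>c a. G (Asc c a) = C [:c:] \<rhd> G a"
    "\<And>a. deg_cochain m (G a)" "G 1 = F 1 1"
    "\<And>a. G (Ax \<star> a) = Ax \<rhd> G a + u \<lhd> a - F Ax a"
    "\<And>a. G (Ay \<star> a) = Ay \<rhd> G a + v \<lhd> a - F Ay a"
    "\<And>a b. a \<rhd> G b - G (a \<star> b) + G a \<lhd> b = F a b"
proof -
  interpret ore_rep h scE XE "YE v" by (rule ore_rep_E[OF assms])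
  define G where "G a = snd (hom (1, F 1 1) a)" for a
  have fst: "fst (hom (1, F 1 1) a) = a" for a
  proof (induction a rule: ore_induct)
    case (scalar c)
    have "hom (1, F 1 1) (C [:c:]) = scE c (1, F 1 1)"
      using hom_C[of "(1, F 1 1)" "[:c:]" 1] by (simp add: hom_1)
    hence "fst (hom (1, F 1 1) (C [:c:])) = Asc c 1" by simp
    thus ?case by (simp add: Asc_def)
  qed (simp_all only: hom_add hom_X hom_Y YE_sel fst_add XEg_sel)
  have G_add: "G (a + b) = G a + G b" for a b
    by (simp add: G_def hom_add)
  have Asc: "G (Asc c a) = C [:c:] \<rhd> G a" for c a
    by (simp add: G_def Asc_eq hom_C)
  have G1: "G 1 = F 1 1"
    by (simp add: G_def hom_1)
  have G_X: "G (Ax \<star> a) = Ax \<rhd> G a + u \<lhd> a - F Ax a" for a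
    by (simp add: G_def hom_X fst)
  have G_Y: "G (Ay \<star> a) = Ay \<rhd> G a + v \<lhd> a - F Ay a" for a
    by (simp add: G_def hom_Y fst)
  have deg: "deg_cochain m (G a)" for a
  proof (induction a rule: ore_induct)
    case (scalar c)
    have "C [:c:] = Asc c 1" by (simp add: Asc_def)
    thus ?case by (simp add: Asc G1 deg_F deg_cochain_intros)
  qed (auto simp only: G_add G_X G_Y intro!: deg_cochain_intros deg_F deg_u v)
  have "\<forall>b. a \<rhd> G b - G (a \<star> b) + G a \<lhd> b = F a b" for a
  proof (induction a rule: ore_induct)
    case (scalar c)
    have c: "C [:c:] = Asc c 1" by (simp add: Asc_def)
    have "Asc c 1 \<rhd> G b - G (Asc c 1 \<star> b) + G (Asc c 1) \<lhd> b = F (Asc c 1) b" for b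
      unfolding mul_Asc_left Asc F_Asc_left mul_1_left G1 lact_ract F_1[of b] by (simp add: Asc_eq)
    thus ?case unfolding c by blast
  next
    case (add a a')
    have "(a + a') \<rhd> G b - G ((a + a') \<star> b) + G (a + a') \<lhd> b =
      (a \<rhd> G b - G (a \<star> b) + G a \<lhd> b) + (a' \<rhd> G b - G (a' \<star> b) + G a' \<lhd> b)" for b
      by (simp add: G_add lact_distribs ract_distribs mul_add_left)
    with add show ?case by (simp only: F_add_left simp_thms)
  next
    case (X a)
    show ?case
    proof
      fix b
      have 1: "G (a \<star> b) = a \<rhd> G b + G a \<lhd> b - F a b"
        using X[THEN spec, of b] by (simp add: algebra_simps)
      have 2: "F (Ax \<star> a) b = Ax \<rhd> F a b + F Ax (a \<star> b) - F Ax a \<lhd> b"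
        using cocycle[of Ax a b] by (simp add: algebra_simps)
      show "(Ax \<star> a) \<rhd> G b - G (Ax \<star> a \<star> b) + G (Ax \<star> a) \<lhd> b = F (Ax \<star> a) b"
        by (simp add: 1 2 mul_assoc G_X lact_distribs ract_distribs lact_mul ract_mul
            lact_ract algebra_simps)
    qed
  next
    case (Y a)
    show ?case
    proof
      fix b
      have 1: "G (a \<star> b) = a \<rhd> G b + G a \<lhd> b - F a b"
        using Y[THEN spec, of b] by (simp add: algebra_simps)
      have 2: "F (Ay \<star> a) b = Ay \<rhd> F a b + F Ay (a \<star> b) - F Ay a \<lhd> b"
        using cocycle[of Ay a b] by (simp add: algebra_simps)
      show "(Ay \<star> a) \<rhd> G b - G (Ay \<star> a \<star> b) + G (Ay \<star> a) \<lhd> b = F (Ay \<star> a) b"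
        by (simp add: 1 2 mul_assoc G_Y lact_distribs ract_distribs lact_mul ract_mul
            lact_ract algebra_simps)
    qed
  qed
  with G_add Asc deg G1 G_X G_Y that show thesis by blast
qed

end

section \<open>Vanishing of the cohomology in degrees at least three\<close>

context ore_algebra
begin

lemma deg_cochain_SucI:
  assumes "f [] = 0" "\<And>a. deg_cochain m (\<lambda>rs. f (a # rs))"
    "\<And>a b rs. f ((a + b) # rs) = f (a # rs) + f (b # rs)"
    "\<And>c a rs. f (Asc c a # rs) = Asc c (f (a # rs))"
  shows "deg_cochain (Suc m) f"
proof -
  have "multilin f"
  proof (rule multilinI)
    show "f (us @ (a + b) # vs) = f (us @ a # vs) + f (us @ b # vs)" for us vs a b
      using assms(3) multilin_add[OF deg_cochain_multilin[OF assms(2)]]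
      by (cases us) auto
    show "f (us @ Asc c a # vs) = Asc c (f (us @ a # vs))" for us vs c a
      using assms(4) multilin_Asc[OF deg_cochain_multilin[OF assms(2)]]
      by (cases us) auto
  qed
  moreover have "f xs = 0" if "length xs \<noteq> Suc m" for xs
    using that assms(1,2) by (cases xs) (auto simp: deg_cochain_def)
  ultimately show ?thesis by (simp add: deg_cochain_def)
qed

lemma deg_cochain_SucD:
  assumes "deg_cochain (Suc m) f"
  shows "deg_cochain m (\<lambda>rs. f (a # rs))" "f [] = 0"
    "f ((a + b) # rs) = f (a # rs) + f (b # rs)" "f (Asc c a # rs) = Asc c (f (a # rs))"
  using assms by (auto simp: deg_cochain_def multilin_Cons multilin_add_hd multilin_Asc_hd)

lemma ore_cocycleI:
  assumes f: "deg_cochain (Suc (Suc m)) f" and "hdiff h f = (\<lambda>_. 0)" and "deg_cochain m u"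
  shows "ore_cocycle h m (\<lambda>a b rs. f (a # b # rs)) u"
proof
  note f1 = deg_cochain_SucD[OF f]
  note f2 = deg_cochain_SucD[OF f1(1)]
  fix a a' b b' :: "'a poly poly" and c :: 'a
  show "(\<lambda>rs. f ((a + a') # b # rs)) = (\<lambda>rs. f (a # b # rs)) + (\<lambda>rs. f (a' # b # rs))"
    "(\<lambda>rs. f (a # (b + b') # rs)) = (\<lambda>rs. f (a # b # rs)) + (\<lambda>rs. f (a # b' # rs))"
    "(\<lambda>rs. f (Asc c a # b # rs)) = C [:c:] \<rhd> (\<lambda>rs. f (a # b # rs))"
    "(\<lambda>rs. f (a # Asc c b # rs)) = C [:c:] \<rhd> (\<lambda>rs. f (a # b # rs))"
    by (simp_all add: fun_eq_iff plus_fun_apply f1 f2 lact_def flip: Asc_eq)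
  show "deg_cochain m (\<lambda>rs. f (a # b # rs))" "deg_cochain m u"
    by (fact assms f2)+
  show "a \<rhd> (\<lambda>rs. f (b # b' # rs)) - (\<lambda>rs. f ((a \<star> b) # b' # rs)) + (\<lambda>rs. f (a # (b \<star> b') # rs)) -
      (\<lambda>rs. f (a # b # rs)) \<lhd> b' = 0"
    using assms(2) hdiff_Cons3[of f a b b']
    by (simp add: fun_eq_iff plus_fun_apply minus_apply zero_fun_apply)
qed

text \<open>\<open>A\<close> is free over \<open>F[x]\<close> on the powers of \<open>y\<close>, so the recursion along \<open>x\<close> has a solution
  for all initial values.\<close>
lemma solve_left_mult_X:
  assumes c: "deg_cochain m c" and \<rho>: "deg_cochain (Suc m) \<rho>"
  obtains v where "deg_cochain (Suc m) v"
    "\<And>a rs. v ((Ax \<star> a) # rs) = Ax \<star> v (a # rs) + (c \<lhd> a) rs - \<rho> (a # rs)"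
    "\<And>k rs. v (monom 1 k # rs) = 0"
proof -
  define R where "R a = (\<lambda>rs. \<rho> (a # rs))" for a
  note \<rho>' = deg_cochain_SucD[OF \<rho>]
  interpret poly_rep scE "XEg c R"
    by (rule poly_rep_XEg)
       (use c in \<open>auto simp: deg_cochain_def R_def fun_eq_iff plus_fun_apply lact_apply \<rho>' simp flip: Asc_eq\<close>)
  define V where "V a = snd (lin_ext (\<lambda>k. (monom 1 k, 0)) a)" for a
  have fst: "fst (lin_ext (\<lambda>k. (monom 1 k, 0)) a) = a" for a
  proof -
    have "fst (sum g A) = (\<Sum>i\<in>A. fst (g i))"
      for g :: "nat \<Rightarrow> 'a poly poly \<times> ('a poly poly list \<Rightarrow> 'a poly poly)" and A
      by (induction A rule: infinite_finite_induct) auto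
    thus ?thesis
      by (simp add: lin_ext_def fst_poly_act_XEg[OF poly_rep_axioms] mul_C flip: pp_eq_sum)
  qed
  have V_add: "V (a + b) = V a + V b" for a b
    by (simp add: V_def lin_ext_add)
  have V_C: "V (C q \<star> a) = snd (poly_act q (lin_ext (\<lambda>k. (monom 1 k, 0)) a))" for q a
    by (simp add: V_def mul_C lin_ext_smult)
  have V_Asc: "V (Asc c a) = C [:c:] \<rhd> V a" for c a
    unfolding Asc_eq V_C by (simp add: V_def)
  have V_X: "V (Ax \<star> a) = Ax \<rhd> V a + c \<lhd> a - R a" for a
    unfolding Ax_def V_C by (simp add: V_def fst flip: Ax_def)
  have V_monom: "V (monom 1 k) = 0" for k
    by (simp add: V_def lin_ext_monom)
  have V_deg: "deg_cochain m (V a)" for a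
    unfolding V_def
  proof (rule lin_ext_closed)
    show "deg_cochain m (snd (monom 1 k, 0))" for k :: nat
      by (simp add: deg_cochain_0)
  qed (auto intro!: deg_cochain_intros c simp: R_def \<rho>')
  define v where "v rs = (case rs of [] \<Rightarrow> 0 | a # rs' \<Rightarrow> V a rs')" for rs
  show thesis
  proof (rule that)
    show "deg_cochain (Suc m) v"
      by (rule deg_cochain_SucI) (auto simp: v_def V_deg V_add plus_fun_apply V_Asc lact_apply simp flip: Asc_eq)
    show "v ((Ax \<star> a) # rs) = Ax \<star> v (a # rs) + (c \<lhd> a) rs - \<rho> (a # rs)" for a rs
      by (simp add: v_def V_X R_def plus_fun_apply minus_apply lact_apply)
    show "v (monom 1 k # rs) = 0" for k rs
      by (simp add: v_def V_monom zero_fun_apply)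
  qed
qed

text \<open>At \<open>b # rs\<close> the right action produces both \<open>v ((x b) # rs)\<close>
  and the value of \<open>v\<close> at \<open>x\<close>. The commutator equation is thus a recursion
  in the first argument, provided that \<open>c\<close> is that value.\<close>

lemma commutator_X_solution:
  assumes "v [] = 0" "\<And>a rs. v ((Ax \<star> a) # rs) = Ax \<star> v (a # rs) + (c \<lhd> a) rs - \<rho> (a # rs)"
    and "(\<lambda>rs. v (Ax # rs)) = c" and "\<rho> [] = 0"
  shows "Ax \<rhd> v - v \<lhd> Ax = \<rho>"
proof
  fix rs show "(Ax \<rhd> v - v \<lhd> Ax) rs = \<rho> rs"
    using assms by (cases rs) (simp_all add: minus_apply lact_apply ract_Nil ract_Cons)
qed

text \<open>Here the values are cochains of positive degree, and \<open>w\<close> is the obstruction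
  for \<open>u = v = 0\<close>. It can be compensated by \<open>v\<close>, which is constructed by
  recursion in its first argument.\<close>

theorem cocycle_high_degree:
  assumes f: "deg_cochain (Suc (Suc (Suc n))) f" and d: "hdiff h f = (\<lambda>_. 0)"
  obtains g where "deg_cochain (Suc (Suc n)) g" "hdiff h g = f"
proof -
  define F where "F a b = (\<lambda>rs. f (a # b # rs))" for a b
  interpret ore_cocycle h "Suc n" F 0
    unfolding F_def by (rule ore_cocycleI[OF f d deg_cochain_0])
  define w where "w = gx h + F Ay Ax - F Ax Ay"
  have w: "deg_cochain (Suc n) w"
    unfolding w_def by (intro deg_cochain_intros deg_gx deg_F)
  \<comment> \<open>Only \<open>obstr v \<lhd> a = 0\<close> is required. The cochain
    \<open>- (w \<lhd> 1)\<close> has the same right multiples as \<open>- w\<close> and is moreover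
    fixed by \<open>\<lhd> 1\<close>, which makes the recursion for \<open>v\<close>
    consistent.\<close>
  define \<rho> where "\<rho> = - (w \<lhd> 1)"
  have \<rho>: "deg_cochain (Suc n) \<rho>" unfolding \<rho>_def by (intro deg_cochain_intros w)
  have \<rho>1: "\<rho> \<lhd> 1 = \<rho>" by (simp add: \<rho>_def ract_distribs ract_mul)
  \<comment> \<open>With \<open>v (1 # rs) = 0\<close> the recursion at \<open>a = 1\<close> gives
    \<open>v (x # rs) = (c \<lhd> 1) rs - \<rho> (1 # rs)\<close>. Since
    \<open>c \<lhd> 1 = 0\<close>, this is \<open>c\<close>, as \<open>commutator_X_solution\<close>
    demands.\<close>
  define c where "c = (\<lambda>rs. - \<rho> (1 # rs))"
  have c: "deg_cochain n c"
    using deg_cochain_minus[OF deg_cochain_SucD(1)[OF \<rho>, of 1]] by (simp add: c_def fun_Compl_def)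
  have c1: "c \<lhd> 1 = 0"
  proof
    fix rs
    have "((\<lambda>rs. \<rho> (1 # rs)) \<lhd> 1) rs = \<rho> (1 # rs) - (\<rho> \<lhd> 1) (1 # rs)"
      by (subst ract_Cons) simp
    moreover have "c = - (\<lambda>rs. \<rho> (1 # rs))" by (simp add: c_def fun_Compl_def)
    ultimately show "(c \<lhd> 1) rs = 0 rs"
      using \<rho>1 by (simp add: ract_distribs uminus_apply zero_fun_apply)
  qed
  obtain v where v: "deg_cochain (Suc n) v"
    "\<And>a rs. v ((Ax \<star> a) # rs) = Ax \<star> v (a # rs) + (c \<lhd> a) rs - \<rho> (a # rs)"
    "\<And>k rs. v (monom 1 k # rs) = 0"
    using solve_left_mult_X[OF c \<rho>] by blast
  have vX: "(\<lambda>rs. v (Ax # rs)) = c"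
    using v(2)[of 1] v(3)[of 0] c1 by (auto simp: fun_eq_iff monom_0 c_def zero_fun_apply simp flip: one_pCons)
  have comm: "Ax \<rhd> v - v \<lhd> Ax = \<rho>"
    by (rule commutator_X_solution[OF _ v(2) vX]) (use deg_cochain_SucD[OF v(1)] deg_cochain_SucD[OF \<rho>] in auto)
  have "obstr v = \<rho> + w"
    unfolding obstr_def comm by (simp add: w_def ract_distribs lact_distribs algebra_simps)
  hence "obstr v \<lhd> a = 0" for a
    by (simp add: ract_distribs \<rho>_def ract_mul)
  from coboundary[OF v(1) this] obtain G where
    G: "\<And>a b. G (a + b) = G a + G b" "\<And>c a. G (Asc c a) = C [:c:] \<rhd> G a"
    "\<And>a. deg_cochain (Suc n) (G a)" "\<And>a b. a \<rhd> G b - G (a \<star> b) + G a \<lhd> b = F a b"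
    by metis
  define g where "g rs = (case rs of [] \<Rightarrow> 0 | a # rs' \<Rightarrow> G a rs')" for rs
  show thesis
  proof (rule that)
    show "deg_cochain (Suc (Suc n)) g"
      by (rule deg_cochain_SucI) (auto simp: g_def G(1,2,3) plus_fun_apply lact_apply simp flip: Asc_eq)
    show "hdiff h g = f"
    proof
      fix xs :: "'a poly poly list"
      consider "xs = []" | a where "xs = [a]" | a b rs where "xs = a # b # rs"
        by (metis list.exhaust)
      thus "hdiff h g xs = f xs"
      proof cases
        case (3 a b rs)
        have "hdiff h g xs = (a \<rhd> G b - G (a \<star> b) + G a \<lhd> b) rs"
          unfolding 3 hdiff_Cons2 by (simp add: g_def plus_fun_apply minus_apply)
        also have "\<dots> = f xs" by (simp add: G 3 F_def)
        finally show ?thesis .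
      qed (use f in \<open>auto simp: deg_cochain_def hdiff_Cons g_def\<close>)
    qed
  qed
qed

section \<open>Cohomology in degrees one and two\<close>

text \<open>Identifies \<open>A\<close> with the cochains of degree 0; both actions become
  multiplication in \<open>A\<close>, and here the right action is unital.\<close>

definition const_cochain :: "'a poly poly \<Rightarrow> 'a poly poly list \<Rightarrow> 'a poly poly" where
  "const_cochain w rs = (if rs = [] then w else 0)"

lemma deg_const_cochain: "deg_cochain 0 (const_cochain w)"
  by (auto simp: deg_cochain_def multilin_def const_cochain_def)

lemma ract_const_cochain: "const_cochain w \<lhd> a = const_cochain (w \<star> a)"
proof
  fix rs show "(const_cochain w \<lhd> a) rs = const_cochain (w \<star> a) rs"
  proof (cases rs)
    case (Cons b rs')
    have "(\<lambda>ys. const_cochain w (a # ys)) = 0"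
      by (simp add: const_cochain_def zero_fun_def)
    thus ?thesis
      by (simp add: Cons ract_Cons ract_distribs zero_fun_apply) (simp add: const_cochain_def)
  qed (simp add: ract_Nil const_cochain_def)
qed

lemma lact_const_cochain: "a \<rhd> const_cochain w = const_cochain (a \<star> w)"
  by (auto simp: const_cochain_def lact_def)

lemma const_cochain_0 [simp]: "const_cochain 0 = 0"
  by (auto simp: const_cochain_def zero_fun_def)

lemma const_cochain_eqI: "deg_cochain 0 f \<Longrightarrow> f [] = w \<Longrightarrow> f = const_cochain w"
  by (auto simp: const_cochain_def deg_cochain_def)

lemma Suc_Suc_0_eq: "Suc (Suc 0) = 2"
  by simp

lemma multilin_single:
  assumes "multilin g"
  shows "g [a + b] = g [a] + g [b]" "g [Asc c a] = Asc c (g [a])"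
  using multilin_add_hd[OF assms, of a b "[]"] multilin_Asc_hd[OF assms, of c a "[]"] by auto

text \<open>The element \<open>gx q []\<close> for values in degree 0, defined for every
  \<open>f\<close>, cocycle or not, so that additivity in \<open>f\<close> and \<open>u\<close> can
  be stated.\<close>

definition poly_value :: "('a poly poly list \<Rightarrow> 'a poly poly) \<Rightarrow> 'a poly poly \<Rightarrow> 'a poly \<Rightarrow> 'a poly poly" where
  "poly_value f u q = snd (poly_rep.poly_act scE (XEg (const_cochain u) (\<lambda>a rs. f (Ax # a # rs))) q
     (1, \<lambda>rs. f (1 # 1 # rs))) []"

text \<open>For a coboundary \<open>f = hdiff h g\<close> and \<open>u = g [x]\<close> the element \<open>poly_value f u q\<close> is \<open>g [q]\<close>.\<close>
lemma poly_value_pCons: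
  assumes "deg_cochain 2 f"
  shows "poly_value f u (pCons c q) = Asc c (f [1, 1]) + (Ax \<star> poly_value f u q + u \<star> C q - f [Ax, C q])"
    and "poly_value f u 0 = 0"
proof -
  note f1 = deg_cochain_SucD[OF assms[folded Suc_Suc_0_eq]]
  note f2 = deg_cochain_SucD[OF f1(1)]
  interpret poly_rep scE "XEg (const_cochain u) (\<lambda>a rs. f (Ax # a # rs))"
    by (rule poly_rep_XEg)
       (auto simp: deg_cochain_multilin[OF deg_const_cochain] fun_eq_iff plus_fun_apply f1 f2 lact_apply
             simp flip: Asc_eq)
  show "poly_value f u (pCons c q) = Asc c (f [1, 1]) + (Ax \<star> poly_value f u q + u \<star> C q - f [Ax, C q])"
    by (simp add: poly_value_def fst_poly_act_XEg[OF poly_rep_axioms] plus_fun_apply minus_apply lact_apply ract_Nil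
                  const_cochain_def Asc_eq)
  show "poly_value f u 0 = 0" by (simp add: poly_value_def zero_fun_apply)
qed

lemma poly_value_add:
  assumes "deg_cochain 2 f" "deg_cochain 2 f'"
  shows "poly_value (f + f') (u + u') q = poly_value f u q + poly_value f' u' q"
proof (induction q)
  case (pCons c q)
  show ?case
    unfolding poly_value_pCons[OF deg_cochain_add[OF assms]] poly_value_pCons[OF assms(1)] poly_value_pCons[OF assms(2)] pCons
    by (simp add: plus_fun_apply Asc_add mul_distribs)
qed (simp_all add: poly_value_pCons assms deg_cochain_add)

lemma poly_value_lact:
  assumes "deg_cochain 2 f" and z: "\<And>a. z \<star> a = a \<star> z"
  shows "poly_value (z \<rhd> f) (z \<star> u) q = z \<star> poly_value f u q"
proof (induction q)
  case (pCons c q)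
  have "z \<star> (Ax \<star> a) = Ax \<star> (z \<star> a)" for a
    by (metis mul_assoc z)
  thus ?case
    unfolding poly_value_pCons[OF deg_cochain_lact[OF assms(1)]] poly_value_pCons[OF assms(1)] pCons
    by (simp add: lact_apply mul_distribs mul_assoc mul_Asc_right)
qed (simp_all add: poly_value_pCons assms(1) deg_cochain_lact)

lemma poly_value_vanish:
  assumes "deg_cochain 2 f" and "f [1, 1] = 0" "\<And>q. f [Ax, C q] = 0"
  shows "poly_value f 0 q = 0"
  by (induction q) (simp_all add: poly_value_pCons assms)

lemma poly_value_coboundary:
  assumes "deg_cochain 2 f" "multilin g" "\<And>a b. f [a, b] = hdiff h g [a, b]"
  shows "poly_value f (g [Ax]) q = g [C q]"
proof (induction q)
  case 0
  thus ?case using multilin_single(2)[OF assms(2), of 0 0]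
    by (simp add: poly_value_pCons assms(1) Asc_def)
next
  case (pCons c q)
  have "g [C (pCons c q)] = Asc c (g [1]) + g [Ax \<star> C q]"
    unfolding C_pCons[of c q] by (simp add: multilin_single[OF assms(2)])
  moreover have "f [Ax, C q] = Ax \<star> g [C q] - g [Ax \<star> C q] + g [Ax] \<star> C q" "f [1, 1] = g [1]"
    by (simp_all add: assms(3) hdiff_Cons)
  ultimately show ?case using pCons
    by (simp add: poly_value_pCons[OF assms(1)])
qed

text \<open>The obstruction \<open>obstr\<close> for values in \<open>A\<close>, as an element of
  \<open>A\<close>. The class of a 2-cocycle \<open>f\<close> will be that of
  \<open>obs f 0 0\<close> modulo all elements \<open>obs 0 u v\<close>.\<close>

definition obs :: "('a poly poly list \<Rightarrow> 'a poly poly) \<Rightarrow> 'a poly poly \<Rightarrow> 'a poly poly \<Rightarrow> 'a poly poly" where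
  "obs f u v = Ax \<star> v - v \<star> Ax + u \<star> Ay - Ay \<star> u + poly_value f u h + f [Ay, Ax] - f [Ax, Ay]"

lemma obs_add:
  assumes "deg_cochain 2 f" "deg_cochain 2 f'"
  shows "obs (f + f') (u + u') (v + v') = obs f u v + obs f' u' v'"
  by (simp add: obs_def poly_value_add assms mul_distribs plus_fun_apply)

lemma obs_lact:
  assumes "deg_cochain 2 f" and z: "\<And>a. z \<star> a = a \<star> z"
  shows "obs (z \<rhd> f) (z \<star> u) (z \<star> v) = z \<star> obs f u v"
proof -
  have "Ax \<star> (z \<star> a) = z \<star> (Ax \<star> a)" "Ay \<star> (z \<star> a) = z \<star> (Ay \<star> a)" for a
    by (metis mul_assoc z)+
  thus ?thesis
    by (simp add: obs_def poly_value_lact[OF assms] lact_apply mul_distribs mul_assoc)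
qed

text \<open>Apply \<open>g\<close> to the relation \<open>y x = x y + h\<close> and expand
  \<open>g [y x]\<close> and \<open>g [x y]\<close> by means of \<open>f\<close>.\<close>

lemma obs_coboundary:
  assumes "deg_cochain 2 f" "multilin g" "\<And>a b. f [a, b] = hdiff h g [a, b]"
  shows "obs f (g [Ax]) (g [Ay]) = 0"
proof -
  have "g [Ay \<star> Ax] = g [Ax \<star> Ay] + g [C h]"
    unfolding YX by (simp add: multilin_single[OF assms(2)])
  moreover have "f [Ay, Ax] = Ay \<star> g [Ax] - g [Ay \<star> Ax] + g [Ay] \<star> Ax"
    "f [Ax, Ay] = Ax \<star> g [Ay] - g [Ax \<star> Ay] + g [Ax] \<star> Ay"
    by (simp_all add: assms(3) hdiff_Cons)
  ultimately show ?thesis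
    by (simp add: obs_def poly_value_coboundary[OF assms])
qed

text \<open>The extension theorem for values in \<open>A\<close>. The values of \<open>g\<close> at
  \<open>x\<close> and \<open>y\<close> are recorded so that the case \<open>f = 0\<close> yields
  derivations with prescribed values.\<close>

lemma coboundary_2:
  assumes f: "deg_cochain 2 f" and d: "hdiff h f = (\<lambda>_. 0)" and o: "obs f u v = 0"
  obtains g where "deg_cochain 1 g" "hdiff h g = f"
    "g [Ax] = Ax \<star> f [1, 1] + u - f [Ax, 1]" "g [Ay] = Ay \<star> f [1, 1] + v - f [Ay, 1]"
proof -
  define F where "F a b = (\<lambda>rs. f (a # b # rs))" for a b
  interpret ore_cocycle h 0 F "const_cochain u"
    unfolding F_def using ore_cocycleI[OF _ d deg_const_cochain] f[folded Suc_Suc_0_eq] by blast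
  have "gx h [] = poly_value f u h"
    unfolding gx_def poly_value_def F_def ..
  hence "obstr (const_cochain v) [] = obs f u v"
    by (simp add: obstr_def obs_def plus_fun_apply minus_apply ract_const_cochain lact_const_cochain
        const_cochain_def F_def)
  moreover have "deg_cochain 0 (obstr (const_cochain v))"
    unfolding obstr_def by (intro deg_cochain_intros deg_const_cochain deg_gx deg_F)
  ultimately have "obstr (const_cochain v) = 0"
    using const_cochain_eqI[of _ 0] o by simp
  hence "obstr (const_cochain v) \<lhd> a = 0" for a
    by (simp add: ract_distribs)
  from coboundary[OF deg_const_cochain this] obtain G where
    G: "\<And>a b. G (a + b) = G a + G b" "\<And>c a. G (Asc c a) = C [:c:] \<rhd> G a"
    "\<And>a. deg_cochain 0 (G a)" "\<And>a b. a \<rhd> G b - G (a \<star> b) + G a \<lhd> b = F a b" "G 1 = F 1 1"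
    "\<And>a. G (Ax \<star> a) = Ax \<rhd> G a + const_cochain u \<lhd> a - F Ax a"
    "\<And>a. G (Ay \<star> a) = Ay \<rhd> G a + const_cochain v \<lhd> a - F Ay a"
    by metis
  define g where "g rs = (case rs of [] \<Rightarrow> 0 | a # rs' \<Rightarrow> G a rs')" for rs
  show thesis
  proof (rule that)
    show "deg_cochain 1 g"
      unfolding One_nat_def
      by (rule deg_cochain_SucI) (auto simp: g_def G(1,2,3) plus_fun_apply lact_apply simp flip: Asc_eq)
    show "hdiff h g = f"
    proof
      fix xs :: "'a poly poly list"
      consider "xs = []" | a where "xs = [a]" | a b rs where "xs = a # b # rs"
        by (metis list.exhaust)
      thus "hdiff h g xs = f xs"
      proof cases
        case (3 a b rs)
        have "hdiff h g xs = (a \<rhd> G b - G (a \<star> b) + G a \<lhd> b) rs"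
          unfolding 3 hdiff_Cons2 by (simp add: g_def plus_fun_apply minus_apply)
        also have "\<dots> = f xs" by (simp add: G 3 F_def)
        finally show ?thesis .
      qed (use f in \<open>auto simp: deg_cochain_def hdiff_Cons g_def\<close>)
    qed
    show "g [Ax] = Ax \<star> f [1, 1] + u - f [Ax, 1]"
      using G(6)[of 1] by (simp add: g_def G(5) F_def plus_fun_apply minus_apply lact_apply ract_const_cochain const_cochain_def)
    show "g [Ay] = Ay \<star> f [1, 1] + v - f [Ay, 1]"
      using G(7)[of 1] by (simp add: g_def G(5) F_def plus_fun_apply minus_apply lact_apply ract_const_cochain const_cochain_def)
  qed
qed

text \<open>Every element of \<open>A\<close> occurs as an obstruction. By the dimension shift a
  2-cocycle is a derivation \<open>G\<close> into the 1-cochains. Take \<open>x \<mapsto> 0\<close>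
  and \<open>y \<mapsto> \<tau>\<close>, where \<open>\<tau>\<close> commutes with \<open>x\<close>
  and has the value \<open>w\<close> at \<open>x\<close>; then the relation is respected and
  \<open>f [y, x] = w\<close>.\<close>

lemma cocycle_2_with_class:
  obtains f where "deg_cochain 2 f" "hdiff h f = (\<lambda>_. 0)" "obs f 0 0 = w" "\<And>q b. f [C q, b] = 0"
    "f [Ay, Ax] = w"
proof -
  obtain \<tau> where \<tau>: "deg_cochain (Suc 0) \<tau>"
    "\<And>a rs. \<tau> ((Ax \<star> a) # rs) = Ax \<star> \<tau> (a # rs) + (const_cochain w \<lhd> a) rs - 0 (a # rs)"
    "\<And>k rs. \<tau> (monom 1 k # rs) = 0"
    using solve_left_mult_X[OF deg_const_cochain deg_cochain_0, of w] by blast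
  have \<tau>1: "\<tau> (1 # rs) = 0" for rs
    using \<tau>(3)[of 0] by (simp add: monom_0 flip: one_pCons)
  have \<tau>X: "(\<lambda>rs. \<tau> (Ax # rs)) = const_cochain w"
    using \<tau>(2)[of 1] \<tau>1 by (auto simp: fun_eq_iff zero_fun_apply ract_const_cochain)
  have comm: "Ax \<rhd> \<tau> - \<tau> \<lhd> Ax = 0"
    by (rule commutator_X_solution[OF _ \<tau>(2) \<tau>X]) (use deg_cochain_SucD[OF \<tau>(1)] in \<open>auto simp: zero_fun_apply\<close>)
  define Z :: "'a poly poly \<Rightarrow> 'a poly poly \<Rightarrow> 'a poly poly list \<Rightarrow> 'a poly poly" where "Z a b = 0" for a b
  interpret ore_cocycle h "Suc 0" Z 0
    by unfold_locales (simp_all add: Z_def deg_cochain_0 lact_distribs ract_distribs)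
  have "gx q = 0" for q
  proof (induction q)
    case (pCons c q)
    show ?case unfolding gx_pCons pCons by (simp add: Z_def lact_distribs ract_distribs)
  qed (rule gx_0)
  hence "obstr \<tau> = 0"
    unfolding obstr_def comm by (simp add: lact_distribs ract_distribs Z_def)
  hence "obstr \<tau> \<lhd> a = 0" for a by (simp add: ract_distribs)
  from coboundary[OF \<tau>(1) this] obtain G where
    G: "\<And>a b. G (a + b) = G a + G b" "\<And>c a. G (Asc c a) = C [:c:] \<rhd> G a"
    "\<And>a. deg_cochain (Suc 0) (G a)" "\<And>a b. a \<rhd> G b - G (a \<star> b) + G a \<lhd> b = Z a b" "G 1 = Z 1 1"
    "\<And>a. G (Ax \<star> a) = Ax \<rhd> G a + 0 \<lhd> a - Z Ax a"
    "\<And>a. G (Ay \<star> a) = Ay \<rhd> G a + \<tau> \<lhd> a - Z Ay a"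
    by metis
  note G = G[unfolded Z_def]
  define f where "f rs = (case rs of [] \<Rightarrow> 0 | a # rs' \<Rightarrow> G a rs')" for rs
  have deg: "deg_cochain 2 f"
    unfolding Suc_Suc_0_eq[symmetric]
    by (rule deg_cochain_SucI) (auto simp: f_def G(1,2,3) plus_fun_apply lact_apply simp flip: Asc_eq)
  have GC: "G (C q) = 0" for q
  proof (induction q)
    case 0 show ?case using G(1)[of 0 0] by simp
  next
    case (pCons c q)
    show ?case unfolding C_pCons[of c q] by (simp add: G pCons lact_distribs ract_distribs)
  qed
  hence fC: "f [C q, b] = 0" for q b
    by (simp add: f_def zero_fun_apply)
  have fYX: "f [Ay, Ax] = w"
    using G(7)[of 1] \<tau>X \<tau>1 by (simp add: f_def G(5) lact_distribs ract_Nil ract_Cons fun_eq_iff const_cochain_def)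
  have fX: "f [Ax, b] = 0" for b
    unfolding Ax_def by (rule fC)
  have f1: "f [1, 1] = 0"
    using fC[of 1] by (simp flip: one_pCons)
  have "obs f 0 0 = w"
    using poly_value_vanish[OF deg f1 fX, of h] by (simp add: obs_def fYX fX)
  moreover have "hdiff h f = (\<lambda>_. 0)"
  proof
    fix xs :: "'a poly poly list"
    consider "xs = []" | a where "xs = [a]" | a b rs where "xs = a # b # rs"
      by (metis list.exhaust)
    thus "hdiff h f xs = 0"
    proof cases
      case (3 a b rs)
      have "hdiff h f xs = (a \<rhd> G b - G (a \<star> b) + G a \<lhd> b) rs"
        unfolding 3 hdiff_Cons2 by (simp add: f_def plus_fun_apply minus_apply)
      also have "\<dots> = 0" unfolding G(4) by (simp add: zero_fun_apply)
      finally show ?thesis .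
    qed (use deg in \<open>auto simp: deg_cochain_def hdiff_Cons\<close>)
  qed
  ultimately show thesis using that deg fC fYX by blast
qed

lemma deg_cochain_imp_cochain: "deg_cochain m f \<Longrightarrow> cochain f"
  unfolding deg_cochain_def cochain_def
  by (auto intro!: finite_subset[of _ "{m}"])

lemma obs_split:
  assumes "deg_cochain 2 f" shows "obs f u v = obs f 0 0 + obs 0 u v"
  using obs_add[OF assms deg_cochain_0, of 0 u 0 v] by simp

lemma obs_0_add: "obs 0 (u + u') (v + v') = obs 0 u v + obs 0 u' v'"
  using obs_add[OF deg_cochain_0 deg_cochain_0] by simp

lemma obs_0_0 [simp]: "obs 0 0 0 = 0"
  using obs_0_add[of 0 0 0 0] by (metis add_0 add_cancel_right_right)

lemma obs_0_minus: "obs 0 (- u) (- v) = - obs 0 u v"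
  using obs_0_add[of u "- u" v "- v"] by (simp add: eq_neg_iff_add_eq_0 add.commute)

text \<open>By additivity \<open>obs f u v = obs f 0 0 + obs 0 u v\<close>, so a suitable pair
  \<open>u\<close>, \<open>v\<close> exists exactly if \<open>obs f 0 0\<close> is a value of the
  obstruction map of the zero cocycle. With \<open>cocycle_2_with_class\<close> this identifies the
  second cohomology with the cokernel of that map.\<close>

theorem coboundaries_2_iff:
  assumes "f \<in> cocycles_deg h 2"
  shows "f \<in> coboundaries_deg h 2 \<longleftrightarrow> (\<exists>u v. obs f 0 0 = obs 0 u v)"
proof
  have f: "deg_cochain 2 f" "hdiff h f = (\<lambda>_. 0)"
    using assms by (auto simp: cocycles_deg_def)
  {
    assume "f \<in> coboundaries_deg h 2"
    then obtain g where g: "f = hdiff h g" "cochain g"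
      by (auto simp: coboundaries_deg_def coboundaries_def)
    have "obs f (g [Ax]) (g [Ay]) = 0"
      by (rule obs_coboundary) (use f g in \<open>auto simp: cochain_def\<close>)
    hence "obs f 0 0 = obs 0 (- g [Ax]) (- g [Ay])"
      unfolding obs_split[OF f(1), of "g [Ax]" "g [Ay]"] obs_0_minus eq_neg_iff_add_eq_0 .
    thus "\<exists>u v. obs f 0 0 = obs 0 u v" by blast
  next
    assume "\<exists>u v. obs f 0 0 = obs 0 u v"
    then obtain u v where "obs f 0 0 = obs 0 u v" by blast
    hence "obs f (- u) (- v) = 0"
      by (subst obs_split[OF f(1)]) (simp add: obs_0_minus)
    from coboundary_2[OF f this] obtain g where "deg_cochain 1 g" "hdiff h g = f" by metis
    thus "f \<in> coboundaries_deg h 2"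
      using f(1) deg_cochain_imp_cochain by (auto simp: coboundaries_deg_def coboundaries_def)
  }
qed

lemma derivation_obs:
  assumes "multilin f" "\<And>a b. hdiff h f [a, b] = 0"
  shows "obs 0 (f [Ax]) (f [Ay]) = 0"
  by (rule obs_coboundary[OF deg_cochain_0 assms(1)]) (simp only: zero_fun_apply assms)

lemma derivation_exists:
  assumes "obs 0 u v = 0"
  obtains f where "deg_cochain 1 f" "hdiff h f = (\<lambda>_. 0)" "f [Ax] = u" "f [Ay] = v"
proof -
  have "hdiff h 0 = (\<lambda>_. 0)"
  proof
    fix xs show "hdiff h 0 xs = 0"
      using tdiff_zero by (cases xs) (simp_all add: hdiff_Cons zero_fun_def)
  qed
  from coboundary_2[OF deg_cochain_0 this assms] that show thesis
    by (auto simp: zero_fun_def)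
qed

lemma derivation_eq_0:
  assumes f: "deg_cochain 1 f" "hdiff h f = (\<lambda>_. 0)" "f [Ax] = 0" "f [Ay] = 0"
  shows "f xs = 0"
proof -
  have m: "multilin f" using f by (simp add: deg_cochain_def)
  have p: "f [a \<star> b] = a \<star> f [b] + f [a] \<star> b" for a b
    using fun_cong[OF f(2), of "[a, b]"] by (simp add: hdiff_Cons algebra_simps eq_commute)
  have 1: "f [1] = 0" using p[of 1 1] by (metis mul_1_left mul_1_right add_cancel_right_right)
  have "f [a] = 0" for a
  proof (induction a rule: ore_induct)
    case (scalar c)
    have "C [:c:] = Asc c 1" by (simp add: Asc_def)
    thus ?case using multilin_single(2)[OF m, of c 1] 1 by simp
  qed (simp_all add: multilin_single[OF m] p f)
  moreover have "f xs = 0" if "length xs \<noteq> 1"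
    using f that by (simp add: deg_cochain_def)
  ultimately show ?thesis
    by (cases "length xs = 1") (auto simp: length_Suc_conv)
qed

end

section \<open>Derivatives in positive characteristic\<close>

text \<open>In positive characteristic this operator is linear over the polynomials with derivative
  zero, takes its values among them, and its kernel is the image of \<open>pderiv\<close>.\<close>

definition top_pderiv :: "'a::field poly \<Rightarrow> 'a poly" where
  "top_pderiv f = (pderiv ^^ (CHAR('a) - 1)) f"

lemma prime_CHAR_field:
  assumes "CHAR('a::field) > 0" shows "prime CHAR('a)"
  using assms prime_CHAR_semidom by blast

lemma higher_pderiv_mult_const:
  fixes c :: "'a::field poly"
  assumes "pderiv c = 0" shows "(pderiv ^^ k) (c * f) = c * (pderiv ^^ k) f"
  by (induction k) (simp_all add: pderiv_mult assms)

lemma top_pderiv_mult_const: "pderiv c = 0 \<Longrightarrow> top_pderiv (c * f) = c * top_pderiv f"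
  by (simp add: top_pderiv_def higher_pderiv_mult_const)

lemma top_pderiv_add: "top_pderiv (f + g) = top_pderiv f + top_pderiv g"
  by (simp add: top_pderiv_def higher_pderiv_add)

lemma top_pderiv_minus: "top_pderiv (- f) = - top_pderiv f"
  using top_pderiv_mult_const[of "-1" f] by (simp add: pderiv_minus)

lemma top_pderiv_diff: "top_pderiv (f - g) = top_pderiv f - top_pderiv g"
  using top_pderiv_add[of f "-g"] by (simp add: top_pderiv_minus)

lemma coeff_higher_pderiv_prod:
  fixes f :: "'a::field poly"
  shows "coeff ((pderiv ^^ k) f) n = of_nat (\<Prod>i<k. n + 1 + i) * coeff f (n + k)"
proof (induction k arbitrary: n)
  case (Suc k)
  have "(\<Prod>i<Suc k. n + 1 + i) = Suc n * (\<Prod>i<k. Suc n + 1 + i)"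
    by (subst prod.lessThan_Suc_shift) simp
  thus ?case by (simp add: coeff_pderiv Suc algebra_simps)
qed simp

text \<open>Each coefficient acquires a product of \<open>p\<close> consecutive integers, one of
  which is divisible by \<open>p\<close>.\<close>

lemma higher_pderiv_char:
  fixes f :: "'a::field poly"
  assumes "CHAR('a) > 0"
  shows "(pderiv ^^ CHAR('a)) f = 0"
proof (rule poly_eqI)
  fix n
  define p where "p = CHAR('a)"
  define i where "i = p - 1 - n mod p"
  have "n mod p < p" using assms by (simp add: p_def)
  hence i: "i < p" and i': "n mod p + 1 + i = p" by (auto simp: i_def)
  have "n + 1 + i = p * (n div p) + (n mod p + 1 + i)" by simp
  hence "p dvd n + 1 + i" unfolding i' by simp
  also have "\<dots> dvd (\<Prod>i<p. n + 1 + i)" using i by (intro dvd_prodI) auto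
  finally have "of_nat (\<Prod>i<p. n + 1 + i) = (0 :: 'a)"
    by (simp only: of_nat_eq_0_iff_char_dvd p_def)
  thus "coeff ((pderiv ^^ CHAR('a)) f) n = coeff 0 n"
    unfolding coeff_higher_pderiv_prod by (simp add: p_def)
qed

lemma pderiv_top_pderiv:
  fixes f :: "'a::field poly"
  assumes "CHAR('a) > 0" shows "pderiv (top_pderiv f) = 0"
proof -
  have "(pderiv ^^ Suc (CHAR('a) - 1)) f = 0" using higher_pderiv_char[of f] assms by simp
  thus ?thesis by (simp add: top_pderiv_def)
qed

lemma top_pderiv_pderiv:
  fixes f :: "'a::field poly"
  assumes "CHAR('a) > 0" shows "top_pderiv (pderiv f) = 0"
proof -
  have "(pderiv ^^ Suc (CHAR('a) - 1)) f = 0" using higher_pderiv_char[of f] assms by simp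
  thus ?thesis by (simp only: top_pderiv_def funpow_Suc_right o_apply)
qed

lemma of_nat_prod_neq_0:
  assumes "CHAR('a::field) > 0" "CHAR('a) dvd n"
  shows "of_nat (\<Prod>i<CHAR('a) - 1. n + 1 + i) \<noteq> (0 :: 'a)"
proof
  define p where "p = CHAR('a)"
  have p: "prime p" using assms prime_CHAR_field by (simp add: p_def)
  assume "of_nat (\<Prod>i<CHAR('a) - 1. n + 1 + i) = (0 :: 'a)"
  hence "p dvd (\<Prod>i<p - 1. n + 1 + i)" by (simp only: of_nat_eq_0_iff_char_dvd p_def)
  then obtain i where "i < p - 1" "p dvd n + 1 + i"
    using p by (auto simp: prime_dvd_prod_iff)
  moreover have "p dvd n" using assms by (simp add: p_def)
  ultimately have "p dvd 1 + i" "1 + i < p"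
    using dvd_add_right_iff[of p n "1 + i"] by (auto simp: add.assoc)
  thus False using nat_dvd_not_less by (metis add_gr_0 zero_less_one)
qed

text \<open>Only coefficients of \<open>x\<^sup>n\<close> with \<open>p\<close> dividing
  \<open>n + 1\<close> obstruct integration, and \<open>top_pderiv\<close> multiplies exactly these
  by nonzero scalars.\<close>

lemma antiderivative_exists:
  fixes f :: "'a::field poly"
  assumes "CHAR('a) > 0" "top_pderiv f = 0"
  obtains g where "f = pderiv g"
proof -
  define p where "p = CHAR('a)"
  have 0: "coeff f n = 0" if "p dvd Suc n" for n
  proof -
    have "n \<ge> p - 1" using that dvd_imp_le[of p "Suc n"] by simp
    then obtain m where n: "n = m + (p - 1)" by (metis le_add_diff_inverse2)
    have "p dvd m + p" using that n assms by (simp add: p_def)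
    hence "p dvd m" by simp
    have "coeff (top_pderiv f) m = of_nat (\<Prod>i<p - 1. m + 1 + i) * coeff f n"
      unfolding top_pderiv_def coeff_higher_pderiv_prod n p_def ..
    thus ?thesis using of_nat_prod_neq_0[where 'a = 'a, of m] assms \<open>p dvd m\<close> by (simp add: p_def)
  qed
  define g where "g = Abs_poly (\<lambda>n. case n of 0 \<Rightarrow> 0 | Suc m \<Rightarrow> coeff f m / of_nat (Suc m))"
  have "coeff g n = (case n of 0 \<Rightarrow> 0 | Suc m \<Rightarrow> coeff f m / of_nat (Suc m))" for n
    unfolding g_def
    by (subst coeff_Abs_poly[of "Suc (degree f)"]) (auto simp: coeff_eq_0 split: nat.splits)
  hence "f = pderiv g"
    using 0 by (intro poly_eqI) (auto simp: coeff_pderiv p_def of_nat_eq_0_iff_char_dvd simp del: of_nat_Suc)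
  thus thesis using that by blast
qed

lemma top_pderiv_monom:
  assumes "CHAR('a::field) > 0"
  obtains c :: "'a::field" where "c \<noteq> 0" "top_pderiv (monom 1 (CHAR('a::field) - 1)) = [:c:]"
proof -
  define p where "p = CHAR('a)"
  define c where "c = (of_nat (\<Prod>i<p - 1. 0 + 1 + i) :: 'a)"
  have "c \<noteq> 0" unfolding c_def p_def by (rule of_nat_prod_neq_0) (use assms in auto)
  moreover have "top_pderiv (monom 1 (p - 1)) = [:c:]"
    unfolding top_pderiv_def
    by (rule poly_eqI) (auto simp: coeff_higher_pderiv_prod c_def p_def coeff_pCons split: nat.splits)
  ultimately show thesis using that[of c] unfolding p_def by blast
qed

section \<open>The cokernel of \<open>wronski h j\<close> for \<open>h\<close> coprime to its
  derivative\<close>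

lemma pderiv_power_Suc': "pderiv (f ^ Suc k) = of_nat (Suc k) * f ^ k * pderiv f"
  for f :: "'a::field poly"
  by (simp add: pderiv_power_Suc of_nat_poly del: power_Suc of_nat_Suc)

lemma is_unit_of_nat_poly: "of_nat n \<noteq> (0 :: 'a::field) \<Longrightarrow> is_unit (of_nat n :: 'a poly)"
  by (simp add: of_nat_poly is_unit_pCons_iff)

text \<open>Modulo \<open>f\<close> only the terms survive in which the \<open>k\<close> derivatives
  hit the \<open>k\<close> factors \<open>f\<close>, one each.\<close>

lemma higher_pderiv_power_mult:
  fixes f g :: "'a::field poly"
  shows "\<exists>r. (pderiv ^^ k) (f ^ k * g) = of_nat (fact k) * pderiv f ^ k * g + f * r"
proof (induction k arbitrary: g)
  case (Suc k)
  have "(pderiv ^^ Suc k) (f ^ Suc k * g) = (pderiv ^^ k) (pderiv (f ^ Suc k * g))"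
    by (simp add: funpow_swap1)
  also have "pderiv (f ^ Suc k * g) = f ^ k * (of_nat (Suc k) * pderiv f * g + f * pderiv g)"
    by (simp only: pderiv_mult pderiv_power_Suc') (simp add: algebra_simps)
  also obtain r where "(pderiv ^^ k) (f ^ k * (of_nat (Suc k) * pderiv f * g + f * pderiv g)) =
      of_nat (fact k) * pderiv f ^ k * (of_nat (Suc k) * pderiv f * g + f * pderiv g) + f * r"
    using Suc by blast
  also have "\<dots> = of_nat (fact (Suc k)) * pderiv f ^ Suc k * g
      + f * (of_nat (fact k) * pderiv f ^ k * pderiv g + r)"
    by (simp add: algebra_simps)
  finally show ?case by blast
qed auto

lemma of_nat_fact_neq_0:
  assumes "k < CHAR('a::field)" shows "of_nat (fact k) \<noteq> (0 :: 'a)"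
proof -
  have "prime CHAR('a)" using assms by (intro prime_CHAR_field) simp
  thus ?thesis using assms by (simp add: of_nat_eq_0_iff_char_dvd prime_dvd_fact_iff del: of_nat_fact)
qed

lemma pderiv_power_char: "pderiv (f ^ CHAR('a)) = 0" for f :: "'a::field poly"
  by (simp add: pderiv_power)

text \<open>The operator \<open>g \<mapsto> (h\<^bsup>j+1\<^esup> g)' / h\<^bsup>j\<^esup>\<close>.\<close>
definition wronski :: "'a::field poly \<Rightarrow> nat \<Rightarrow> 'a poly \<Rightarrow> 'a poly" where
  "wronski h j f = of_nat (Suc j) * pderiv h * f + h * pderiv f"

lemma power_mult_wronski: "h ^ j * wronski h j f = pderiv (h ^ Suc j * f)"
  by (simp only: pderiv_mult pderiv_power_Suc' wronski_def) (simp add: algebra_simps)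

lemma wronski_add: "wronski h j (f + g) = wronski h j f + wronski h j g"
  by (simp add: wronski_def pderiv_add algebra_simps)

lemma wronski_mult: "wronski h j (h * f) = h * wronski h (Suc j) f"
  by (simp add: wronski_def pderiv_mult algebra_simps)

text \<open>Downward induction on \<open>j\<close>. For \<open>j = p - 1\<close> the hypothesis
  modulo \<open>h\<close> forces \<open>h\<close> to divide \<open>g\<close>; then
  \<open>h\<^sup>p\<close>, whose derivative is zero, can be taken out, and the quotient of
  \<open>g\<close> by \<open>h\<close> has an antiderivative. In the step, coprimality solves the
  equation modulo \<open>h\<close>, and the remainder \<open>h * g1\<close> satisfies the hypothesis
  for \<open>j + 1\<close>.\<close>

lemma in_range_wronski:
  fixes h :: "'a::field_gcd poly"
  assumes p: "CHAR('a) > 0" and cop: "coprime h (pderiv h)" and "h \<noteq> 0"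
    and "j \<le> CHAR('a) - 1" and "top_pderiv (h ^ j * g) = 0"
  shows "\<exists>f. g = wronski h j f"
  using assms(4,5)
proof (induction j arbitrary: g rule: inc_induct)
  case base
  define p where "p = CHAR('a)"
  have Suc_p: "Suc (p - 1) = p" using assms(1) by (simp add: p_def)
  obtain r where r: "(pderiv ^^ (p - 1)) (h ^ (p - 1) * g) = of_nat (fact (p - 1)) * pderiv h ^ (p - 1) * g + h * r"
    using higher_pderiv_power_mult by blast
  hence "h * r = - (of_nat (fact (p - 1)) * pderiv h ^ (p - 1) * g)"
    using base by (simp add: top_pderiv_def p_def eq_neg_iff_add_eq_0 add.commute)
  hence "h dvd of_nat (fact (p - 1)) * (pderiv h ^ (p - 1) * g)"
    by (metis dvd_triv_left dvd_minus_iff mult.assoc)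
  moreover have "of_nat (fact (p - 1)) \<noteq> (0 :: 'a)"
    using assms(1) by (intro of_nat_fact_neq_0) (simp add: p_def)
  hence "is_unit (of_nat (fact (p - 1)) :: 'a poly)"
    by (rule is_unit_of_nat_poly)
  ultimately have "h dvd pderiv h ^ (p - 1) * g" by (simp add: dvd_mult_unit_iff')
  moreover have "coprime h (pderiv h ^ (p - 1))" using cop by simp
  ultimately have "h dvd g" using coprime_dvd_mult_right_iff by blast
  then obtain g2 where g2: "g = h * g2" by blast
  have "h ^ (p - 1) * g = h ^ p * g2"
    using power_Suc[of h "p - 1"] unfolding Suc_p g2 by (simp add: algebra_simps)
  hence "h ^ p * top_pderiv g2 = 0"
    using base top_pderiv_mult_const[of "h ^ p" g2] by (simp add: pderiv_power_char p_def)
  hence "top_pderiv g2 = 0" using \<open>h \<noteq> 0\<close> by simp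
  then obtain f where "g2 = pderiv f" using antiderivative_exists p by blast
  \<comment> \<open>The first summand of \<open>wronski\<close> carries the factor \<open>p\<close>,
    which is zero.\<close>
  hence "g = wronski h (p - 1) f"
    unfolding wronski_def Suc_p by (simp add: g2 p_def of_nat_poly)
  thus ?case by (auto simp: p_def)
next
  case (step j)
  define c where "c = (of_nat (Suc j) :: 'a)"
  have "\<not> CHAR('a) dvd Suc j" using step.hyps by (auto dest: dvd_imp_le)
  hence c: "c \<noteq> 0" by (simp add: c_def of_nat_eq_0_iff_char_dvd del: of_nat_Suc)
  obtain a b where ab: "a * h + b * pderiv h = 1"
    using bezout_coefficients[of h "pderiv h"] cop
    by (metis coprime_imp_gcd_eq_1 prod.exhaust)
  define f0 where "f0 = smult (inverse c) (b * g)"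
  have "of_nat (Suc j) * f0 = b * g"
    using c by (simp add: f0_def of_nat_poly flip: c_def del: of_nat_Suc)
  hence "of_nat (Suc j) * pderiv h * f0 = b * pderiv h * g"
    by (metis mult.assoc mult.commute)
  also have "\<dots> = g - h * (a * g)"
    using arg_cong[OF ab, of "\<lambda>x. x * g"] by (simp add: algebra_simps)
  finally have "g - wronski h j f0 = h * (a * g - pderiv f0)"
    by (simp add: wronski_def algebra_simps)
  then obtain g1 where g1: "g = wronski h j f0 + h * g1" by (metis diff_eq_eq add.commute)
  have "h ^ Suc j * g1 = h ^ j * g - pderiv (h ^ Suc j * f0)"
    unfolding g1 distrib_left power_mult_wronski by (simp add: algebra_simps)
  hence "top_pderiv (h ^ Suc j * g1) = 0"
    using step.prems p by (simp only: top_pderiv_diff top_pderiv_pderiv diff_0_right)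
  then obtain f1 where "g1 = wronski h (Suc j) f1" using step.IH by blast
  hence "g = wronski h j (f0 + h * f1)"
    by (simp add: g1 wronski_add wronski_mult)
  thus ?case by blast
qed

text \<open>The values for \<open>j = p - 1\<close> include some \<open>s\<close> congruent to 1
  modulo \<open>h\<close> and all products of \<open>h\<^sup>p\<close> with values of
  \<open>top_pderiv\<close>. A Bezout identity for \<open>s\<close> and \<open>h\<^sup>p\<close>,
  multiplied by some \<open>m\<close> with \<open>top_pderiv m = 1\<close>, yields the value 1. For
  smaller \<open>j\<close> the extra powers of \<open>h\<close> are absorbed into
  \<open>g\<close>.\<close>

lemma top_pderiv_power_mult_surj:
  fixes h :: "'a::field_gcd poly"
  assumes p: "CHAR('a) > 0" and cop: "coprime h (pderiv h)" and "j \<le> CHAR('a) - 1"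
  obtains g where "top_pderiv (h ^ j * g) = 1"
proof -
  define p where "p = CHAR('a)"
  have Suc_p: "Suc (p - 1) = p" using assms(1) by (simp add: p_def)
  define d where "d = of_nat (fact (p - 1)) * pderiv h ^ (p - 1)"
  have "of_nat (fact (p - 1)) \<noteq> (0 :: 'a)"
    using assms(1) by (intro of_nat_fact_neq_0) (simp add: p_def)
  hence "is_unit (of_nat (fact (p - 1)) :: 'a poly)"
    by (rule is_unit_of_nat_poly)
  hence "coprime h d" unfolding d_def using cop by (simp add: is_unit_right_imp_coprime)
  then obtain a b where ab: "a * h + b * d = 1"
    using bezout_coefficients[of h d]
    by (metis coprime_imp_gcd_eq_1 prod.exhaust)
  define s where "s = top_pderiv (h ^ (p - 1) * b)"
  obtain r where "s = d * b + h * r"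
    using higher_pderiv_power_mult[of "p - 1" h b] unfolding s_def d_def top_pderiv_def p_def by blast
  hence "s = 1 + h * (r - a)" using ab by (simp add: algebra_simps)
  hence "coprime h s"
    by (metis coprime_iff_gcd_eq_1 gcd_add_mult coprime_1_right mult.commute add.commute)
  hence "coprime s (h ^ p)" by (simp add: coprime_commute)
  then obtain u v where uv: "u * s + v * h ^ p = 1"
    using bezout_coefficients[of s "h ^ p"]
    by (metis coprime_imp_gcd_eq_1 prod.exhaust)
  obtain c :: 'a where c: "c \<noteq> 0" "top_pderiv (monom 1 (CHAR('a) - 1)) = [:c:]"
    by (rule top_pderiv_monom[OF p])
  define m where "m = smult (inverse c) (monom 1 (p - 1))"
  have m_eq: "m = [:inverse c:] * monom 1 (p - 1)" by (simp add: m_def)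
  have "top_pderiv m = [:inverse c:] * [:c:]"
    unfolding m_eq c(2)[folded p_def, symmetric] by (rule top_pderiv_mult_const) (simp add: pderiv_pCons)
  hence m: "top_pderiv m = 1" using c(1) by simp
  have s': "pderiv s = 0" unfolding s_def by (rule pderiv_top_pderiv[OF p])
  \<comment> \<open>The Bezout coefficients need not have derivative zero, so they stay inside the
    argument of \<open>top_pderiv\<close>; only \<open>s\<close> and \<open>h\<^sup>p\<close> are
    moved out.\<close>
  have "m = s * (u * m) + h ^ p * (v * m)"
    using arg_cong[OF uv, of "\<lambda>x. x * m"] by (simp add: algebra_simps)
  hence "1 = s * top_pderiv (u * m) + top_pderiv (h ^ p * (v * m))"
    using m by (metis top_pderiv_add top_pderiv_mult_const s')
  also have "s * top_pderiv (u * m) = top_pderiv (h ^ (p - 1) * (b * top_pderiv (u * m)))"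
    using top_pderiv_mult_const[OF pderiv_top_pderiv[OF p], of "u * m" "h ^ (p - 1) * b"]
    by (simp add: s_def algebra_simps)
  also have "h ^ p = h ^ (p - 1) * h" by (metis Suc_p power_Suc2)
  finally have "top_pderiv (h ^ (p - 1) * (b * top_pderiv (u * m) + h * (v * m))) = 1"
    by (simp add: top_pderiv_add distrib_left algebra_simps)
  moreover have "p - 1 = j + (p - 1 - j)"
    using assms(3) by (simp add: p_def)
  hence "h ^ (p - 1) = h ^ j * h ^ (p - 1 - j)"
    by (metis power_add)
  ultimately show thesis using that by (metis mult.assoc)
qed

text \<open>The map \<open>g \<mapsto> top_pderiv (h\<^sup>j g)\<close> is linear over the
  polynomials with derivative zero, and its kernel is the range of \<open>wronski h j\<close>. Hence
  any \<open>g0\<close> with value 1 generates the cokernel freely.\<close>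

theorem wronski_cokernel:
  fixes h :: "'a::field_gcd poly"
  assumes p: "CHAR('a) > 0" and cop: "coprime h (pderiv h)" and h: "h \<noteq> 0" and j: "j \<le> CHAR('a) - 1"
  obtains g0 where "\<And>g. \<exists>c f. pderiv c = 0 \<and> g = c * g0 + wronski h j f"
    "\<And>c f. pderiv c = 0 \<Longrightarrow> c * g0 = wronski h j f \<Longrightarrow> c = 0"
proof -
  obtain g0 where g0: "top_pderiv (h ^ j * g0) = 1"
    using top_pderiv_power_mult_surj[OF p cop j] .
  show thesis
  proof (rule that)
    fix g
    define c where "c = top_pderiv (h ^ j * g)"
    have c: "pderiv c = 0" unfolding c_def by (rule pderiv_top_pderiv[OF p])
    have "h ^ j * (g - c * g0) = h ^ j * g - c * (h ^ j * g0)" by (simp add: algebra_simps)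
    hence "top_pderiv (h ^ j * (g - c * g0)) = 0"
      by (simp add: top_pderiv_diff top_pderiv_mult_const c g0) (simp add: c_def)
    from in_range_wronski[OF p cop h j this] obtain f where "g - c * g0 = wronski h j f" by blast
    thus "\<exists>c f. pderiv c = 0 \<and> g = c * g0 + wronski h j f" using c by (metis add.commute diff_eq_eq)
  next
    fix c f assume c: "pderiv c = 0" and eq: "c * g0 = wronski h j f"
    have "c = c * top_pderiv (h ^ j * g0)" by (simp add: g0)
    also have "\<dots> = top_pderiv (c * (h ^ j * g0))" by (simp add: top_pderiv_mult_const c)
    also have "c * (h ^ j * g0) = h ^ j * (c * g0)" by (simp only: mult_ac)
    also have "\<dots> = pderiv (h ^ Suc j * f)" by (simp only: eq power_mult_wronski)
    also have "top_pderiv \<dots> = 0" by (rule top_pderiv_pderiv[OF p])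
    finally show "c = 0" .
  qed
qed

section \<open>Coordinates\<close>

text \<open>Choosing zero wherever the given coefficient is zero keeps the support finite. The
  second conclusion transfers vanishing conditions from \<open>c\<close> to
  \<open>d\<close>.\<close>

lemma poly_choice:
  fixes c :: "'b::zero poly"
  assumes "\<And>n. \<exists>y::'d::zero. P n (coeff c n) y" "\<And>n. P n 0 0"
  obtains d :: "'d::zero poly" where "\<And>n. P n (coeff c n) (coeff d n)" "\<And>n. coeff c n = 0 \<Longrightarrow> coeff d n = 0"
proof -
  obtain Y where Y: "P n (coeff c n) (Y n)" for n using assms(1) by metis
  define d where "d = Abs_poly (\<lambda>n. if coeff c n = 0 then 0 else Y n)"
  have "coeff d n = (if coeff c n = 0 then 0 else Y n)" for n
    unfolding d_def by (subst coeff_Abs_poly[of "degree c"]) (auto simp: coeff_eq_0)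
  thus thesis using that[of d] Y assms(2) by metis
qed

context ore_algebra
begin

text \<open>With \<open>y = h \<partial>\<close> this is \<open>h\<^sup>k \<partial>\<^sup>k\<close>.\<close>
primrec ebasis :: "nat \<Rightarrow> 'a poly poly" where
  "ebasis 0 = 1"
| "ebasis (Suc k) = Ay \<star> ebasis k - smult (of_nat k * pderiv h) (ebasis k)"

lemma Y_smult: "Ay \<star> smult f a = smult f (Ay \<star> a) + smult (h * pderiv f) a"
  by (simp add: mul_Y Yop_smult Dh_def)

lemma X_smult: "Ax \<star> smult f a = smult f (Ax \<star> a)"
  by (simp add: mul_X mult.commute)

lemma Y_ebasis: "Ay \<star> ebasis k = ebasis (Suc k) + smult (of_nat k * pderiv h) (ebasis k)"
  by simp

declare ebasis.simps(2) [simp del]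

lemma ebasis_X: "ebasis k \<star> Ax = Ax \<star> ebasis k + smult (of_nat k * h) (ebasis (k - 1))"
proof (induction k)
  case (Suc k)
  have YX': "Ay \<star> (Ax \<star> a) = Ax \<star> (Ay \<star> a) + smult h a" for a
    by (metis YX mul_assoc mul_add_left mul_C)
  have "ebasis (Suc k) \<star> Ax = Ay \<star> (ebasis k \<star> Ax) - smult (of_nat k * pderiv h) (ebasis k \<star> Ax)"
    by (simp add: ebasis.simps(2) mul_diff_left mul_assoc mul_smult_left)
  also have "\<dots> = Ax \<star> ebasis (Suc k) + smult (of_nat (Suc k) * h) (ebasis k)"
  proof (cases k)
    case 0
    thus ?thesis using YX by (simp add: ebasis.simps(2) mul_distribs)
  next
    case (Suc l)
    have IH: "ebasis k \<star> Ax = Ax \<star> ebasis k + smult (of_nat k * h) (ebasis l)"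
      using Suc.IH Suc by simp
    have Y: "Ay \<star> ebasis k = ebasis (Suc k) + smult (of_nat k * pderiv h) (ebasis k)"
      "Ay \<star> ebasis l = ebasis k + smult (of_nat l * pderiv h) (ebasis l)"
      using Y_ebasis[of k] Y_ebasis[of l] Suc by simp_all
    define r where "r = of_nat k * h * (of_nat l * pderiv h) + h * (of_nat k * pderiv h)"
    have r: "r = of_nat k * pderiv h * (of_nat k * h)"
      by (simp add: r_def Suc algebra_simps)
    have "Ay \<star> (ebasis k \<star> Ax) = Ax \<star> ebasis (Suc k) + smult (of_nat k * pderiv h) (Ax \<star> ebasis k)
        + smult h (ebasis k) + smult (of_nat k * h) (ebasis k) + smult r (ebasis l)"
      by (simp add: IH mul_add_right YX' Y_smult Y X_smult smult_add_right pderiv_mult r_def smult_add_left)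
    moreover have "smult (of_nat k * pderiv h) (ebasis k \<star> Ax) =
        smult (of_nat k * pderiv h) (Ax \<star> ebasis k) + smult r (ebasis l)"
      by (simp add: IH smult_add_right r)
    ultimately show ?thesis
      by (simp add: smult_add_left algebra_simps)
  qed
  finally show ?case by simp
qed simp

text \<open>The outer variable of \<open>c\<close> is read through the basis \<open>ebasis\<close>.
  In these coordinates the commutator with \<open>x\<close> becomes \<open>h\<close> times the
  derivative in the outer variable.\<close>

definition of_coords :: "'a poly poly \<Rightarrow> 'a poly poly" where
  "of_coords c = (\<Sum>n\<le>degree c. smult (coeff c n) (ebasis n))"

lemma of_coords_eq_sum: "degree c \<le> n \<Longrightarrow> of_coords c = (\<Sum>k\<le>n. smult (coeff c k) (ebasis k))"
  unfolding of_coords_def by (rule sum.mono_neutral_left) (auto simp: coeff_eq_0)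

lemma of_coords_add: "of_coords (c + d) = of_coords c + of_coords d"
proof -
  define n where "n = max (degree c) (degree d)"
  have "degree c \<le> n" "degree d \<le> n" "degree (c + d) \<le> n"
    by (auto simp: n_def degree_add_le_max)
  thus ?thesis by (simp add: of_coords_eq_sum smult_add_left sum.distrib)
qed

lemma of_coords_0 [simp]: "of_coords 0 = 0"
  by (simp add: of_coords_def)

lemma of_coords_minus: "of_coords (- c) = - of_coords c"
  using of_coords_add[of c "-c"] by (simp add: eq_neg_iff_add_eq_0 add.commute)

lemma of_coords_diff: "of_coords (c - d) = of_coords c - of_coords d"
  using of_coords_add[of c "-d"] by (simp add: of_coords_minus)

lemma of_coords_smult: "of_coords (smult f c) = smult f (of_coords c)"
  using degree_smult_le[of f c]
  by (simp add: of_coords_eq_sum[of "smult f c" "degree c"] of_coords_def[of c] smult_sum_right)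

lemma of_coords_monom: "of_coords (monom f n) = smult f (ebasis n)"
proof -
  have "of_coords (monom f n) = (\<Sum>k\<le>n. smult (coeff (monom f n) k) (ebasis k))"
    by (rule of_coords_eq_sum) (rule degree_monom_le)
  also have "\<dots> = (\<Sum>k\<le>n. if k = n then smult f (ebasis n) else 0)"
    by (intro sum.cong) auto
  finally show ?thesis by simp
qed

lemma monom_induct [case_names add monom]:
  assumes "\<And>c d. P c \<Longrightarrow> P d \<Longrightarrow> P (c + d)" "\<And>f n. P (monom f n)"
  shows "P (c :: 'b::comm_monoid_add poly)"
proof -
  have "P (\<Sum>k\<le>n. monom (g k) k)" for g :: "nat \<Rightarrow> 'b" and n
    by (induction n) (auto simp: assms)
  thus ?thesis by (metis poly_as_sum_of_monoms)
qed

lemma commutator_X_of_coords: "of_coords c \<star> Ax - Ax \<star> of_coords c = of_coords (smult h (pderiv c))"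
proof (induction c rule: monom_induct)
  case (add c d)
  thus ?case by (simp add: of_coords_add mul_distribs pderiv_add smult_add_right algebra_simps)
next
  case (monom f n)
  show ?case
    by (simp add: of_coords_monom mul_smult_left ebasis_X X_smult smult_add_right pderiv_monom smult_monom mult_ac)
qed

lemma map_poly_Dh_add: "map_poly (Dh h) (c + d) = map_poly (Dh h) c + map_poly (Dh h) d"
  by (rule poly_eqI) (simp add: coeff_map_poly Dh_add)

lemma Y_of_coords: "Ay \<star> of_coords c = of_coords (pCons 0 c + smult (pderiv h) (pCons 0 (pderiv c)) + map_poly (Dh h) c)"
proof (induction c rule: monom_induct)
  case (add c d)
  have "pCons 0 (c + d) = pCons 0 c + pCons 0 d" "pCons 0 (pderiv (c + d)) = pCons 0 (pderiv c) + pCons 0 (pderiv d)"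
    by (simp_all add: pderiv_add)
  with add show ?case
    by (simp only: of_coords_add mul_add_right map_poly_Dh_add smult_add_right add_ac)
next
  case (monom f n)
  have 1: "pCons 0 (pderiv (monom f n)) = monom (of_nat n * f) n"
    unfolding pderiv_monom by (cases n) (simp_all add: monom_Suc)
  have 2: "pCons 0 (monom f n) = monom f (Suc n)" by (simp add: monom_Suc)
  have 3: "map_poly (Dh h) (monom f n) = monom (Dh h f) n" by (simp add: map_poly_monom)
  show ?case
    unfolding 1 2 3 smult_monom of_coords_add of_coords_monom Y_smult Y_ebasis
    by (simp add: smult_add_right Dh_def mult_ac)
qed

lemma X_of_coords: "Ax \<star> of_coords c = of_coords (smult [:0, 1:] c)"
  by (simp add: mul_X of_coords_smult)

lemma of_coords_surj: obtains c where "a = of_coords c"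
proof -
  have "\<exists>c. a = of_coords c"
  proof (induction a rule: ore_induct)
    case (scalar c)
    have "C [:c:] = of_coords (monom [:c:] 0)" by (simp add: of_coords_monom)
    thus ?case by blast
  next
    case (add a b) thus ?case by (metis of_coords_add)
  next
    case (X a) thus ?case by (metis X_of_coords)
  next
    case (Y a) thus ?case by (metis Y_of_coords)
  qed
  thus thesis using that by blast
qed

text \<open>The change from the powers of \<open>y\<close> to \<open>ebasis\<close> is
  unitriangular, which makes coordinates unique.\<close>

lemma degree_ebasis: "degree (ebasis n) \<le> n \<and> coeff (ebasis n) n = 1"
proof (induction n)
  case (Suc n)
  have "degree (pCons 0 (ebasis n)) \<le> Suc n" using Suc by (meson degree_pCons_le le_trans Suc_le_mono)
  moreover have "degree (map_poly (Dh h) (ebasis n)) \<le> Suc n"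
    using Suc map_poly_degree_leq[of "Dh h" "ebasis n"] by linarith
  moreover have "degree (smult (of_nat n * pderiv h) (ebasis n)) \<le> Suc n"
    using Suc degree_smult_le[of "of_nat n * pderiv h" "ebasis n"] by linarith
  moreover have "coeff (ebasis n) (Suc n) = 0" using Suc by (intro coeff_eq_0) linarith
  ultimately show ?case
    using Suc by (auto simp: ebasis.simps(2) mul_Y Yop_def coeff_map_poly intro!: degree_diff_le degree_add_le)
qed simp

lemma of_coords_eq_0D: assumes "of_coords c = 0" shows "c = 0"
proof (rule ccontr)
  assume "c \<noteq> 0"
  define n where "n = degree c"
  have "coeff (of_coords c) n = (\<Sum>k\<le>n. coeff c k * coeff (ebasis k) n)"
    by (simp add: of_coords_def n_def coeff_sum)
  also have "\<dots> = (\<Sum>k\<le>n. if k = n then coeff c n else 0)"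
  proof (intro sum.cong refl)
    fix k assume "k \<in> {..n}"
    thus "coeff c k * coeff (ebasis k) n = (if k = n then coeff c n else 0)"
      using degree_ebasis[of k] by (cases "k = n") (auto simp: coeff_eq_0)
  qed
  also have "\<dots> = lead_coeff c" by (simp add: n_def)
  finally show False using assms \<open>c \<noteq> 0\<close> by simp
qed

lemma of_coords_eq_iff: "of_coords c = of_coords d \<longleftrightarrow> c = d"
  using of_coords_eq_0D[of "c - d"] by (auto simp: of_coords_diff)

lemma commute_X_iff: "h \<noteq> 0 \<Longrightarrow> of_coords c \<star> Ax = Ax \<star> of_coords c \<longleftrightarrow> pderiv c = 0"
  using commutator_X_of_coords[of c] of_coords_eq_0D by fastforce

lemma centralI:
  assumes "z \<star> Ax = Ax \<star> z" "z \<star> Ay = Ay \<star> z"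
  shows "z \<star> a = a \<star> z"
proof (induction a rule: ore_induct)
  case (scalar c) thus ?case by (rule mul_scalar)
next
  case (add a b) thus ?case by (simp add: mul_distribs)
next
  case (X a) thus ?case by (metis mul_assoc assms(1))
next
  case (Y a) thus ?case by (metis mul_assoc assms(2))
qed

lemma commute_C:
  assumes "z \<star> Ax = Ax \<star> z" shows "z \<star> C q = C q \<star> z"
proof (induction q)
  case (pCons c q)
  have "z \<star> (Ax \<star> C q) = Ax \<star> C q \<star> z"
    by (metis mul_assoc assms pCons.IH)
  moreover have "z \<star> Asc c 1 = Asc c 1 \<star> z"
    using mul_scalar[of z c] by (simp add: Asc_eq)
  ultimately show ?case unfolding C_pCons[of c q] by (simp add: mul_distribs)
qed simp

text \<open>The bounds on the support are essential later: for \<open>k = p\<close> they leave no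
  index divisible by \<open>p\<close>, and for \<open>k < p\<close> no index congruent to -1 modulo
  \<open>p\<close>.\<close>

lemma commutator_Y_ebasis:
  obtains d where "ebasis k \<star> Ay - Ay \<star> ebasis k = of_coords (smult h d)" "\<And>i. coeff d i \<noteq> 0 \<Longrightarrow> 1 \<le> i \<and> i < k"
proof -
  have "\<exists>d. ebasis k \<star> Ay - Ay \<star> ebasis k = of_coords (smult h d) \<and> (\<forall>i. coeff d i \<noteq> 0 \<longrightarrow> 1 \<le> i \<and> i < k)"
  proof (induction k)
    case (Suc k)
    then obtain d where d: "ebasis k \<star> Ay - Ay \<star> ebasis k = of_coords (smult h d)"
      "\<And>i. coeff d i \<noteq> 0 \<Longrightarrow> 1 \<le> i \<and> i < k" by blast
    define d' where "d' = pCons 0 d + smult (pderiv h) (pCons 0 (pderiv d))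
        + map_poly (\<lambda>f. pderiv (h * f)) d - smult (of_nat k * pderiv h) d
        + monom (of_nat k * pderiv (pderiv h)) k"
    have mp: "map_poly (Dh h) (smult h d) = smult h (map_poly (\<lambda>f. pderiv (h * f)) d)"
      by (rule poly_eqI) (simp add: coeff_map_poly Dh_def)
    have P: "pCons 0 (smult h c) = smult h (pCons 0 c)" for c by simp
    have "ebasis (Suc k) \<star> Ay - Ay \<star> ebasis (Suc k) = Ay \<star> (ebasis k \<star> Ay - Ay \<star> ebasis k)
       - smult (of_nat k * pderiv h) (ebasis k \<star> Ay - Ay \<star> ebasis k) + smult (h * pderiv (of_nat k * pderiv h)) (ebasis k)"
      by (simp add: ebasis.simps(2) mul_distribs mul_assoc mul_smult_left Y_smult smult_diff_right)
    also have "\<dots> = of_coords (smult h d')"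
      unfolding d d'_def Y_of_coords mp
      by (simp add: of_coords_add of_coords_diff of_coords_smult smult_add_right smult_diff_right pderiv_smult
           of_coords_monom smult_monom pderiv_mult mult_ac P del: smult_pCons)
    finally have "ebasis (Suc k) \<star> Ay - Ay \<star> ebasis (Suc k) = of_coords (smult h d')" .
    moreover have "1 \<le> i \<and> i < Suc k" if "coeff d' i \<noteq> 0" for i
    proof (rule ccontr)
      assume *: "\<not> (1 \<le> i \<and> i < Suc k)"
      have di: "coeff d i = 0" using d(2)[of i] * by (meson less_Suc_eq)
      moreover have "coeff (pCons 0 d) i = 0"
      proof (cases i)
        case (Suc j)
        hence "\<not> j < k" using * by simp
        hence "coeff d j = 0" using d(2)[of j] by blast
        thus ?thesis by (simp add: Suc)
      qed simp
      moreover have "coeff (pCons 0 (pderiv d)) i = 0"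
        using di by (cases i) (auto simp: coeff_pderiv)
      moreover have "coeff (monom (of_nat k * pderiv (pderiv h)) k) i = 0"
        using * by (cases i) auto
      ultimately have "coeff d' i = 0"
        unfolding d'_def coeff_add coeff_diff coeff_smult by (simp add: coeff_map_poly)
      thus False using that by simp
    qed
    ultimately show ?case by blast
  qed (auto intro: exI[of _ 0])
  thus thesis using that by blast
qed

end

section \<open>The centre and the image of the obstruction map in characteristic
  \<open>p\<close>\<close>

locale ore_algebra_char = ore_algebra h for h :: "'a::field_gcd poly" +
  fixes p :: nat
  assumes p_eq: "p = CHAR('a)" and char_pos: "p > 0" and h_nz: "h \<noteq> 0"
begin

lemma prime_p: "prime p"
  using prime_CHAR_field[where 'a = 'a] char_pos by (simp add: p_eq)

lemma of_nat_p_poly [simp]: "of_nat p = (0 :: 'a poly)"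
  by (simp add: of_nat_poly p_eq)

lemma of_nat_eq_0_iff: "of_nat n = (0 :: 'a poly) \<longleftrightarrow> p dvd n"
  by (simp add: of_nat_poly of_nat_eq_0_iff_char_dvd p_eq)

definition coords :: "'a poly poly \<Rightarrow> 'a poly poly" where
  "coords a = (THE c. of_coords c = a)"

lemma coords_of_coords [simp]: "coords (of_coords c) = c"
  unfolding coords_def using of_coords_eq_iff by blast

lemma of_coords_coords [simp]: "of_coords (coords a) = a"
  by (metis of_coords_surj coords_of_coords)

lemma coords_add: "coords (a + b) = coords a + coords b"
  by (metis of_coords_add of_coords_coords coords_of_coords)

lemma coords_minus: "coords (- a) = - coords a"
  by (metis of_coords_minus of_coords_coords coords_of_coords)

lemma coords_diff: "coords (a - b) = coords a - coords b"
  by (metis of_coords_diff of_coords_coords coords_of_coords)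

lemma coords_smult: "coords (smult f a) = smult f (coords a)"
  by (metis of_coords_smult of_coords_coords coords_of_coords)

lemma coords_0 [simp]: "coords 0 = 0"
  by (metis of_coords_0 coords_of_coords)

lemma coords_ebasis: "coords (ebasis n) = monom 1 n"
  by (metis of_coords_monom coords_of_coords smult_1_left)

lemma coords_commutator_X: "coords (a \<star> Ax - Ax \<star> a) = smult h (pderiv (coords a))"
  by (metis commutator_X_of_coords of_coords_coords coords_of_coords)

lemma inner_coeffs: "p dvd Suc n \<Longrightarrow> coeff (pderiv c) n = 0" for c :: "'a poly poly"
  by (simp add: coeff_pderiv of_nat_eq_0_iff del: of_nat_Suc)

lemma antiderivative_outer:
  fixes d :: "'a poly poly"
  assumes "\<And>n. p dvd Suc n \<Longrightarrow> coeff d n = 0"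
  obtains c where "d = pderiv c"
proof -
  \<comment> \<open>Here \<open>x\<close> is a coefficient of \<open>pCons 0 d\<close> and
    \<open>y\<close> the one of the antiderivative at the same index; at \<open>n = 0\<close> the
    constant of integration is set to zero.\<close>
  define P where "P n x y \<longleftrightarrow> (if n = 0 then y = 0 else of_nat n * y = x)" for n and x y :: "'a poly"
  have ex: "\<exists>y. P n (coeff (pCons 0 d) n) y" for n
  proof (cases n)
    case (Suc m)
    show ?thesis
    proof (cases "p dvd n")
      case True
      thus ?thesis using assms[of m] Suc by (auto simp: P_def intro!: exI[of _ 0])
    next
      case False
      hence "(of_nat n :: 'a) \<noteq> 0" by (simp add: of_nat_eq_0_iff_char_dvd p_eq)
      hence "of_nat n * smult (inverse (of_nat n)) (coeff d m) = coeff d m"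
        by (simp add: of_nat_poly)
      moreover have "coeff (pCons 0 d) n = coeff d m" "n \<noteq> 0" using Suc by simp_all
      ultimately show ?thesis unfolding P_def by metis
    qed
  qed (auto simp: P_def)
  have P0: "P n 0 0" for n by (simp add: P_def)
  obtain c where "\<And>n. P n (coeff (pCons 0 d) n) (coeff c n)"
    using poly_choice[of P "pCons 0 d"] ex P0 by metis
  hence c: "if n = 0 then coeff c n = 0 else of_nat n * coeff c n = coeff (pCons 0 d) n" for n
    by (simp add: P_def)
  have "d = pderiv c"
    by (rule poly_eqI) (use c[of "Suc _"] in \<open>simp add: coeff_pderiv del: of_nat_Suc\<close>)
  thus thesis using that by blast
qed

lemma pderiv_0_coeff:
  assumes "pderiv c = (0 :: 'a poly poly)" "\<not> p dvd n" shows "coeff c n = 0"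
proof -
  obtain m where n: "n = Suc m" using assms(2) by (cases n) auto
  have "of_nat n * coeff c n = 0"
    using arg_cong[OF assms(1), of "\<lambda>c. coeff c m"] by (simp add: coeff_pderiv n del: of_nat_Suc)
  thus ?thesis using assms(2) by (simp add: of_nat_eq_0_iff)
qed

definition inner_X :: "'a poly poly set" where
  "inner_X = {a \<star> Ax - Ax \<star> a |a. True}"

text \<open>In coordinates \<open>inner_X\<close> consists of \<open>h\<close> times the outer
  derivatives, and a polynomial is an outer derivative if and only if its coefficients at the
  indices congruent to -1 modulo \<open>p\<close> vanish.\<close>

lemma inner_X_iff: "a \<in> inner_X \<longleftrightarrow> (\<forall>n. h dvd coeff (coords a) n \<and> (p dvd Suc n \<longrightarrow> coeff (coords a) n = 0))"
proof
  assume "a \<in> inner_X"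
  then obtain b where "a = b \<star> Ax - Ax \<star> b" by (auto simp: inner_X_def)
  thus "\<forall>n. h dvd coeff (coords a) n \<and> (p dvd Suc n \<longrightarrow> coeff (coords a) n = 0)"
    by (simp add: coords_commutator_X inner_coeffs)
next
  assume *: "\<forall>n. h dvd coeff (coords a) n \<and> (p dvd Suc n \<longrightarrow> coeff (coords a) n = 0)"
  then obtain r where "coords a = smult h r"
    using const_poly_dvd_iff[of h "coords a"] by (auto elim!: dvdE)
  with * have "coeff r n = 0" if "p dvd Suc n" for n
    using that h_nz by auto
  then obtain c where "r = pderiv c" using antiderivative_outer by blast
  hence "coords a = coords (of_coords c \<star> Ax - Ax \<star> of_coords c)" by (simp add: coords_commutator_X \<open>coords a = _\<close>)
  hence "a = of_coords c \<star> Ax - Ax \<star> of_coords c" by (metis of_coords_coords)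
  thus "a \<in> inner_X" by (auto simp: inner_X_def)
qed

lemma inner_X_0: "0 \<in> inner_X"
  by (simp add: inner_X_iff)

lemma inner_X_add: "a \<in> inner_X \<Longrightarrow> b \<in> inner_X \<Longrightarrow> a + b \<in> inner_X"
  by (simp add: inner_X_iff coords_add)

lemma inner_X_minus: "a \<in> inner_X \<Longrightarrow> - a \<in> inner_X"
  by (simp add: inner_X_iff coords_minus)

lemma inner_X_diff: "a \<in> inner_X \<Longrightarrow> b \<in> inner_X \<Longrightarrow> a - b \<in> inner_X"
  by (simp add: inner_X_iff coords_diff)

lemma inner_X_smult: "a \<in> inner_X \<Longrightarrow> smult f a \<in> inner_X"
  by (simp add: inner_X_iff coords_smult)

lemma inner_X_X: "a \<in> inner_X \<Longrightarrow> Ax \<star> a \<in> inner_X"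
  by (simp add: mul_X inner_X_smult)

lemma inner_X_C: "a \<in> inner_X \<Longrightarrow> C f \<star> a \<in> inner_X"
  by (simp add: mul_C inner_X_smult)

lemma inner_XI: "a \<star> Ax - Ax \<star> a \<in> inner_X"
  by (auto simp: inner_X_def)

lemma inner_X_mul_X:
  assumes "a \<in> inner_X" shows "a \<star> Ax \<in> inner_X"
proof -
  obtain b where "a = b \<star> Ax - Ax \<star> b" using assms by (auto simp: inner_X_def)
  hence "a \<star> Ax = (b \<star> Ax) \<star> Ax - Ax \<star> (b \<star> Ax)" by (simp add: mul_diff_left mul_assoc)
  thus ?thesis using inner_XI by metis
qed

text \<open>Commutation with \<open>x\<close> follows from \<open>p = 0\<close>. By the Jacobi
  identity the commutator with \<open>y\<close> then commutes with \<open>x\<close>, so its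
  coordinates have outer derivative zero; but their support lies strictly between 0 and
  \<open>p\<close>.\<close>

lemma ebasis_p_central: "ebasis p \<star> a = a \<star> ebasis p"
proof (rule centralI)
  show X: "ebasis p \<star> Ax = Ax \<star> ebasis p"
    by (simp add: ebasis_X)
  obtain d where d: "ebasis p \<star> Ay - Ay \<star> ebasis p = of_coords (smult h d)" "\<And>i. coeff d i \<noteq> 0 \<Longrightarrow> 1 \<le> i \<and> i < p"
    using commutator_Y_ebasis[of p] by blast
  have "of_coords (smult h (pderiv (smult h d))) = (ebasis p \<star> Ay - Ay \<star> ebasis p) \<star> Ax - Ax \<star> (ebasis p \<star> Ay - Ay \<star> ebasis p)"
    unfolding commutator_X_of_coords[symmetric] d ..
  also have "\<dots> = ebasis p \<star> (Ay \<star> Ax - Ax \<star> Ay) - (Ay \<star> Ax - Ax \<star> Ay) \<star> ebasis p"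
    by (simp add: mul_distribs X mul_assoc algebra_simps) (metis X mul_assoc)
  also have "Ay \<star> Ax - Ax \<star> Ay = C h" by (simp add: YX)
  also have "ebasis p \<star> C h - C h \<star> ebasis p = 0" using commute_C[OF X] by simp
  finally have "smult h (pderiv (smult h d)) = 0" by (rule of_coords_eq_0D)
  hence pd: "pderiv d = 0" using h_nz by (simp add: pderiv_smult)
  have "d = 0"
  proof (rule poly_eqI)
    fix n show "coeff d n = coeff 0 n"
      using pderiv_0_coeff[OF pd, of n] d(2)[of n] dvd_imp_le[of p n] by force
  qed
  with d show "ebasis p \<star> Ay = Ay \<star> ebasis p" by simp
qed

lemma ebasis_p_smult: "ebasis p \<star> smult f a = smult f (ebasis p \<star> a)"
  by (metis ebasis_p_central mul_smult_left)

text \<open>The recursion for \<open>ebasis\<close> sees its index only through a factor read modulo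
  \<open>p\<close>.\<close>

lemma ebasis_add_p: "ebasis (n + p) = ebasis p \<star> ebasis n"
proof (induction n)
  case (Suc n)
  have "ebasis (Suc n + p) = Ay \<star> ebasis (n + p) - smult (of_nat (n + p) * pderiv h) (ebasis (n + p))"
    by (simp add: ebasis.simps(2))
  also have "\<dots> = ebasis p \<star> ebasis (Suc n)"
    unfolding Suc by (simp add: ebasis.simps(2) mul_diff_right ebasis_p_smult) (metis ebasis_p_central mul_assoc)
  finally show ?case .
qed simp

lemma ebasis_p_of_coords: "ebasis p \<star> of_coords d = of_coords (monom 1 p * d)"
proof (induction d rule: monom_induct)
  case (add c d) thus ?case by (simp add: mul_add_right of_coords_add distrib_left)
next
  case (monom f n) thus ?case by (simp add: of_coords_monom ebasis_p_smult mult_monom ebasis_add_p[symmetric] add.commute)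
qed

lemma ebasis_mul_of_coords: "p dvd n \<Longrightarrow> ebasis n \<star> of_coords d = of_coords (monom 1 n * d)"
proof (induction n rule: less_induct)
  case (less n)
  show ?case
  proof (cases "n = 0")
    case False
    hence n: "n \<ge> p" using less.prems by (auto dest: dvd_imp_le)
    have "ebasis n = ebasis p \<star> ebasis (n - p)" using ebasis_add_p[of "n - p"] n by simp
    moreover have "ebasis (n - p) \<star> of_coords d = of_coords (monom 1 (n - p) * d)"
      using less n char_pos by (intro less.IH) auto
    ultimately show ?thesis using n by (simp add: mul_assoc ebasis_p_of_coords mult_monom flip: mult.assoc)
  qed (simp flip: one_pCons)
qed

text \<open>The hypothesis confines \<open>c\<close> to indices divisible by \<open>p\<close>, so
  the left factor is a combination of powers of the central element \<open>ebasis p\<close> with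
  left coefficients in \<open>F[x]\<close>.\<close>

lemma of_coords_mul_of_coords:
  assumes "pderiv c = 0" shows "of_coords c \<star> of_coords d = of_coords (c * d)"
proof -
  have "of_coords (\<Sum>k\<le>n. monom (coeff c k) k) \<star> of_coords d = of_coords ((\<Sum>k\<le>n. monom (coeff c k) k) * d)" for n
  proof -
    have *: "of_coords (monom (coeff c k) k) \<star> of_coords d = of_coords (monom (coeff c k) k * d)" for k
    proof (cases "p dvd k")
      case True
      have "monom (coeff c k) k * d = smult (coeff c k) (monom 1 k * d)"
        by (simp add: smult_monom flip: mult_smult_left)
      thus ?thesis by (simp add: of_coords_monom mul_smult_left ebasis_mul_of_coords True of_coords_smult)
    qed (simp add: pderiv_0_coeff[OF assms])
    show ?thesis by (induction n) (simp_all add: * of_coords_add mul_add_left distrib_right)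
  qed
  from this[of "degree c"] show ?thesis by (simp add: poly_as_sum_of_monoms)
qed

lemma Ay_eq: "Ay = of_coords (monom 1 1)"
  using ebasis.simps(2)[of 0] by (simp add: of_coords_monom)

lemma commutator_Y_of_coords:
  assumes "pderiv c = 0" shows "Ay \<star> of_coords c - of_coords c \<star> Ay = of_coords (map_poly (Dh h) c)"
proof -
  have "of_coords c \<star> Ay = of_coords (pCons 0 c)"
    unfolding Ay_eq of_coords_mul_of_coords[OF assms] by (simp add: monom_Suc monom_0 mult.commute flip: one_pCons)
  thus ?thesis
    by (simp add: Y_of_coords assms of_coords_add)
qed

text \<open>The first condition is commutation with \<open>x\<close>; under it the commutator with
  \<open>y\<close> is the coefficientwise \<open>Dh h\<close>, which gives the second. In
  coordinates this is \<open>F[x\<^sup>p, e\<^sub>p]\<close>.\<close>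

lemma center_iff: "of_coords c \<in> Acenter h \<longleftrightarrow> pderiv c = 0 \<and> (\<forall>n. pderiv (coeff c n) = 0)"
proof
  assume "of_coords c \<in> Acenter h"
  hence z: "of_coords c \<star> a = a \<star> of_coords c" for a by (auto simp: Acenter_def)
  have 1: "pderiv c = 0" using z[of Ax] commute_X_iff[OF h_nz] by blast
  have "of_coords (map_poly (Dh h) c) = 0"
    using commutator_Y_of_coords[OF 1] z[of Ay] by simp
  hence "map_poly (Dh h) c = 0" by (rule of_coords_eq_0D)
  hence "coeff (map_poly (Dh h) c) n = 0" for n by simp
  hence "pderiv (coeff c n) = 0" for n using h_nz by (simp add: coeff_map_poly Dh_def)
  with 1 show "pderiv c = 0 \<and> (\<forall>n. pderiv (coeff c n) = 0)" by blast
next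
  assume *: "pderiv c = 0 \<and> (\<forall>n. pderiv (coeff c n) = 0)"
  have "map_poly (Dh h) c = 0" using * by (intro poly_eqI) (simp add: coeff_map_poly Dh_def)
  hence "Ay \<star> of_coords c = of_coords c \<star> Ay" using commutator_Y_of_coords * by fastforce
  moreover have "of_coords c \<star> Ax = Ax \<star> of_coords c" using * commute_X_iff[OF h_nz] by blast
  ultimately show "of_coords c \<in> Acenter h"
    using centralI[of "of_coords c"] by (auto simp: Acenter_def)
qed

lemma center_commute: "z \<in> Acenter h \<Longrightarrow> z \<star> a = a \<star> z"
  by (simp add: Acenter_def)

lemma inner_X_ebasis_p:
  assumes "a \<in> inner_X" shows "ebasis p \<star> a \<in> inner_X"
proof -
  obtain b where "a = b \<star> Ax - Ax \<star> b" using assms by (auto simp: inner_X_def)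
  hence "ebasis p \<star> a = (ebasis p \<star> b) \<star> Ax - Ax \<star> (ebasis p \<star> b)"
    by (metis ebasis_p_central mul_assoc mul_diff_right)
  thus ?thesis using inner_XI by metis
qed

text \<open>For \<open>n < p\<close> the support found in \<open>commutator_Y_ebasis\<close> avoids
  the forbidden indices. Multiplication by the central \<open>ebasis p\<close> preserves
  \<open>inner_X\<close> and gives the other cases.\<close>

lemma commutator_Y_ebasis_inner: "ebasis n \<star> Ay - Ay \<star> ebasis n \<in> inner_X"
proof (induction n rule: less_induct)
  case (less n)
  show ?case
  proof (cases "n < p")
    case True
    obtain d where d: "ebasis n \<star> Ay - Ay \<star> ebasis n = of_coords (smult h d)" "\<And>i. coeff d i \<noteq> 0 \<Longrightarrow> 1 \<le> i \<and> i < n"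
      using commutator_Y_ebasis[of n] by blast
    have "coeff d i = 0" if "p dvd Suc i" for i
      using d(2)[of i] True dvd_imp_le[OF that] by force
    thus ?thesis unfolding inner_X_iff d by simp
  next
    case False
    have "ebasis n = ebasis p \<star> ebasis (n - p)" using ebasis_add_p[of "n - p"] False by simp
    hence "ebasis n \<star> Ay - Ay \<star> ebasis n = ebasis p \<star> (ebasis (n - p) \<star> Ay - Ay \<star> ebasis (n - p))"
      by (simp add: mul_diff_right mul_assoc) (metis ebasis_p_central mul_assoc)
    also have "\<dots> \<in> inner_X" using False char_pos by (intro inner_X_ebasis_p less) auto
    finally show ?thesis .
  qed
qed

lemma commutator_Y_mod: "Ay \<star> a - a \<star> Ay - of_coords (map_poly (Dh h) (coords a)) \<in> inner_X"
proof -
  obtain c where a: "a = of_coords c" by (rule of_coords_surj)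
  have "Ay \<star> of_coords c - of_coords c \<star> Ay - of_coords (map_poly (Dh h) c) \<in> inner_X"
  proof (induction c rule: monom_induct)
    case (add c d)
    from inner_X_add[OF add] show ?case
      by (simp add: of_coords_add mul_distribs map_poly_Dh_add algebra_simps)
  next
    case (monom f n)
    have "Ay \<star> of_coords (monom f n) - of_coords (monom f n) \<star> Ay - of_coords (map_poly (Dh h) (monom f n))
       = smult f (- (ebasis n \<star> Ay - Ay \<star> ebasis n))"
      by (simp add: of_coords_monom Y_smult mul_smult_left map_poly_monom Dh_def smult_diff_right)
    thus ?case by (simp only: inner_X_smult inner_X_minus commutator_Y_ebasis_inner)
  qed
  thus ?thesis by (simp add: a)
qed

lemma commutator_C_inner: "u \<star> C q - C q \<star> u \<in> inner_X"
proof (induction q)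
  case 0 thus ?case by (simp add: inner_X_0)
next
  case (pCons c q)
  have "u \<star> C (pCons c q) - C (pCons c q) \<star> u = (u \<star> C q - C q \<star> u) \<star> Ax + C q \<star> (u \<star> Ax - Ax \<star> u)"
  proof -
    have "Ax \<star> C q = C q \<star> Ax" by (rule commute_C[OF refl])
    moreover have "u \<star> Asc c 1 = Asc c 1 \<star> u" using mul_scalar[of u c] by (simp add: Asc_eq)
    ultimately show ?thesis
      unfolding C_pCons[of c q] by (simp add: mul_distribs mul_assoc)
  qed
  also have "\<dots> \<in> inner_X"
    by (intro inner_X_add inner_X_mul_X pCons.IH inner_X_C inner_XI)
  finally show ?case .
qed

text \<open>A derivation with value \<open>u\<close> at \<open>x\<close> sends \<open>q\<close> to
  \<open>q' u\<close> up to commutators of \<open>u\<close> with polynomials, which lie in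
  \<open>inner_X\<close>.\<close>

lemma poly_value_0_mod: "poly_value 0 u q - smult (pderiv q) u \<in> inner_X"
proof (induction q)
  case 0 thus ?case by (simp add: poly_value_pCons[OF deg_cochain_0] inner_X_0)
next
  case (pCons c q)
  have "poly_value 0 u (pCons c q) - smult (pderiv (pCons c q)) u =
      Ax \<star> (poly_value 0 u q - smult (pderiv q) u) + (u \<star> C q - C q \<star> u)"
  proof -
    have "smult (pCons 0 (pderiv q)) u = Ax \<star> smult (pderiv q) u" by (simp add: mul_X)
    thus ?thesis
      by (simp add: poly_value_pCons[OF deg_cochain_0] zero_fun_apply pderiv_pCons smult_add_left mul_diff_right mul_C algebra_simps)
  qed
  also have "\<dots> \<in> inner_X"
    by (intro inner_X_add inner_X_X pCons commutator_C_inner)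
  finally show ?case .
qed

definition W :: "'a poly \<Rightarrow> 'a poly" where "W f = h * pderiv f - pderiv h * f"

lemma W_0 [simp]: "W 0 = 0" by (simp add: W_def)

text \<open>In characteristic \<open>p\<close> the factor \<open>p - 1\<close> of
  \<open>wronski h (p - 2)\<close> is -1.\<close>

lemma W_eq_wronski: "W = wronski h (p - 2)"
proof
  fix f
  have "Suc (p - 2) = p - 1" using prime_ge_2_nat[OF prime_p] by simp
  hence "of_nat (Suc (p - 2)) = (- 1 :: 'a poly)"
    using char_pos by (simp only: of_nat_diff Suc_leI of_nat_p_poly) simp
  thus "W f = wronski h (p - 2) f" by (simp add: W_def wronski_def del: of_nat_Suc)
qed

text \<open>Modulo \<open>inner_X\<close> the commutator with \<open>y\<close> acts on coordinates
  by \<open>Dh h\<close>, and the value at \<open>h\<close> contributes \<open>h' u\<close>;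
  together they give minus \<open>W\<close>.\<close>

lemma obs_0_mod: "obs 0 u 0 + of_coords (map_poly W (coords u)) \<in> inner_X"
proof -
  have "of_coords (map_poly W (coords u)) = of_coords (map_poly (Dh h) (coords u)) - smult (pderiv h) u"
  proof -
    have "map_poly W (coords u) = map_poly (Dh h) (coords u) - smult (pderiv h) (coords u)"
      by (rule poly_eqI) (simp add: coeff_map_poly W_def Dh_def)
    thus ?thesis by (simp add: of_coords_diff of_coords_smult)
  qed
  hence "obs 0 u 0 + of_coords (map_poly W (coords u)) =
      (poly_value 0 u h - smult (pderiv h) u) - (Ay \<star> u - u \<star> Ay - of_coords (map_poly (Dh h) (coords u)))"
    by (simp add: obs_def zero_fun_apply)
  also have "\<dots> \<in> inner_X" by (intro inner_X_diff poly_value_0_mod commutator_Y_mod)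
  finally show ?thesis .
qed

lemma obs_0_v: "obs 0 0 v = - (v \<star> Ax - Ax \<star> v)"
  using poly_value_vanish[OF deg_cochain_0, of h] by (simp add: obs_def zero_fun_apply)

definition obs_range :: "'a poly poly set" where "obs_range = {obs 0 u v |u v. True}"

lemma obs_range_add: "a \<in> obs_range \<Longrightarrow> b \<in> obs_range \<Longrightarrow> a + b \<in> obs_range"
  unfolding obs_range_def using obs_0_add by (smt (verit) mem_Collect_eq)

lemma inner_X_obs_range: "a \<in> inner_X \<Longrightarrow> a \<in> obs_range"
proof -
  assume "a \<in> inner_X"
  then obtain b where "a = b \<star> Ax - Ax \<star> b" by (auto simp: inner_X_def)
  hence "a = obs 0 0 (- b)" by (simp add: obs_0_v)
  thus ?thesis by (auto simp: obs_range_def)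
qed

lemma of_coords_W_obs_range: "of_coords (map_poly W c) \<in> obs_range"
proof -
  have "obs 0 (of_coords c) 0 + of_coords (map_poly W c) \<in> obs_range"
    using obs_0_mod[of "of_coords c"] inner_X_obs_range by simp
  moreover have "obs 0 (- of_coords c) 0 \<in> obs_range" by (auto simp: obs_range_def)
  moreover have "obs 0 (- of_coords c) 0 = - obs 0 (of_coords c) 0" using obs_0_minus[of "of_coords c" 0] by simp
  ultimately show ?thesis using obs_range_add by fastforce
qed

text \<open>At these indices the elements of \<open>inner_X\<close> have coefficient zero, so the
  formula modulo \<open>inner_X\<close> becomes exact. At all indices it holds modulo
  \<open>h\<close>, see \<open>obs_range_coeff_mod\<close>.\<close>

lemma obs_range_coeff:
  assumes "p dvd Suc n"
  shows "coeff (coords (obs 0 u v)) n = - W (coeff (coords u) n)"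
proof -
  have "obs 0 u v = (obs 0 u 0 + of_coords (map_poly W (coords u))) + obs 0 0 v - of_coords (map_poly W (coords u))"
    using obs_0_add[of u 0 0 v] by simp
  hence "coords (obs 0 u v) = coords (obs 0 u 0 + of_coords (map_poly W (coords u))) + coords (obs 0 0 v) - map_poly W (coords u)"
    by (metis coords_add coords_diff coords_of_coords)
  moreover have "coeff (coords (obs 0 u 0 + of_coords (map_poly W (coords u)))) n = 0"
    using obs_0_mod inner_X_iff assms by blast
  moreover have "obs 0 0 v \<in> inner_X"
    unfolding obs_0_v by (intro inner_X_minus) (auto simp: inner_X_def)
  hence "coeff (coords (obs 0 0 v)) n = 0" using inner_X_iff assms by blast
  ultimately show ?thesis by (simp add: coeff_map_poly)
qed

end

section \<open>The cohomology modules\<close>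

lemma sum_fun_apply: "sum f A x = (\<Sum>i\<in>A. f i x)"
  for f :: "'c \<Rightarrow> 'd \<Rightarrow> 'b::comm_monoid_add"
  by (induction A rule: infinite_finite_induct) (simp_all add: plus_fun_apply zero_fun_apply)

context ore_algebra
begin

lemma hdiff_add: "hdiff h (f + g) xs = hdiff h f xs + hdiff h g xs"
proof (cases xs)
  case (Cons a ys)
  have "tdiff (f + g) xs = tdiff f xs + tdiff g xs"
    unfolding plus_fun_def by (rule tdiff_add)
  thus ?thesis by (simp add: Cons hdiff_Cons mul_add_right plus_fun_apply)
qed simp

lemma hdiff_minus: "hdiff h (- f) xs = - hdiff h f xs"
proof (cases xs)
  case (Cons a ys)
  have "tdiff (- f) xs = - tdiff f xs"
    unfolding fun_Compl_def by (rule tdiff_uminus)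
  thus ?thesis by (simp add: Cons hdiff_Cons uminus_apply)
qed simp

lemma hdiff_diff: "hdiff h (f - g) xs = hdiff h f xs - hdiff h g xs"
  using hdiff_add[of f "- g"] by (simp add: hdiff_minus)

lemma hdiff_0: "hdiff h 0 xs = 0"
  using hdiff_diff[of 0 0] by simp

lemma hdiff_lact:
  assumes "z \<in> Acenter h" shows "hdiff h (z \<rhd> f) xs = z \<star> hdiff h f xs"
proof (cases xs)
  case (Cons a ys)
  have "a \<star> (z \<star> b) = z \<star> (a \<star> b)" for b
    using assms by (metis (mono_tags, lifting) Acenter_def mem_Collect_eq mul_assoc)
  thus ?thesis unfolding Cons hdiff_Cons lact_def tdiff_mul_left by (simp add: mul_add_right)
qed simp

lemma center_mul:
  assumes "z \<in> Acenter h" "w \<in> Acenter h" shows "z \<star> w \<in> Acenter h"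
proof -
  have "z \<star> w \<star> a = a \<star> (z \<star> w)" for a
  proof -
    have "z \<star> (w \<star> a) = z \<star> (a \<star> w)" using assms(2) by (simp add: Acenter_def)
    also have "\<dots> = a \<star> z \<star> w" using assms(1) by (simp add: Acenter_def flip: mul_assoc)
    finally show ?thesis by (simp add: mul_assoc)
  qed
  thus ?thesis by (simp add: Acenter_def)
qed

lemma cochain_0: "cochain 0"
  using deg_cochain_imp_cochain[OF deg_cochain_0] .

lemma cochain_add:
  assumes "cochain f" "cochain g" shows "cochain (f + g)"
proof -
  have "{n. \<exists>xs. length xs = n \<and> (f + g) xs \<noteq> 0} \<subseteq>
        {n. \<exists>xs. length xs = n \<and> f xs \<noteq> 0} \<union> {n. \<exists>xs. length xs = n \<and> g xs \<noteq> 0}"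
    by (auto simp: plus_fun_apply)
  moreover have "multilin (f + g)"
    using assms by (auto simp: cochain_def multilin_def plus_fun_apply Asc_add)
  ultimately show ?thesis
    using assms finite_subset unfolding cochain_def by blast
qed

lemma cochain_lact:
  assumes "cochain f" shows "cochain (a \<rhd> f)"
proof -
  have "{n. \<exists>xs. length xs = n \<and> (a \<rhd> f) xs \<noteq> 0} \<subseteq> {n. \<exists>xs. length xs = n \<and> f xs \<noteq> 0}"
    by (auto simp: lact_apply)
  moreover have "multilin (a \<rhd> f)"
    using assms by (auto simp: cochain_def multilin_def lact_def mul_add_right mul_Asc_right)
  ultimately show ?thesis
    using assms finite_subset unfolding cochain_def by blast
qed

lemma coboundaries_0: "0 \<in> coboundaries h"
  using cochain_0 hdiff_0 by (force simp: coboundaries_def fun_eq_iff zero_fun_apply)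

lemma coboundaries_add: "f \<in> coboundaries h \<Longrightarrow> g \<in> coboundaries h \<Longrightarrow> f + g \<in> coboundaries h"
proof -
  assume "f \<in> coboundaries h" "g \<in> coboundaries h"
  then obtain f' g' where "f = hdiff h f'" "g = hdiff h g'" "cochain f'" "cochain g'"
    by (auto simp: coboundaries_def)
  moreover from this have "f + g = hdiff h (f' + g')" by (simp add: fun_eq_iff hdiff_add plus_fun_apply)
  ultimately show ?thesis using cochain_add by (auto simp: coboundaries_def)
qed

lemma coboundaries_lact: "f \<in> coboundaries h \<Longrightarrow> z \<in> Acenter h \<Longrightarrow> z \<rhd> f \<in> coboundaries h"
proof -
  assume "f \<in> coboundaries h" "z \<in> Acenter h"
  then obtain f' where "f = hdiff h f'" "cochain f'"
    by (auto simp: coboundaries_def)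
  moreover from this have "z \<rhd> f = hdiff h (z \<rhd> f')"
    using \<open>z \<in> Acenter h\<close> by (simp add: fun_eq_iff hdiff_lact lact_apply)
  ultimately show ?thesis using cochain_lact by (auto simp: coboundaries_def)
qed

lemma coboundaries_sum:
  "(\<And>i. i \<in> A \<Longrightarrow> f i \<in> coboundaries h) \<Longrightarrow> sum f A \<in> coboundaries h"
  by (induction A rule: infinite_finite_induct) (auto simp: coboundaries_0 coboundaries_add)

lemma hdiff_const_cochain: "hdiff h (const_cochain w) [a] = a \<star> w - w \<star> a"
  by (simp add: hdiff_Cons const_cochain_def)

lemma deg_hdiff_const_cochain: "deg_cochain 1 (hdiff h (const_cochain w))"
proof -
  have z: "hdiff h (const_cochain w) xs = 0" if "length xs \<noteq> 1" for xs
  proof -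
    have "hdiff h (const_cochain w) xs = hdiff h 0 xs"
      by (rule hdiff_cong) (use that in \<open>auto simp: const_cochain_def zero_fun_apply\<close>)
    thus ?thesis by (simp add: hdiff_0)
  qed
  show ?thesis
    unfolding One_nat_def
  proof (rule deg_cochain_SucI)
    show "deg_cochain 0 (\<lambda>rs. hdiff h (const_cochain w) (a # rs))" for a
    proof -
      have "(\<lambda>rs. hdiff h (const_cochain w) (a # rs)) = const_cochain (a \<star> w - w \<star> a)"
        using z by (auto simp: const_cochain_def[of "_ - _"] hdiff_const_cochain)
      thus ?thesis by (simp only: deg_const_cochain)
    qed
    show "hdiff h (const_cochain w) ((a + b) # rs) = hdiff h (const_cochain w) (a # rs) + hdiff h (const_cochain w) (b # rs)" for a b rs
      using z by (cases rs) (simp_all add: hdiff_const_cochain mul_distribs)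
    show "hdiff h (const_cochain w) (Asc c a # rs) = Asc c (hdiff h (const_cochain w) (a # rs))" for c a rs
      using z by (cases rs) (simp_all add: hdiff_const_cochain mul_Asc_left mul_Asc_right Asc_diff)
  qed simp
qed

lemma hdiff_hdiff_const_cochain: "hdiff h (hdiff h (const_cochain w)) = (\<lambda>_. 0)"
proof
  fix xs :: "'a poly poly list"
  consider "xs = []" | a where "xs = [a]" | a b where "xs = [a, b]" | a b c rs where "xs = a # b # c # rs"
    by (metis list.exhaust)
  thus "hdiff h (hdiff h (const_cochain w)) xs = 0"
  proof cases
    case (3 a b)
    thus ?thesis by (simp add: hdiff_Cons[of _ a "[b]"] hdiff_const_cochain mul_distribs mul_assoc)
  next
    case (4 a b c rs)
    have "hdiff h (hdiff h (const_cochain w)) xs = hdiff h 0 xs"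
      by (rule hdiff_cong)
         (use deg_hdiff_const_cochain[of w] 4 in \<open>auto simp: deg_cochain_def zero_fun_apply\<close>)
    thus ?thesis by (simp add: hdiff_0)
  qed (simp_all add: hdiff_Cons[of _ _ "[]"] const_cochain_def)
qed

lemma lact_diff_eq: "(\<lambda>xs. f xs - z \<star> s xs) = f - z \<rhd> s"
  by (simp add: fun_eq_iff minus_apply lact_apply)

definition component :: "nat \<Rightarrow> ('a poly poly list \<Rightarrow> 'a poly poly) \<Rightarrow> 'a poly poly list \<Rightarrow> 'a poly poly" where
  "component n f xs = (if length xs = n then f xs else 0)"

lemma deg_cochain_component: "multilin f \<Longrightarrow> deg_cochain n (component n f)"
  by (auto simp: deg_cochain_def multilin_def component_def)

lemma hdiff_component:
  assumes "hdiff h f = (\<lambda>_. 0)" shows "hdiff h (component n f) = (\<lambda>_. 0)"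
proof
  fix xs
  show "hdiff h (component n f) xs = 0"
  proof (cases "length xs = Suc n")
    case True
    have "hdiff h (component n f) xs = hdiff h f xs"
      by (rule hdiff_cong) (use True in \<open>auto simp: component_def\<close>)
    thus ?thesis by (simp add: assms)
  next
    case False
    have "hdiff h (component n f) xs = hdiff h 0 xs"
      by (rule hdiff_cong) (use False in \<open>auto simp: component_def zero_fun_apply\<close>)
    thus ?thesis by (simp add: hdiff_0)
  qed
qed

lemma high_coboundary:
  assumes "deg_cochain n f" "hdiff h f = (\<lambda>_. 0)" "n \<ge> 3"
  shows "f \<in> coboundaries h"
proof -
  obtain m where "n = Suc (Suc (Suc m))"
    using le_Suc_ex[OF assms(3)] by (auto simp: numeral_3_eq_3)
  with assms obtain g where "deg_cochain (Suc (Suc m)) g" "hdiff h g = f"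
    using cocycle_high_degree by metis
  thus ?thesis using deg_cochain_imp_cochain by (auto simp: coboundaries_def)
qed

text \<open>For a finite \<open>S\<close> the sums over the support of \<open>z\<close> may run over
  all of \<open>S\<close>.\<close>

lemma HH_basisI:
  assumes "finite S" "S \<subseteq> Zs"
    and span: "\<And>f. f \<in> Zs \<Longrightarrow> \<exists>z. (\<forall>s\<in>S. z s \<in> Acenter h) \<and> (\<lambda>xs. f xs - (\<Sum>s\<in>S. z s \<star> s xs)) \<in> Bs"
    and indep: "\<And>z. (\<forall>s\<in>S. z s \<in> Acenter h) \<Longrightarrow> (\<lambda>xs. \<Sum>s\<in>S. z s \<star> s xs) \<in> Bs \<Longrightarrow> \<forall>s\<in>S. z s = 0"
  shows "HH_basis h Zs Bs S"
proof -
  have "(\<Sum>s\<in>{s \<in> S. z s \<noteq> 0}. z s \<star> s xs) = (\<Sum>s\<in>S. z s \<star> s xs)" for z xs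
    using \<open>finite S\<close> by (intro sum.mono_neutral_left) auto
  with assms show ?thesis by (simp add: HH_basis_def)
qed

end

section \<open>Torsion in the second cohomology\<close>

context ore_algebra_char
begin

lemma obs_range_coeff_mod: "h dvd coeff (coords (obs 0 u v)) n + W (coeff (coords u) n)"
proof -
  have "obs 0 0 v \<in> inner_X"
    unfolding obs_0_v by (intro inner_X_minus inner_XI)
  hence "(obs 0 u 0 + of_coords (map_poly W (coords u))) + obs 0 0 v \<in> inner_X"
    by (intro inner_X_add obs_0_mod)
  also have "(obs 0 u 0 + of_coords (map_poly W (coords u))) + obs 0 0 v = obs 0 u v + of_coords (map_poly W (coords u))"
    using obs_0_add[of u 0 0 v] by simp
  finally show ?thesis by (simp add: inner_X_iff coords_add coeff_map_poly)
qed

text \<open>The coefficient at index 0 of an obstruction equal to 1 gives \<open>1 = h' f\<close>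
  modulo \<open>h\<close>.\<close>

lemma one_in_obs_range_imp_coprime:
  assumes "1 \<in> obs_range" shows "coprime h (pderiv h)"
proof -
  obtain u v where uv: "1 = obs 0 u v" using assms by (auto simp: obs_range_def)
  have "coords 1 = 1" using coords_ebasis[of 0] by (simp add: monom_0 flip: one_pCons)
  hence "h dvd 1 + W (coeff (coords u) 0)"
    using obs_range_coeff_mod[of u v 0] unfolding uv[symmetric] by simp
  hence 1: "h dvd (1 - pderiv h * coeff (coords u) 0) + h * pderiv (coeff (coords u) 0)"
    by (simp add: W_def algebra_simps)
  show ?thesis
  proof (rule coprimeI)
    fix d assume d: "d dvd h" "d dvd pderiv h"
    have "d dvd (1 - pderiv h * coeff (coords u) 0)"
      using 1 d(1) by (meson dvd_add_left_iff dvd_mult2 dvd_trans)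
    thus "is_unit d" using d(2) by (metis dvd_diff_right_iff dvd_mult2 dvd_diffD1 diff_add_cancel dvd_add)
  qed
qed

lemma center_hp: "C (h ^ p) \<in> Acenter h"
proof -
  have "C (h ^ p) = of_coords (monom (h ^ p) 0)" by (simp add: of_coords_monom)
  moreover have "pderiv (h ^ p) = 0" using pderiv_power_char[of h] by (simp add: p_eq)
  ultimately show ?thesis by (simp only: center_iff) (simp add: pderiv_monom)
qed

text \<open>\<open>h\<close> divides \<open>h\<^sup>p\<close>, and index 0 is not congruent to -1
  modulo \<open>p\<close>, since \<open>p > 1\<close>.\<close>

lemma hp_obs_range: "C (h ^ p) \<in> obs_range"
proof (rule inner_X_obs_range)
  have C: "C (h ^ p) = of_coords (monom (h ^ p) 0)" by (simp add: of_coords_monom)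
  have "p > 1" using prime_p prime_gt_1_nat by blast
  thus "C (h ^ p) \<in> inner_X"
    unfolding C inner_X_iff by (auto simp: char_pos)
qed

lemma coboundaries_deg_2_iff:
  assumes "deg_cochain 2 f" "hdiff h f = (\<lambda>_. 0)"
  shows "f \<in> coboundaries_deg h 2 \<longleftrightarrow> obs f 0 0 \<in> obs_range"
  using coboundaries_2_iff[of f] assms by (auto simp: cocycles_deg_def obs_range_def)

text \<open>The class with obstruction 1 is annihilated by the central \<open>h\<^sup>p\<close>.
  Multiplying its expansion in the basis by \<open>h\<^sup>p\<close> gives a relation, so all
  \<open>h\<^sup>p z\<^sub>s\<close> vanish, and so do the \<open>z\<^sub>s\<close>, since this
  multiplication is injective on \<open>A\<close>. The class is therefore zero, and 1 is an
  obstruction of the zero cocycle.\<close>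

lemma not_free:
  assumes "HH_basis h (cocycles_deg h 2) (coboundaries_deg h 2) S"
  shows "coprime h (pderiv h)"
proof -
  obtain f where f: "deg_cochain 2 f" "hdiff h f = (\<lambda>_. 0)" "obs f 0 0 = 1"
    using cocycle_2_with_class[of 1] by metis
  hence "f \<in> cocycles_deg h 2" by (simp add: cocycles_deg_def)
  then obtain z where z: "finite {s\<in>S. z s \<noteq> 0}" "\<forall>s\<in>S. z s \<in> Acenter h"
     "(\<lambda>xs. f xs - (\<Sum>s\<in>{s\<in>S. z s \<noteq> 0}. z s \<star> s xs)) \<in> coboundaries_deg h 2"
    using assms unfolding HH_basis_def by blast
  define H where "H = C (h ^ p)"
  have Hz: "H \<star> z s \<in> Acenter h" if "s \<in> S" for s
    using center_mul center_hp z(2) that unfolding H_def by blast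
  have H0: "H \<star> a = 0 \<longleftrightarrow> a = 0" for a by (simp add: H_def mul_C h_nz)
  define g where "g = (\<lambda>xs. f xs - (\<Sum>s\<in>{s\<in>S. z s \<noteq> 0}. z s \<star> s xs))"
  have g: "g \<in> coboundaries h" "deg_cochain 2 g" using z(3) by (auto simp: g_def coboundaries_deg_def)
  have Hf: "deg_cochain 2 (H \<rhd> f)" by (intro deg_cochain_lact f)
  have "hdiff h (H \<rhd> f) = (\<lambda>_. 0)"
    using hdiff_lact[OF center_hp, of f] f(2) by (simp add: fun_eq_iff H_def)
  moreover have "obs (H \<rhd> f) 0 0 = H"
    using obs_lact[OF f(1) center_commute[OF center_hp], of 0 0] f(3) by (simp add: H_def)
  ultimately have "H \<rhd> f \<in> coboundaries_deg h 2"
    using coboundaries_deg_2_iff[OF Hf] hp_obs_range by (simp add: H_def)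
  hence "H \<rhd> f \<in> coboundaries h" by (simp add: coboundaries_deg_def)
  moreover have "- H \<in> Acenter h" using center_hp[folded H_def] by (simp add: Acenter_def)
  ultimately have "H \<rhd> f + (- H) \<rhd> g \<in> coboundaries h"
    using coboundaries_add coboundaries_lact g(1) by blast
  moreover have "deg_cochain 2 (H \<rhd> f + (- H) \<rhd> g)"
    by (intro deg_cochain_intros f g)
  moreover have "H \<rhd> f + (- H) \<rhd> g = (\<lambda>xs. \<Sum>s\<in>{s\<in>S. H \<star> z s \<noteq> 0}. (H \<star> z s) \<star> s xs)"
    by (simp add: fun_eq_iff plus_fun_apply lact_apply g_def mul_diff_right mul_sum_right H0 mul_assoc sum_negf)
  ultimately have "(\<lambda>xs. \<Sum>s\<in>{s\<in>S. H \<star> z s \<noteq> 0}. (H \<star> z s) \<star> s xs) \<in> coboundaries_deg h 2"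
    by (simp add: coboundaries_deg_def)
  moreover have "finite {s\<in>S. H \<star> z s \<noteq> 0}" using z(1) by (simp add: H0)
  moreover have "finite {s\<in>S. z' s \<noteq> 0} \<Longrightarrow> (\<forall>s\<in>S. z' s \<in> Acenter h) \<Longrightarrow>
      (\<lambda>xs. \<Sum>s\<in>{s\<in>S. z' s \<noteq> 0}. z' s \<star> s xs) \<in> coboundaries_deg h 2 \<Longrightarrow> \<forall>s\<in>S. z' s = 0" for z'
    using assms unfolding HH_basis_def by blast
  from this[of "\<lambda>s. H \<star> z s"] Hz have "finite {s\<in>S. H \<star> z s \<noteq> 0} \<Longrightarrow>
      (\<lambda>xs. \<Sum>s\<in>{s\<in>S. H \<star> z s \<noteq> 0}. (H \<star> z s) \<star> s xs) \<in> coboundaries_deg h 2 \<Longrightarrow> \<forall>s\<in>S. H \<star> z s = 0"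
    by blast
  ultimately have "\<forall>s\<in>S. H \<star> z s = 0" by blast
  hence "{s\<in>S. z s \<noteq> 0} = {}" by (simp add: H0)
  hence "g = f" unfolding g_def by simp
  with z(3) have "f \<in> coboundaries_deg h 2" by (simp add: g_def)
  hence "1 \<in> obs_range" using coboundaries_deg_2_iff[OF f(1,2)] f(3) by simp
  thus ?thesis by (rule one_in_obs_range_imp_coprime)
qed

end

section \<open>Free generators when \<open>h\<close> and its derivative are coprime\<close>

locale ore_algebra_coprime = ore_algebra_char h p for h :: "'a::field_gcd poly" and p +
  assumes cop: "coprime h (pderiv h)"
begin

text \<open>\<open>g0\<close> is a free generator of the cokernel of \<open>wronski h j\<close> over
  the polynomials with derivative zero. The case \<open>j = p - 2\<close>, which is
  \<open>W\<close>, serves degree 2; the case \<open>j = p - 1\<close>, which is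
  \<open>f \<mapsto> h f'\<close>, serves derivations.\<close>

definition cokernel_gen :: "nat \<Rightarrow> 'a poly \<Rightarrow> bool" where
  "cokernel_gen j g0 \<longleftrightarrow> (\<forall>g. \<exists>c f. pderiv c = 0 \<and> g = c * g0 + wronski h j f) \<and>
     (\<forall>c f. pderiv c = 0 \<and> c * g0 = wronski h j f \<longrightarrow> c = 0)"

lemma cokernel_gen_exists:
  assumes "j < p" obtains g0 where "cokernel_gen j g0"
proof -
  have "j \<le> CHAR('a) - 1" using assms by (simp add: p_eq)
  from wronski_cokernel[OF _ cop h_nz this] char_pos that show thesis
    unfolding cokernel_gen_def p_eq by metis
qed

lemma wronski_0 [simp]: "wronski h j 0 = 0"
  by (simp add: wronski_def)

lemma cokernel_gen_nz: "cokernel_gen j g0 \<Longrightarrow> g0 \<noteq> 0"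
  unfolding cokernel_gen_def by (metis mult_zero_right pderiv_1 wronski_0 zero_neq_one)

lemma of_coords_mul_ebasis:
  assumes "pderiv k = 0" shows "of_coords k \<star> smult g (ebasis n) = of_coords (smult g (monom 1 n * k))"
proof -
  have "k * monom g n = smult g (monom 1 n * k)"
    using mult_smult_right[of k g "monom 1 n"] by (simp add: smult_monom mult.commute)
  thus ?thesis by (simp flip: of_coords_monom add: of_coords_mul_of_coords[OF assms])
qed

lemma of_coords_mul_C:
  assumes "pderiv k = 0" shows "of_coords k \<star> C g = of_coords (smult g k)"
  using of_coords_mul_ebasis[OF assms, of g 0] by (simp add: monom_0 flip: one_pCons)

text \<open>Indices congruent to -1 modulo \<open>p\<close> are \<open>p - 1\<close> plus multiples
  of \<open>p\<close>, so splitting off the index \<open>p - 1\<close> leaves the coordinates of a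
  central element.\<close>

lemma decomp_top:
  fixes \<gamma> :: "'a poly poly"
  assumes "\<And>n. \<not> p dvd Suc n \<Longrightarrow> coeff \<gamma> n = 0" and "\<And>n. pderiv (coeff \<gamma> n) = 0"
  obtains k where "\<gamma> = monom 1 (p - 1) * k" "pderiv k = 0" "of_coords k \<in> Acenter h"
proof -
  define k where "k = poly_shift (p - 1) \<gamma>"
  have k: "coeff k n = coeff \<gamma> (n + (p - 1))" for n by (simp add: k_def coeff_poly_shift)
  have "\<gamma> = monom 1 (p - 1) * k"
  proof (rule poly_eqI)
    fix n
    show "coeff \<gamma> n = coeff (monom 1 (p - 1) * k) n"
    proof (cases "n < p - 1")
      case True
      hence "\<not> p dvd Suc n" by (auto dest: dvd_imp_le)
      with True show ?thesis using assms(1) by (simp add: coeff_monom_mult)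
    next
      case False
      thus ?thesis by (simp add: coeff_monom_mult k)
    qed
  qed
  moreover have pk: "pderiv k = 0"
  proof (rule poly_eqI)
    fix n
    show "coeff (pderiv k) n = coeff 0 n"
    proof (cases "p dvd Suc n")
      case True thus ?thesis by (simp add: inner_coeffs)
    next
      case False
      have "Suc (Suc n + (p - 1)) = Suc n + p" using char_pos by simp
      hence "\<not> p dvd Suc (Suc n + (p - 1))" using False by (simp only: dvd_add_triv_right_iff not_False_eq_True)
      hence "coeff k (Suc n) = 0" unfolding k by (rule assms(1))
      thus ?thesis by (simp add: coeff_pderiv)
    qed
  qed
  moreover have "of_coords k \<in> Acenter h" using pk assms(2) by (simp add: center_iff k)
  ultimately show thesis using that by blast
qed

lemma h_dvd_W_preimage: "\<exists>f. h dvd g - W f"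
proof -
  obtain a b where ab: "a * h + b * pderiv h = 1"
    using bezout_coefficients[of h "pderiv h"] cop by (metis coprime_imp_gcd_eq_1 prod.exhaust)
  have "g - W (- (b * g)) = h * (a * g - pderiv (- (b * g)))"
    using arg_cong[OF ab, of "\<lambda>x. x * g"] by (simp add: W_def algebra_simps)
  thus ?thesis by (metis dvd_triv_left)
qed

lemma obs_cokernel_span:
  assumes g0: "cokernel_gen (p - 2) g0"
  obtains z where "z \<in> Acenter h" "a - z \<star> smult g0 (ebasis (p - 1)) \<in> obs_range"
proof -
  \<comment> \<open>Setting \<open>\<gamma> = 0\<close> at the other indices makes
    \<open>decomp_top\<close> applicable.\<close>
  define P where "P n x \<gamma> \<longleftrightarrow> (if p dvd Suc n then pderiv \<gamma> = 0 \<and> (\<exists>f. x = \<gamma> * g0 + W f) else \<gamma> = 0)"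
    for n and x \<gamma> :: "'a poly"
  have "\<exists>\<gamma>. P n (coeff (coords a) n) \<gamma>" for n
    using g0 unfolding P_def W_eq_wronski cokernel_gen_def by (cases "p dvd Suc n") auto
  moreover have "P n 0 0" for n unfolding P_def by (auto intro: exI[of _ 0])
  ultimately obtain \<gamma> where \<gamma>: "\<And>n. P n (coeff (coords a) n) (coeff \<gamma> n)"
    using poly_choice[of P "coords a"] by metis
  have \<gamma>1: "coeff \<gamma> n = 0" if "\<not> p dvd Suc n" for n
    using \<gamma>[of n] that by (simp add: P_def)
  have \<gamma>2: "pderiv (coeff \<gamma> n) = 0" for n
    using \<gamma>[of n] by (cases "p dvd Suc n") (simp_all add: P_def)
  obtain k where k: "\<gamma> = monom 1 (p - 1) * k" "pderiv k = 0" "of_coords k \<in> Acenter h"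
    using decomp_top[of \<gamma>] \<gamma>1 \<gamma>2 by metis
  define c where "c = coords a - smult g0 \<gamma>"
  have "of_coords k \<star> smult g0 (ebasis (p - 1)) = of_coords (smult g0 \<gamma>)"
    unfolding k(1) by (rule of_coords_mul_ebasis[OF k(2)])
  hence a: "a - of_coords k \<star> smult g0 (ebasis (p - 1)) = of_coords c"
    by (simp add: c_def of_coords_diff)
  \<comment> \<open>At the indices congruent to -1 the value of \<open>W\<close> must be exact,
    because \<open>inner_X\<close> offers no correction there. Elsewhere a solution modulo
    \<open>h\<close> suffices.\<close>
  define Q where "Q n x f \<longleftrightarrow> (if p dvd Suc n then x = W f else h dvd x - W f)" for n and x f :: "'a poly"
  have "\<exists>f. Q n (coeff c n) f" for n
  proof (cases "p dvd Suc n")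
    case True
    thus ?thesis using \<gamma>[of n] by (auto simp: Q_def P_def c_def mult.commute)
  next
    case False
    thus ?thesis using h_dvd_W_preimage by (simp add: Q_def)
  qed
  moreover have "Q n 0 0" for n by (simp add: Q_def)
  ultimately obtain f where f: "\<And>n. Q n (coeff c n) (coeff f n)"
    using poly_choice[of Q c] by metis
  have "of_coords (c - map_poly W f) \<in> inner_X"
    unfolding inner_X_iff
  proof (intro allI conjI impI)
    fix n
    show "h dvd coeff (coords (of_coords (c - map_poly W f))) n"
      using f[of n] by (cases "p dvd Suc n") (simp_all add: Q_def coeff_map_poly)
    show "coeff (coords (of_coords (c - map_poly W f))) n = 0" if "p dvd Suc n"
      using f[of n] that by (simp add: Q_def coeff_map_poly)
  qed
  hence "of_coords (c - map_poly W f) + of_coords (map_poly W f) \<in> obs_range"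
    by (intro obs_range_add inner_X_obs_range of_coords_W_obs_range)
  hence "of_coords c \<in> obs_range" by (simp add: of_coords_diff)
  with k(3) a that show thesis by metis
qed

text \<open>Multiplication by \<open>ebasis (p - 1)\<close> moves the coordinates of
  \<open>z\<close> to the indices congruent to -1, where obstructions are exact values of
  \<open>W\<close>, so the uniqueness in \<open>cokernel_gen\<close> applies to each
  coefficient.\<close>

lemma obs_cokernel_indep:
  assumes g0: "cokernel_gen (p - 2) g0" and z: "z \<in> Acenter h"
    and r: "z \<star> smult g0 (ebasis (p - 1)) \<in> obs_range"
  shows "z = 0"
proof -
  define k where "k = coords z"
  have k: "pderiv k = 0" "pderiv (coeff k n) = 0" for n
    using z center_iff[of k] by (simp_all add: k_def)
  have zk: "z = of_coords k" by (simp add: k_def)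
  obtain u v where uv: "z \<star> smult g0 (ebasis (p - 1)) = obs 0 u v"
    using r by (auto simp: obs_range_def)
  have coords: "coords (obs 0 u v) = monom g0 (p - 1) * k"
    unfolding uv[symmetric] zk of_coords_monom[symmetric] of_coords_mul_of_coords[OF k(1)] by (simp add: mult.commute)
  have "coeff k n = 0" for n
  proof (cases "p dvd n")
    case True
    hence "p dvd Suc (n + (p - 1))" using char_pos by simp
    from obs_range_coeff[OF this, of u v] have "coeff k n * g0 = - W (coeff (coords u) (n + (p - 1)))"
      unfolding coords coeff_monom_mult by (simp add: mult.commute)
    also have "\<dots> = W (- coeff (coords u) (n + (p - 1)))" by (simp add: W_def pderiv_minus)
    finally have "coeff k n * g0 = wronski h (p - 2) (- coeff (coords u) (n + (p - 1)))"
      unfolding W_eq_wronski .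
    thus ?thesis using g0 k(2) unfolding cokernel_gen_def by blast
  next
    case False
    thus ?thesis by (rule pderiv_0_coeff[OF k(1)])
  qed
  hence "k = 0" by (intro poly_eqI) simp
  thus ?thesis by (simp add: zk)
qed

definition D1_spec where
  "D1_spec g D \<longleftrightarrow> deg_cochain 1 D \<and> hdiff h D = (\<lambda>_. 0) \<and> D [Ax] = 0 \<and> D [Ay] = C g"

definition D2_spec where
  "D2_spec D \<longleftrightarrow> deg_cochain 1 D \<and> hdiff h D = (\<lambda>_. 0) \<and> D [Ax] = smult h (ebasis (p - 1))"

lemma D1_exists: obtains D where "D1_spec g D"
proof -
  have "C g \<star> Ax = Ax \<star> C g" using commute_C[of Ax g] by simp
  hence "obs 0 0 (C g) = 0" by (simp add: obs_0_v)
  from derivation_exists[OF this] that show thesis unfolding D1_spec_def by metis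
qed

lemma D2_exists: obtains D where "D2_spec D"
proof -
  define u where "u = smult h (ebasis (p - 1))"
  have "coords u = monom h (p - 1)" by (simp add: u_def coords_smult coords_ebasis smult_monom)
  hence "map_poly W (coords u) = 0" by (simp add: map_poly_monom W_def)
  hence "obs 0 u 0 \<in> inner_X" using obs_0_mod[of u] by simp
  then obtain v where "obs 0 u 0 = v \<star> Ax - Ax \<star> v" by (auto simp: inner_X_def)
  hence "obs 0 u v = 0" using obs_0_add[of u 0 0 v] by (simp add: obs_0_v)
  from derivation_exists[OF this] that show thesis unfolding D2_spec_def u_def by metis
qed

text \<open>A central multiple of \<open>D2\<close> and an inner derivation reduce the value at
  \<open>x\<close> to zero. The value at \<open>y\<close> then commutes with \<open>x\<close> and is
  removed by a central multiple of \<open>D1\<close> and an inner derivation that vanishes at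
  \<open>x\<close>.\<close>

lemma HH1_span:
  assumes g1: "cokernel_gen (p - 1) g1" and D1: "D1_spec g1 D1" and D2: "D2_spec D2"
    and f: "deg_cochain 1 f" "hdiff h f = (\<lambda>_. 0)"
  obtains z1 z2 w where "z1 \<in> Acenter h" "z2 \<in> Acenter h"
    "\<And>xs. f xs - (z1 \<star> D1 xs + z2 \<star> D2 xs) = hdiff h (const_cochain w) xs"
proof -
  define u where "u = f [Ax]"
  define c where "c = coords u"
  have ml: "multilin f" using f by (simp add: deg_cochain_def)
  have o: "obs 0 u (f [Ay]) = 0"
    unfolding u_def by (rule derivation_obs[OF ml]) (simp add: f)
  have hc: "h dvd coeff c n" for n
  proof -
    have "h dvd W (coeff c n)" using obs_range_coeff_mod[of u "f [Ay]" n] by (simp add: o c_def)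
    hence "h dvd pderiv h * coeff c n" unfolding W_def by (metis dvd_diff_right_iff dvd_triv_left)
    thus ?thesis using cop coprime_dvd_mult_right_iff by blast
  qed
  then obtain r where r: "c = smult h r"
    using const_poly_dvd_iff[of h c] by (auto elim!: dvdE)
  have r0: "pderiv (coeff r n) = 0" if "p dvd Suc n" for n
  proof -
    have "W (coeff c n) = 0" using obs_range_coeff[OF that, of u "f [Ay]"] by (simp add: o c_def)
    hence "h * h * pderiv (coeff r n) = 0" unfolding r W_def by (simp add: pderiv_mult algebra_simps)
    thus ?thesis using h_nz by simp
  qed
  \<comment> \<open>\<open>\<gamma>\<close> collects the coefficients of \<open>r\<close> that
    prevent it from being an outer derivative; they belong to \<open>D2\<close>, and the remainder
    \<open>r - \<gamma>\<close> to an inner derivation.\<close>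
  define R where "R n x y \<longleftrightarrow> y = (if p dvd Suc n then x else 0)" for n and x y :: "'a poly"
  have "\<exists>y. R n (coeff r n) y" "R n 0 0" for n by (simp_all add: R_def)
  then obtain \<gamma> where "\<And>n. R n (coeff r n) (coeff \<gamma> n)"
    using poly_choice[of R r] by metis
  hence \<gamma>: "coeff \<gamma> n = (if p dvd Suc n then coeff r n else 0)" for n by (simp add: R_def)
  obtain k where k: "\<gamma> = monom 1 (p - 1) * k" "pderiv k = 0" "of_coords k \<in> Acenter h"
    using decomp_top[of \<gamma>] \<gamma> r0 by (metis pderiv_0)
  obtain s where s: "r - \<gamma> = pderiv s"
    using antiderivative_outer[of "r - \<gamma>"] \<gamma> by (metis coeff_diff cancel_comm_monoid_add_class.diff_cancel)
  have "of_coords k \<star> smult h (ebasis (p - 1)) = of_coords (smult h \<gamma>)"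
    unfolding k(1) by (rule of_coords_mul_ebasis[OF k(2)])
  hence "u - of_coords k \<star> smult h (ebasis (p - 1)) = of_coords (c - smult h \<gamma>)"
    by (simp add: c_def of_coords_diff)
  also have "c - smult h \<gamma> = smult h (pderiv s)"
    unfolding r s[symmetric] by (simp add: smult_diff_right)
  finally have u: "u - of_coords k \<star> D2 [Ax] = of_coords s \<star> Ax - Ax \<star> of_coords s"
    using D2 by (simp add: D2_spec_def commutator_X_of_coords)
  define f1 where "f1 = f - of_coords k \<rhd> D2 - hdiff h (const_cochain (- of_coords s))"
  have f1: "deg_cochain 1 f1" "hdiff h f1 = (\<lambda>_. 0)" "f1 [Ax] = 0"
  proof -
    show "deg_cochain 1 f1"
      unfolding f1_def using D2 by (intro deg_cochain_intros f deg_hdiff_const_cochain) (simp add: D2_spec_def)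
    show "hdiff h f1 = (\<lambda>_. 0)"
      using D2 f by (simp add: fun_eq_iff f1_def hdiff_diff hdiff_lact[OF k(3)] hdiff_hdiff_const_cochain D2_spec_def)
    show "f1 [Ax] = 0"
      using u by (simp add: f1_def minus_apply lact_apply hdiff_const_cochain u_def)
  qed
  define v where "v = f1 [Ay]"
  have "obs 0 0 v = 0"
    using derivation_obs[of f1] f1 by (simp add: v_def deg_cochain_multilin)
  hence "v \<star> Ax = Ax \<star> v" by (simp add: obs_0_v)
  hence pv: "pderiv (coords v) = 0" using commute_X_iff[OF h_nz, of "coords v"] by simp
  define P where "P n x \<gamma> \<longleftrightarrow> pderiv \<gamma> = 0 \<and> (\<exists>f. x = \<gamma> * g1 + h * pderiv f)"
    for n :: nat and x \<gamma> :: "'a poly"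
  have wr: "wronski h (p - 1) f = h * pderiv f" for f
    using char_pos by (simp add: wronski_def del: of_nat_Suc)
  have "\<exists>\<gamma>. P n (coeff (coords v) n) \<gamma>" for n
    using g1 unfolding P_def cokernel_gen_def wr by metis
  moreover have "P n 0 0" for n unfolding P_def by (auto intro: exI[of _ 0])
  ultimately obtain k' where k': "\<And>n. P n (coeff (coords v) n) (coeff k' n)" "\<And>n. coeff (coords v) n = 0 \<Longrightarrow> coeff k' n = 0"
    using poly_choice[of P "coords v"] by metis
  have pk': "pderiv k' = 0"
    using k'(2) pderiv_0_coeff[OF pv] inner_coeffs[of _ k']
    by (intro poly_eqI) (metis coeff_0 coeff_pderiv mult_zero_right)
  have Zk': "of_coords k' \<in> Acenter h" using k'(1) pk' by (simp add: center_iff P_def)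
  define Q where "Q n x f \<longleftrightarrow> x = h * pderiv f" for n :: nat and x f :: "'a poly"
  have "\<exists>f. Q n (coeff (coords v - smult g1 k') n) f" for n
    using k'(1)[of n] by (auto simp: P_def Q_def mult.commute)
  moreover have "Q n 0 0" for n by (simp add: Q_def)
  ultimately obtain t where t: "\<And>n. Q n (coeff (coords v - smult g1 k') n) (coeff t n)"
     "\<And>n. coeff (coords v - smult g1 k') n = 0 \<Longrightarrow> coeff t n = 0"
    using poly_choice[of Q "coords v - smult g1 k'"] by metis
  \<comment> \<open>The zero default of \<open>poly_choice\<close> confines \<open>t\<close> to
    multiples of \<open>p\<close>, so \<open>of_coords t\<close> commutes with \<open>x\<close> and
    its inner derivation leaves the value at \<open>x\<close> unchanged.\<close>
  have tn: "coeff t n = 0" if "\<not> p dvd n" for n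
    using t(2)[of n] pderiv_0_coeff[OF pv that] pderiv_0_coeff[OF pk' that] by simp
  have pt: "pderiv t = 0"
    using tn inner_coeffs[of _ t] by (intro poly_eqI) (metis coeff_0 coeff_pderiv mult_zero_right)
  have "of_coords k' \<star> C g1 = of_coords (smult g1 k')"
    by (rule of_coords_mul_C[OF pk'])
  moreover have "coords v - smult g1 k' = map_poly (Dh h) t"
    using t(1) by (intro poly_eqI) (simp add: Q_def coeff_map_poly Dh_def)
  hence "of_coords (coords v) - of_coords (smult g1 k') = Ay \<star> of_coords t - of_coords t \<star> Ay"
    using commutator_Y_of_coords[OF pt] by (metis of_coords_diff)
  ultimately have v: "v - of_coords k' \<star> D1 [Ay] = Ay \<star> of_coords t - of_coords t \<star> Ay"
    using D1 by (simp add: D1_spec_def)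
  have tX: "of_coords t \<star> Ax = Ax \<star> of_coords t" using pt commute_X_iff[OF h_nz] by blast
  define f2 where "f2 = f1 - of_coords k' \<rhd> D1 - hdiff h (const_cochain (of_coords t))"
  have "f2 xs = 0" for xs
  proof (rule derivation_eq_0)
    show "deg_cochain 1 f2"
      unfolding f2_def using D1 by (intro deg_cochain_intros f1 deg_hdiff_const_cochain) (simp add: D1_spec_def)
    show "hdiff h f2 = (\<lambda>_. 0)"
      using D1 f1(2) by (simp add: fun_eq_iff f2_def hdiff_diff hdiff_lact[OF Zk'] hdiff_hdiff_const_cochain D1_spec_def)
    show "f2 [Ax] = 0"
      using f1(3) D1 tX by (simp add: f2_def minus_apply lact_apply hdiff_const_cochain D1_spec_def)
    show "f2 [Ay] = 0"
      using v by (simp add: f2_def minus_apply lact_apply hdiff_const_cochain v_def)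
  qed
  moreover have "f2 xs = f xs - of_coords k \<star> D2 xs - hdiff h (const_cochain (- of_coords s)) xs
      - of_coords k' \<star> D1 xs - hdiff h (const_cochain (of_coords t)) xs" for xs
    by (simp add: f2_def f1_def minus_apply lact_apply)
  ultimately have "f xs - (of_coords k' \<star> D1 xs + of_coords k \<star> D2 xs) = hdiff h (const_cochain (of_coords t) + const_cochain (- of_coords s)) xs" for xs
    by (simp add: hdiff_add algebra_simps)
  moreover have "const_cochain (of_coords t) + const_cochain (- of_coords s) = const_cochain (of_coords t - of_coords s)"
    by (auto simp: const_cochain_def plus_fun_apply)
  ultimately show thesis using that Zk' k(3) by metis
qed

lemma HH1_indep:
  assumes g1: "cokernel_gen (p - 1) g1" and D1: "D1_spec g1 D1" and D2: "D2_spec D2"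
    and z: "z1 \<in> Acenter h" "z2 \<in> Acenter h"
    and eq: "\<And>a. z1 \<star> D1 [a] + z2 \<star> D2 [a] = a \<star> w - w \<star> a"
  shows "z1 = 0 \<and> z2 = 0"
proof -
  define k1 k2 where "k1 = coords z1" and "k2 = coords z2"
  have k: "pderiv k1 = 0" "\<And>n. pderiv (coeff k1 n) = 0" "pderiv k2 = 0"
    using z center_iff[of k1] center_iff[of k2] by (simp_all add: k1_def k2_def)
  have zk: "z1 = of_coords k1" "z2 = of_coords k2" by (simp_all add: k1_def k2_def)
  have "z2 \<star> smult h (ebasis (p - 1)) = - (w \<star> Ax - Ax \<star> w)"
    using eq[of Ax] D1 D2 by (simp add: D1_spec_def D2_spec_def)
  moreover have "z2 \<star> smult h (ebasis (p - 1)) = of_coords (monom h (p - 1) * k2)"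
    unfolding zk of_coords_monom[symmetric] of_coords_mul_of_coords[OF k(3)] by (simp add: mult.commute)
  ultimately have "of_coords (monom h (p - 1) * k2) \<in> inner_X" using inner_X_minus inner_XI by metis
  hence i: "p dvd Suc n \<Longrightarrow> coeff (monom h (p - 1) * k2) n = 0" for n
    by (simp add: inner_X_iff)
  have "coeff k2 n = 0" for n
  proof (cases "p dvd n")
    case True
    hence "p dvd Suc (n + (p - 1))" using char_pos by simp
    from i[OF this] show ?thesis using h_nz by (simp add: coeff_monom_mult)
  next
    case False
    thus ?thesis by (rule pderiv_0_coeff[OF k(3)])
  qed
  hence "k2 = 0" by (intro poly_eqI) simp
  hence z2: "z2 = 0" by (simp add: zk)
  have "w \<star> Ax = Ax \<star> w" using eq[of Ax] D1 z2 by (simp add: D1_spec_def)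
  hence pw: "pderiv (coords w) = 0" using commute_X_iff[OF h_nz, of "coords w"] by simp
  have "z1 \<star> C g1 = of_coords (smult g1 k1)"
    using of_coords_mul_C[OF k(1)] by (simp add: zk)
  moreover have "z1 \<star> C g1 = of_coords (map_poly (Dh h) (coords w))"
    using eq[of Ay] D1 z2 commutator_Y_of_coords[OF pw] by (simp add: D1_spec_def)
  ultimately have "smult g1 k1 = map_poly (Dh h) (coords w)" by (simp add: of_coords_eq_iff)
  hence "coeff (smult g1 k1) n = coeff (map_poly (Dh h) (coords w)) n" for n by simp
  hence "coeff k1 n * g1 = wronski h (p - 1) (coeff (coords w) n)" for n
    using char_pos by (simp add: coeff_map_poly Dh_def wronski_def mult.commute del: of_nat_Suc)
  hence "coeff k1 n = 0" for n using g1 k(2) unfolding cokernel_gen_def by blast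
  hence "k1 = 0" by (intro poly_eqI) simp
  thus ?thesis using z2 by (simp add: zk)
qed

definition HH2_spec where
  "HH2_spec g0 s \<longleftrightarrow> deg_cochain 2 s \<and> hdiff h s = (\<lambda>_. 0) \<and> obs s 0 0 = smult g0 (ebasis (p - 1))"

lemma HH2_exists: obtains s where "HH2_spec g0 s"
  using cocycle_2_with_class[of "smult g0 (ebasis (p - 1))"] unfolding HH2_spec_def by metis

lemma HH2_spec_lact:
  assumes s: "HH2_spec g0 s" and z: "z \<in> Acenter h"
  shows "deg_cochain 2 (z \<rhd> s)" "hdiff h (z \<rhd> s) = (\<lambda>_. 0)"
    "obs (z \<rhd> s) 0 0 = z \<star> smult g0 (ebasis (p - 1))"
proof -
  show "deg_cochain 2 (z \<rhd> s)" using s by (auto simp: HH2_spec_def intro: deg_cochain_lact)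
  show "hdiff h (z \<rhd> s) = (\<lambda>_. 0)" using s by (auto simp: HH2_spec_def hdiff_lact[OF z])
  show "obs (z \<rhd> s) 0 0 = z \<star> smult g0 (ebasis (p - 1))"
    using obs_lact[of s z 0 0] center_commute[OF z] s by (simp add: HH2_spec_def)
qed

lemma HH2_span:
  assumes g0: "cokernel_gen (p - 2) g0" and s: "HH2_spec g0 s"
    and f: "deg_cochain 2 f" "hdiff h f = (\<lambda>_. 0)"
  obtains z where "z \<in> Acenter h" "f - z \<rhd> s \<in> coboundaries_deg h 2"
proof -
  obtain z where z: "z \<in> Acenter h" "obs f 0 0 - z \<star> smult g0 (ebasis (p - 1)) \<in> obs_range"
    using obs_cokernel_span[OF g0] by blast
  note zs = HH2_spec_lact[OF s z(1)]
  have d: "deg_cochain 2 (f - z \<rhd> s)" by (intro deg_cochain_diff f zs)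
  have "obs (f - z \<rhd> s) 0 0 = obs f 0 0 - z \<star> smult g0 (ebasis (p - 1))"
    using obs_add[OF d zs(1), of 0 0 0 0] zs(3) by simp
  moreover have "hdiff h (f - z \<rhd> s) = (\<lambda>_. 0)"
    using f(2) zs(2) by (simp add: fun_eq_iff hdiff_diff)
  ultimately have "f - z \<rhd> s \<in> coboundaries_deg h 2"
    using coboundaries_deg_2_iff[OF d] z(2) by simp
  with z(1) that show thesis by blast
qed

text \<open>Only values on pairs are compared, so that \<open>g\<close> may be a cochain with
  components in several degrees, as in the total complex.\<close>

lemma HH2_indep:
  assumes g0: "cokernel_gen (p - 2) g0" and s: "HH2_spec g0 s" and z: "z \<in> Acenter h"
    and g: "multilin g" "\<And>a b. z \<star> s [a, b] = hdiff h g [a, b]"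
  shows "z = 0"
proof -
  note zs = HH2_spec_lact[OF s z(1)]
  have "obs (z \<rhd> s) (g [Ax]) (g [Ay]) = 0"
    by (rule obs_coboundary[OF zs(1) g(1)]) (simp add: lact_apply g(2))
  hence "z \<star> smult g0 (ebasis (p - 1)) = obs 0 (- g [Ax]) (- g [Ay])"
    unfolding obs_split[OF zs(1), of "g [Ax]" "g [Ay]"] zs(3) obs_0_minus eq_neg_iff_add_eq_0 .
  hence "z \<star> smult g0 (ebasis (p - 1)) \<in> obs_range" by (auto simp: obs_range_def)
  thus ?thesis by (rule obs_cokernel_indep[OF g0 z])
qed

lemma p_ge_2: "p \<ge> 2"
  using prime_p prime_ge_2_nat by blast

theorem HH2_basis:
  obtains S where "HH_basis h (cocycles_deg h 2) (coboundaries_deg h 2) S" "card S = 1"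
proof -
  obtain g0 where g0: "cokernel_gen (p - 2) g0"
    using cokernel_gen_exists[of "p - 2"] p_ge_2 by auto
  obtain s where s: "HH2_spec g0 s" by (rule HH2_exists)
  have "HH_basis h (cocycles_deg h 2) (coboundaries_deg h 2) {s}"
  proof (rule HH_basisI)
    show "{s} \<subseteq> cocycles_deg h 2" using s by (auto simp: HH2_spec_def cocycles_deg_def)
    fix f assume "f \<in> cocycles_deg h 2"
    then obtain z where "z \<in> Acenter h" "f - z \<rhd> s \<in> coboundaries_deg h 2"
      using HH2_span[OF g0 s] by (auto simp: cocycles_deg_def)
    thus "\<exists>z. (\<forall>s\<in>{s}. z s \<in> Acenter h) \<and> (\<lambda>xs. f xs - (\<Sum>s\<in>{s}. z s \<star> s xs)) \<in> coboundaries_deg h 2"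
      by (intro exI[of _ "\<lambda>_. z"]) (simp add: lact_diff_eq)
  next
    fix z assume z: "\<forall>s\<in>{s}. z s \<in> Acenter h" "(\<lambda>xs. \<Sum>s\<in>{s}. z s \<star> s xs) \<in> coboundaries_deg h 2"
    then obtain g where g: "(\<lambda>xs. z s \<star> s xs) = hdiff h g" "cochain g"
      by (auto simp: coboundaries_deg_def coboundaries_def)
    have "z s = 0"
      by (rule HH2_indep[OF g0 s]) (use z(1) g fun_cong[OF g(1)] in \<open>auto simp: cochain_def\<close>)
    thus "\<forall>s\<in>{s}. z s = 0" by simp
  qed simp
  with that show thesis by (metis card_1_singleton_iff One_nat_def)
qed

text \<open>The generators are the unit in degree 0, \<open>D1\<close> and \<open>D2\<close> in
  degree 1, and \<open>s2\<close> in degree 2. Components of a cocycle in higher degrees are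
  coboundaries.\<close>

theorem HH_total_basis:
  obtains S where "HH_basis h (cocycles h) (coboundaries h) S"
proof -
  obtain g0 where g0: "cokernel_gen (p - 2) g0"
    using cokernel_gen_exists[of "p - 2"] p_ge_2 by auto
  obtain g1 where g1: "cokernel_gen (p - 1) g1"
    using cokernel_gen_exists[of "p - 1"] p_ge_2 by auto
  obtain s2 where s2: "HH2_spec g0 s2" by (rule HH2_exists)
  obtain D1 where D1: "D1_spec g1 D1" by (rule D1_exists)
  obtain D2 where D2: "D2_spec D2" by (rule D2_exists)
  define s0 where "s0 = const_cochain 1"
  have deg: "deg_cochain 0 s0" "deg_cochain 1 D1" "deg_cochain 1 D2" "deg_cochain 2 s2"
    using D1 D2 s2 deg_const_cochain by (auto simp: s0_def D1_spec_def D2_spec_def HH2_spec_def)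
  have ebasis_nz: "ebasis (p - 1) \<noteq> 0" using degree_ebasis[of "p - 1"] by auto
  have vals: "s0 [] = 1" "D1 [] = 0" "D2 [] = 0" "s2 [] = 0" "s0 [a] = 0" "s2 [a] = 0"
    "s0 [a, b] = 0" "D1 [a, b] = 0" "D2 [a, b] = 0" for a b
    using deg by (auto simp: deg_cochain_def s0_def const_cochain_def)
  have D2X: "D2 [Ax] \<noteq> 0" "D1 [Ax] = 0" and D1Y: "D1 [Ay] \<noteq> 0"
    using D1 D2 h_nz ebasis_nz cokernel_gen_nz[OF g1] by (auto simp: D1_spec_def D2_spec_def)
  \<comment> \<open>A basis is a set with one coefficient for each element, so the generators have
    to be distinct for the sum to have four terms.\<close>
  have dist: "s0 \<noteq> D1" "s0 \<noteq> D2" "s0 \<noteq> s2" "D1 \<noteq> D2" "D1 \<noteq> s2" "D2 \<noteq> s2"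
    using vals D2X D1Y by (metis zero_neq_one)+
  have sum: "(\<Sum>s\<in>{s0, D1, D2, s2}. z s \<star> s xs) =
      z s0 \<star> s0 xs + (z D1 \<star> D1 xs + (z D2 \<star> D2 xs + z s2 \<star> s2 xs))" for z xs
    using dist by simp
  have "HH_basis h (cocycles h) (coboundaries h) {s0, D1, D2, s2}"
  proof (rule HH_basisI)
    have "hdiff h s0 = (\<lambda>_. 0)"
    proof
      fix xs
      show "hdiff h s0 xs = 0"
      proof (cases "length xs = 1")
        case True
        then obtain a where "xs = [a]" by (auto simp: length_Suc_conv)
        thus ?thesis by (simp add: s0_def hdiff_const_cochain)
      next
        case False
        thus ?thesis using deg_hdiff_const_cochain[of 1] by (simp add: s0_def deg_cochain_def)
      qed
    qed
    thus "{s0, D1, D2, s2} \<subseteq> cocycles h"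
      using deg D1 D2 s2 deg_cochain_imp_cochain
      by (auto simp: cocycles_def D1_spec_def D2_spec_def HH2_spec_def)
  next
    fix f assume f: "f \<in> cocycles h"
    hence fm: "multilin f" and fd: "hdiff h f = (\<lambda>_. 0)" and fin: "finite {n. \<exists>xs. length xs = n \<and> f xs \<noteq> 0}"
      by (auto simp: cocycles_def cochain_def)
    note fn = deg_cochain_component[OF fm] hdiff_component[OF fd]
    define z0 where "z0 = f []"
    have "a \<star> z0 = z0 \<star> a" for a
      using fun_cong[OF fd, of "[a]"] by (simp add: hdiff_Cons z0_def)
    hence z0: "z0 \<in> Acenter h" by (simp add: Acenter_def)
    obtain z1 z2 w where z12: "z1 \<in> Acenter h" "z2 \<in> Acenter h"
      "\<And>xs. component 1 f xs - (z1 \<star> D1 xs + z2 \<star> D2 xs) = hdiff h (const_cochain w) xs"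
      using HH1_span[OF g1 D1 D2 fn[of 1]] by blast
    obtain z3 where z3: "z3 \<in> Acenter h" "component 2 f - z3 \<rhd> s2 \<in> coboundaries_deg h 2"
      using HH2_span[OF g0 s2 fn[of 2]] by blast
    define z where "z s = (if s = s0 then z0 else if s = D1 then z1 else if s = D2 then z2 else z3)" for s
    have z: "z s0 = z0" "z D1 = z1" "z D2 = z2" "z s2 = z3"
      using dist by (auto simp: z_def)
    \<comment> \<open>A total cochain lives in finitely many degrees, so its part of degree at least
      3 is a finite sum of coboundaries.\<close>
    obtain N where N: "\<And>n. n \<in> {n. \<exists>xs. length xs = n \<and> f xs \<noteq> 0} \<Longrightarrow> n < N"
      using fin finite_nat_set_iff_bounded by (metis (lifting))
    have f_eq: "f xs = component 0 f xs + component 1 f xs + component 2 f xs + (\<Sum>n\<in>{3..<N}. component n f xs)" for xs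
    proof (cases "f xs = 0")
      case True
      thus ?thesis by (auto simp: component_def)
    next
      case False
      hence "length xs < N" using N by blast
      hence "length xs = 0 \<or> length xs = 1 \<or> length xs = 2 \<or> length xs \<in> {3..<N}"
        unfolding atLeastLessThan_iff by linarith
      moreover have "(\<Sum>n\<in>{3..<N}. component n f xs) = (if length xs \<in> {3..<N} then f xs else 0)"
        by (simp add: component_def)
      ultimately show ?thesis by (elim disjE) (auto simp: component_def)
    qed
    have "(\<lambda>xs. f xs - (\<Sum>s\<in>{s0, D1, D2, s2}. z s \<star> s xs)) =
        hdiff h (const_cochain w) + (component 2 f - z3 \<rhd> s2) + (\<Sum>n\<in>{3..<N}. component n f)"
    proof
      fix xs
      have "component 0 f xs = z0 \<star> s0 xs"
        by (simp add: component_def s0_def const_cochain_def z0_def)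
      moreover have "(\<Sum>n\<in>{3..<N}. component n f) xs = (\<Sum>n\<in>{3..<N}. component n f xs)"
        by (rule sum_fun_apply)
      ultimately show "f xs - (\<Sum>s\<in>{s0, D1, D2, s2}. z s \<star> s xs) =
        (hdiff h (const_cochain w) + (component 2 f - z3 \<rhd> s2) + (\<Sum>n\<in>{3..<N}. component n f)) xs"
        using z12(3)[of xs]
        by (subst f_eq) (simp add: sum z plus_fun_apply minus_apply lact_apply algebra_simps)
    qed
    also have "\<dots> \<in> coboundaries h"
    proof (intro coboundaries_add coboundaries_sum)
      show "hdiff h (const_cochain w) \<in> coboundaries h"
        using deg_cochain_imp_cochain[OF deg_const_cochain] by (auto simp: coboundaries_def)
      show "component 2 f - z3 \<rhd> s2 \<in> coboundaries h" using z3 by (simp add: coboundaries_deg_def)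
      show "component n f \<in> coboundaries h" if "n \<in> {3..<N}" for n
        using that by (intro high_coboundary[OF fn]) auto
    qed
    finally show "\<exists>z. (\<forall>s\<in>{s0, D1, D2, s2}. z s \<in> Acenter h) \<and>
        (\<lambda>xs. f xs - (\<Sum>s\<in>{s0, D1, D2, s2}. z s \<star> s xs)) \<in> coboundaries h"
      using z z0 z12 z3 by (intro exI[of _ z]) auto
  next
    fix z assume z: "\<forall>s\<in>{s0, D1, D2, s2}. z s \<in> Acenter h"
      and "(\<lambda>xs. \<Sum>s\<in>{s0, D1, D2, s2}. z s \<star> s xs) \<in> coboundaries h"
    then obtain g where g: "cochain g" and "(\<lambda>xs. \<Sum>s\<in>{s0, D1, D2, s2}. z s \<star> s xs) = hdiff h g"
      by (auto simp: coboundaries_def)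
    hence eq: "z s0 \<star> s0 xs + (z D1 \<star> D1 xs + (z D2 \<star> D2 xs + z s2 \<star> s2 xs)) = hdiff h g xs" for xs
      using sum[of z xs] by (simp add: fun_eq_iff)
    have "z s0 = 0" using eq[of "[]"] by (simp add: vals)
    moreover have "z D1 = 0 \<and> z D2 = 0"
    proof (rule HH1_indep[OF g1 D1 D2])
      show "z D1 \<star> D1 [a] + z D2 \<star> D2 [a] = a \<star> g [] - g [] \<star> a" for a
        using eq[of "[a]"] by (simp add: vals hdiff_Cons)
    qed (use z in auto)
    moreover have "z s2 = 0"
    proof (rule HH2_indep[OF g0 s2])
      show "z s2 \<star> s2 [a, b] = hdiff h g [a, b]" for a b
        using eq[of "[a, b]"] by (simp add: vals)
    qed (use z g in \<open>auto simp: cochain_def\<close>)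
    ultimately show "\<forall>s\<in>{s0, D1, D2, s2}. z s = 0" by simp
  qed simp
  with that show thesis by blast
qed

end

theorem theorem3p9:
  fixes h :: "'a::field_gcd poly"
  assumes "CHAR('a) > 0" and "h \<noteq> 0"
  shows "(HH_free h (cocycles_deg h 2) (coboundaries_deg h 2) \<longleftrightarrow> gcd h (pderiv h) = 1)
    \<and> (gcd h (pderiv h) = 1 \<longrightarrow>
         (\<exists>S. HH_basis h (cocycles_deg h 2) (coboundaries_deg h 2) S \<and> card S = 1)
         \<and> HH_free h (cocycles h) (coboundaries h))"
proof -
  interpret ore_algebra_char h "CHAR('a)"
    by unfold_locales (use assms in auto)
  have coprime: "ore_algebra_coprime h CHAR('a)" if "gcd h (pderiv h) = 1"
    by unfold_locales (use that in \<open>simp add: coprime_iff_gcd_eq_1\<close>)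
  have nf: "gcd h (pderiv h) = 1" if "HH_free h (cocycles_deg h 2) (coboundaries_deg h 2)"
    using that not_free by (auto simp: HH_free_def coprime_iff_gcd_eq_1)
  have basis: "\<exists>S. HH_basis h (cocycles_deg h 2) (coboundaries_deg h 2) S \<and> card S = 1"
    if "gcd h (pderiv h) = 1"
    using ore_algebra_coprime.HH2_basis[OF coprime[OF that]] by metis
  from basis have free: "HH_free h (cocycles_deg h 2) (coboundaries_deg h 2)"
    if "gcd h (pderiv h) = 1"
    using that by (auto simp: HH_free_def)
  have total: "HH_free h (cocycles h) (coboundaries h)" if "gcd h (pderiv h) = 1"
    using ore_algebra_coprime.HH_total_basis[OF coprime[OF that]] by (metis HH_free_def)
  show ?thesis
    by (intro conjI iffI impI) (fact nf free basis total)+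
qed

end
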